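(* Let $K$ be a field and let $n, r$ be integers with $r\ge 1$ and $n\ge 2r$. Let $R_{r+1}(X)=K[X]/I_{r+1}(X)$ be the Pfaffian ring of a generic skew-symmetric $n\times n$ matrix $X$ over $K$. For $i=1,2,\dots,r$ let $A_i=(r+i-1,\,r-i+1)$ and $E_i=(n-r+i-1,\,n-r-i+1)$ be lattice points in $\mathbb{Z}^2$. Let $\mathcal{P}^+(\mathbf{A}\to\mathbf{E})$ denote the set of all families $\mathbf{P}=(P_1,P_2,\dots,P_r)$ of nonintersecting lattice paths, where $P_i$ runs from $A_i$ to $E_i$ and never passes above the diagonal $x=y$, $i=1,2,\dots,r$. Then the Hilbert series of $R_{r+1}(X)$ equals $$\sum_{\ell=0}^{\infty}\dim_K R_{r+1}(X)_\ell\,z^\ell=\frac{\sum_{\mathbf{P}\in\mathcal{P}^+(\mathbf{A}\to\mathbf{E})} z^{\operatorname{NE}(\mathbf{P})}}{(1-z)^{r(2n-2r-1)}},$$ where $R_{r+1}(X)_\ell$ denotes the homogeneous component of degree $\ell$ in $R_{r+1}(X)$.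
   Context: Pfaffian ring: Let $X=(X_{i,j})_{1\le i,j\le n}$ be the skew-symmetric $n\times n$ matrix where $\{X_{i,j}: i<j\}$ are independent indeterminates over the field $K$, $X_{j,i}=-X_{i,j}$ and $X_{i,i}=0$. $K[X]$ is the polynomial ring over $K$ in the indeterminates $X_{i,j}$ ($i<j$), with the standard grading. The Pfaffian of a skew-symmetric $(2m)\times(2m)$ matrix $A$ is $\operatorname{Pf}(A)=\sum_{\pi}(-1)^{c(\pi)}\prod_{(ij)\in\pi}A_{ij}$, where the sum is over all perfect matchings $\pi$ of the complete graph on the vertices $1,\dots,2m$, the product is over all edges $(ij)$, $i<j$, of $\pi$, and $c(\pi)$ is the crossing number of $\pi$ (the number of pairs of edges $(ij),(kl)$ of $\pi$ with $i<k<j<l$). $I_{r+1}(X)$ is the ideal of $K[X]$ generated by all $(2r+2)\times(2r+2)$ Pfaffian minors of $X$, i.e. the Pfaffians of the submatrices of $X$ with rows and columns both indexed by $i_1<i_2<\dots<i_{2r+2}$ (if $n<2r+2$ there are none and the ideal is zero). The Pfaffian ring is $R_{r+1}(X)=K[X]/I_{r+1}(X)$, graded by degree. Lattice paths: A lattice path is a path in the plane integer lattice $\mathbb{Z}^2$ consisting of unit horizontal and vertical steps in the positive direction. A family of lattice paths is nonintersecting if no two paths of the family have a point in common. A North-East turn (NE-turn) of a path $P$ is a point of $P$ which is the end point of a vertical step and at the same time the starting point of a horizontal step. $\operatorname{NE}(P)$ is the number of NE-turns of $P$, and for a family $\mathbf{P}=(P_1,\dots,P_r)$, $\operatorname{NE}(\mathbf{P})=\sum_{i=1}^r\operatorname{NE}(P_i)$.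 *)

theory Defs
  imports
    "HOL-Algebra.Embedded_Algebras"
    "HOL-Algebra.QuotRing"
    "HOL-Library.Poly_Mapping"
    "HOL-Library.FuncSet"
    "HOL-Computational_Algebra.Formal_Power_Series"
begin

text \<open>A monomial is a finitely supported exponent function on index pairs; a polynomial
  is a finitely supported coefficient function on monomials. The type admits all
  pairs of naturals as variables, so the ring \<open>K[X]\<close> is carved out by its carrier: only
  the variables \<open>(i, j)\<close> with \<open>1 \<le> i < j \<le> n\<close> may occur.\<close>

type_synonym monomial = "(nat \<times> nat) \<Rightarrow>\<^sub>0 nat"
type_synonym 'k mpoly = "monomial \<Rightarrow>\<^sub>0 'k"

definition skew_vars :: "nat \<Rightarrow> (nat \<times> nat) set" where
  "skew_vars n = {(i, j). 1 \<le> i \<and> i < j \<and> j \<le> n}"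

definition skew_poly_ring :: "nat \<Rightarrow> ('k::field mpoly) ring" where
  "skew_poly_ring n =
     \<lparr>carrier = {p. \<forall>m \<in> Poly_Mapping.keys p. Poly_Mapping.keys m \<subseteq> skew_vars n},
      monoid.mult = (*), one = 1, zero = 0, add = (+)\<rparr>"

definition mpoly_const :: "'k::field \<Rightarrow> 'k mpoly" where
  "mpoly_const c = Poly_Mapping.single 0 c"

definition mpoly_var :: "nat \<times> nat \<Rightarrow> 'k::field mpoly" where
  "mpoly_var v = Poly_Mapping.single (Poly_Mapping.single v 1) 1"

definition total_degree :: "monomial \<Rightarrow> nat" where
  "total_degree m = (\<Sum>v \<in> Poly_Mapping.keys m. Poly_Mapping.lookup m v)"

definition homogeneous_part :: "nat \<Rightarrow> nat \<Rightarrow> 'k::field mpoly set" where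
  "homogeneous_part n l =
     {p \<in> carrier (skew_poly_ring n). \<forall>m \<in> Poly_Mapping.keys p. total_degree m = l}"

definition generic_skew :: "nat \<Rightarrow> nat \<Rightarrow> 'k::field mpoly" where
  "generic_skew i j =
     (if i < j then mpoly_var (i, j) else if j < i then - mpoly_var (j, i) else 0)"

text \<open>An edge is stored as the pair \<open>(i, j)\<close> with \<open>i < j\<close>.\<close>

definition perfect_matchings :: "nat \<Rightarrow> (nat \<times> nat) set set" where
  "perfect_matchings m =
     {M. M \<subseteq> {(i, j). 1 \<le> i \<and> i < j \<and> j \<le> 2 * m} \<and>
         (\<forall>v \<in> {1..2 * m}. \<exists>!e. e \<in> M \<and> (v = fst e \<or> v = snd e))}"

definition crossing_number :: "(nat \<times> nat) set \<Rightarrow> nat" where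
  "crossing_number M =
     card {((i, j), (k, l)) | i j k l. (i, j) \<in> M \<and> (k, l) \<in> M \<and> i < k \<and> k < j \<and> j < l}"

definition Pf :: "nat \<Rightarrow> (nat \<Rightarrow> nat \<Rightarrow> 'a::comm_ring_1) \<Rightarrow> 'a" where
  "Pf m A = (\<Sum>M \<in> perfect_matchings m. (- 1) ^ crossing_number M * (\<Prod>(i, j) \<in> M. A i j))"

text \<open>The function \<open>s\<close> enumerates the rows and columns \<open>i\<^sub>1 < \<dots> < i\<^sub>2\<^sub>t\<close> of the submatrix.\<close>

definition pfaffian_minors :: "nat \<Rightarrow> nat \<Rightarrow> 'k::field mpoly set" where
  "pfaffian_minors t n =
     {Pf t (\<lambda>a b. generic_skew (s a) (s b)) | s.
        strict_mono_on {1..2 * t} s \<and> s ` {1..2 * t} \<subseteq> {1..n}}"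

definition pfaffian_ideal :: "nat \<Rightarrow> nat \<Rightarrow> 'k::field mpoly set" where
  "pfaffian_ideal t n = Idl\<^bsub>skew_poly_ring n\<^esub> (pfaffian_minors t n)"

definition pfaffian_ring :: "nat \<Rightarrow> nat \<Rightarrow> ('k::field mpoly set) ring" where
  "pfaffian_ring t n = skew_poly_ring n Quot pfaffian_ideal t n"

definition residue_class :: "nat \<Rightarrow> nat \<Rightarrow> 'k::field mpoly \<Rightarrow> 'k mpoly set" where
  "residue_class t n p = pfaffian_ideal t n +>\<^bsub>skew_poly_ring n\<^esub> p"

definition pfaffian_ring_scalars :: "nat \<Rightarrow> nat \<Rightarrow> 'k::field mpoly set set" where
  "pfaffian_ring_scalars t n = residue_class t n ` range mpoly_const"

definition pfaffian_ring_part :: "nat \<Rightarrow> nat \<Rightarrow> nat \<Rightarrow> 'k::field mpoly set set" where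
  "pfaffian_ring_part t n l = residue_class t n ` homogeneous_part n l"

text \<open>The field \<open>K\<close> enters the dimension as its image in the quotient ring.\<close>

definition pfaffian_ring_dim :: "'k::field itself \<Rightarrow> nat \<Rightarrow> nat \<Rightarrow> nat \<Rightarrow> nat" where
  "pfaffian_ring_dim _ t n l =
     ring.dim (pfaffian_ring t n :: ('k mpoly set) ring)
       (pfaffian_ring_scalars t n) (pfaffian_ring_part t n l)"

text \<open>A lattice path is the list of the lattice points it visits. Since all steps are
  unit steps along the grid, two paths meet in the plane iff they share a lattice point.\<close>

type_synonym point = "int \<times> int"

definition horizontal_step :: "point \<Rightarrow> point \<Rightarrow> bool" where
  "horizontal_step p q \<longleftrightarrow> q = (fst p + 1, snd p)"

definition vertical_step :: "point \<Rightarrow> point \<Rightarrow> bool" where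
  "vertical_step p q \<longleftrightarrow> q = (fst p, snd p + 1)"

definition lattice_path :: "point list \<Rightarrow> bool" where
  "lattice_path P \<longleftrightarrow>
     P \<noteq> [] \<and> successively (\<lambda>p q. horizontal_step p q \<or> vertical_step p q) P"

definition path_from_to :: "point \<Rightarrow> point \<Rightarrow> point list \<Rightarrow> bool" where
  "path_from_to A E P \<longleftrightarrow> lattice_path P \<and> hd P = A \<and> last P = E"

definition below_diagonal :: "point list \<Rightarrow> bool" where
  "below_diagonal P \<longleftrightarrow> (\<forall>(x, y) \<in> set P. y \<le> x)"

definition NE_turns :: "point list \<Rightarrow> point set" where
  "NE_turns P =
     {P ! Suc k | k. Suc (Suc k) < length P \<and> vertical_step (P ! k) (P ! Suc k) \<and>
        horizontal_step (P ! Suc k) (P ! Suc (Suc k))}"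

definition NE :: "point list \<Rightarrow> nat" where
  "NE P = card (NE_turns P)"

text \<open>Families \<open>(P\<^sub>1, \<dots>, P\<^sub>r)\<close> are extensional functions on \<open>{1..r}\<close>, so that each family
  is counted once.\<close>

definition path_families ::
  "nat \<Rightarrow> (nat \<Rightarrow> point) \<Rightarrow> (nat \<Rightarrow> point) \<Rightarrow> (nat \<Rightarrow> point list) set" where
  "path_families r A E =
     {P \<in> (\<Pi>\<^sub>E i \<in> {1..r}. {Q. path_from_to (A i) (E i) Q \<and> below_diagonal Q}).
        \<forall>i \<in> {1..r}. \<forall>j \<in> {1..r}. i \<noteq> j \<longrightarrow> set (P i) \<inter> set (P j) = {}}"

definition NE_family :: "nat \<Rightarrow> (nat \<Rightarrow> point list) \<Rightarrow> nat" where
  "NE_family r P = (\<Sum>i = 1..r. NE (P i))"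

definition start_point :: "nat \<Rightarrow> nat \<Rightarrow> point" where
  "start_point r i = (int r + int i - 1, int r - int i + 1)"

definition end_point :: "nat \<Rightarrow> nat \<Rightarrow> nat \<Rightarrow> point" where
  "end_point n r i = (int n - int r + int i - 1, int n - int r - int i + 1)"

end

theory Submission
  imports Defs "HOL-Combinatorics.Transposition"
begin

text \<open>
  Call a set of variables nest-free if it contains no chain of \<open>r + 1\<close> pairs \<open>(i, j)\<close> strictly
  nested in each other. Among the terms of a Pfaffian minor of size \<open>2 r + 2\<close>, the fully nested
  matching is the unique one minimising \<open>\<Sum> i * j\<close>, so every monomial can be rewritten modulo the
  ideal into monomials with nest-free support. For the linear independence of the latter, cover the
  nest-free support of a monomial by \<open>r\<close> nonintersecting paths and map \<open>X\<^sub>i\<^sub>j\<close> to the entry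
  \<open>\<Sum>\<^sub>k (b\<^sub>k\<^sub>i a\<^sub>k\<^sub>j - a\<^sub>k\<^sub>i b\<^sub>k\<^sub>j)\<close> of a form of rank at most \<open>2 r\<close>, which kills the ideal. Convex
  potentials read off the \<open>k\<close>-th path grade the variables \<open>a\<^sub>k\<^sub>j\<close> and \<open>b\<^sub>k\<^sub>i\<close> so that \<open>b\<^sub>k\<^sub>i a\<^sub>k\<^sub>j\<close>
  has degree at least \<open>i * j\<close>, with equality exactly on that path; hence monomials supported on
  the paths have distinct monomials as initial forms.

  It remains to count monomials with nest-free support. Light shining from the diagonal onto a nest-free set \<open>F\<close>
  casts shadows whose successive boundaries form the only family of paths whose NE-turns lie in \<open>F\<close>
  and whose points cover \<open>F\<close>. Every family covers \<open>d = r (2 n - 2 r - 1)\<close> variables, so the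
  monomials whose support lies between its NE-turns and its points contribute
  \<open>z^NE / (1 - z)^d\<close>.
\<close>

section \<open>Vanishing of Pfaffians of low rank\<close>


text \<open>The weight \<open>i * j\<close> serves both halves because replacing two edges that are
  not nested by nested ones lowers it. Rewriting with a minor therefore raises the weight, which is
  bounded in each degree, while independence looks at terms of lowest degree. The obstacle to
  independence is that an entry of the form is a sum over all \<open>k\<close>, and a variable may
  lie on path \<open>k\<close> for different \<open>k\<close> in different families, so one grading
  cannot suit all nest-free monomials. The grading is chosen for a single monomial of least weight
  in a supposed relation. Any other monomial of the relation either lies on the same paths and has
  another leading monomial, or uses a variable off them, and then its image begins strictly above
  its own weight. Suitable potentials exist because a monotone path is a discrete subdifferential:
  the rows and columns it visits are the slopes of two conjugate convex functions for the pairing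
  \<open>i * j\<close>.

  The vanishing of Pfaffians must hold in characteristic 2 as well, so its sign argument is carried
  out over the integers. The exponent \<open>r * (2 * n - 2 * r - 1)\<close> is the dimension of the
  variety of skew-symmetric \<open>n\<close> by \<open>n\<close> matrices of rank at most
  \<open>2 * r\<close>.\<close>

lemma finite_perfect_matchings: "finite (perfect_matchings m)"
proof (rule finite_subset)
  show "perfect_matchings m \<subseteq> Pow ({..2 * m} \<times> {..2 * m})"
    by (auto simp: perfect_matchings_def)
qed simp

lemma perfect_matching_edge:
  assumes "M \<in> perfect_matchings m" "e \<in> M"
  shows "1 \<le> fst e" "fst e < snd e" "snd e \<le> 2 * m"
  using assms by (auto simp: perfect_matchings_def)

lemma finite_perfect_matching: "M \<in> perfect_matchings m \<Longrightarrow> finite M"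
  by (rule finite_subset[of _ "{..2 * m} \<times> {..2 * m}"]) (auto simp: perfect_matchings_def)

lemma perfect_matching_unique:
  assumes "M \<in> perfect_matchings m" "e \<in> M" "f \<in> M"
    and "v = fst e \<or> v = snd e" "v = fst f \<or> v = snd f"
  shows "e = f"
proof -
  have "v \<in> {1..2 * m}" using assms perfect_matching_edge[OF assms(1,2)] by auto
  then show ?thesis using assms unfolding perfect_matchings_def by blast
qed

lemma perfect_matching_cover:
  assumes "M \<in> perfect_matchings m" "v \<in> {1..2 * m}"
  obtains e where "e \<in> M" "v = fst e \<or> v = snd e"
  using assms unfolding perfect_matchings_def by blast

lemma perfect_matching_vertices:
  assumes "M \<in> perfect_matchings m"
  shows "(\<Union>e\<in>M. {fst e, snd e}) = {1..2 * m}"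
proof (intro equalityI subsetI)
  fix v assume "v \<in> (\<Union>e\<in>M. {fst e, snd e})"
  then obtain e where e: "e \<in> M" "v = fst e \<or> v = snd e" by blast
  then show "v \<in> {1..2 * m}" using perfect_matching_edge[OF assms e(1)] by auto
next
  fix v assume "v \<in> {1..2 * m}"
  then show "v \<in> (\<Union>e\<in>M. {fst e, snd e})" using perfect_matching_cover[OF assms] by blast
qed

lemma perfect_matching_disjoint:
  assumes "M \<in> perfect_matchings m" "e \<in> M" "f \<in> M" "e \<noteq> f"
  shows "{fst e, snd e} \<inter> {fst f, snd f} = {}"
  using perfect_matching_unique[OF assms(1-3)] assms(4) by auto

text \<open>Plain equations stand in for a class of homomorphisms because the lemma serves both
  \<open>of_int\<close> and the substitution \<open>rank_subst r\<close>.\<close>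

lemma Pf_hom:
  fixes h :: "'a::comm_ring_1 \<Rightarrow> 'b::comm_ring_1"
  assumes "h 0 = 0" "h 1 = 1" and add: "\<And>a b. h (a + b) = h a + h b"
    and mult: "\<And>a b. h (a * b) = h a * h b"
  shows "h (Pf m A) = Pf m (\<lambda>a b. h (A a b))"
proof -
  have hm: "h (- 1) = - 1" using add[of "-1" 1] assms(1,2) by (simp add: eq_neg_iff_add_eq_0)
  have hp: "h (x ^ k) = h x ^ k" for x k by (induction k) (auto simp: assms)
  have hs: "h (sum f S) = (\<Sum>x\<in>S. h (f x))" for f :: "(nat \<times> nat) set \<Rightarrow> 'a" and S
    by (induction S rule: infinite_finite_induct) (auto simp: assms)
  have hq: "h (prod f S) = (\<Prod>x\<in>S. h (f x))" for f :: "nat \<times> nat \<Rightarrow> 'a" and S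
    by (induction S rule: infinite_finite_induct) (auto simp: assms)
  show ?thesis unfolding Pf_def hs mult hp hm hq by (simp add: case_prod_unfold)
qed

section \<open>Relabelling two neighbouring vertices of a matching\<close>

definition cross :: "nat \<times> nat \<Rightarrow> nat \<times> nat \<Rightarrow> bool" where
  "cross e f \<longleftrightarrow> fst e < fst f \<and> fst f < snd e \<and> snd e < snd f"

text \<open>Written as a product over ordered pairs of edges, the sign can be compared factor by
  factor after a relabelling of the vertices.\<close>

lemma crossing_sign:
  assumes "finite M"
  shows "(- 1 :: 'a::comm_ring_1) ^ crossing_number M =
    (\<Prod>(e, f) \<in> M \<times> M. if cross e f then - 1 else 1)"
proof -
  have "{((i, j), (k, l)) | i j k l. (i, j) \<in> M \<and> (k, l) \<in> M \<and> i < k \<and> k < j \<and> j < l} =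
      {x \<in> M \<times> M. cross (fst x) (snd x)}" by (auto simp: cross_def)
  then have "(- 1 :: 'a) ^ crossing_number M = (\<Prod>x \<in> {x \<in> M \<times> M. cross (fst x) (snd x)}. - 1)"
    by (simp add: crossing_number_def)
  also have "\<dots> = (\<Prod>x \<in> M \<times> M. if cross (fst x) (snd x) then - 1 else 1)"
    using assms by (intro prod.mono_neutral_cong_left) auto
  finally show ?thesis by (simp add: case_prod_unfold)
qed

abbreviation adj_swap :: "nat \<Rightarrow> nat \<Rightarrow> nat" where
  "adj_swap p \<equiv> transpose p (Suc p)"

definition swap_edges :: "nat \<Rightarrow> (nat \<times> nat) set \<Rightarrow> (nat \<times> nat) set" where
  "swap_edges p M = map_prod (adj_swap p) (adj_swap p) ` M"

lemma adj_swap_less: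
  assumes "i < j" "(i, j) \<noteq> (p, Suc p)" shows "adj_swap p i < adj_swap p j"
  using assms by (auto simp: transpose_def)

lemma adj_swap_mem: "1 \<le> p \<Longrightarrow> Suc p \<le> N \<Longrightarrow> i \<in> {1..N} \<Longrightarrow> adj_swap p i \<in> {1..N}"
  by (auto simp: transpose_def)

lemma swap_edges_involutory: "swap_edges p (swap_edges p M) = M"
proof -
  have "map_prod (adj_swap p) (adj_swap p) (map_prod (adj_swap p) (adj_swap p) e) = e" for e
    by (cases e) simp
  then show ?thesis unfolding swap_edges_def image_image by simp
qed

lemma swap_edges_perfect:
  assumes M: "M \<in> perfect_matchings m" and p: "1 \<le> p" "Suc p \<le> 2 * m" and e: "(p, Suc p) \<notin> M"
  shows "swap_edges p M \<in> perfect_matchings m"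
proof -
  let ?t = "adj_swap p"
  have "\<exists>!e. e \<in> swap_edges p M \<and> (v = fst e \<or> v = snd e)" if v: "v \<in> {1..2 * m}" for v
  proof -
    obtain e where e: "e \<in> M" "?t v = fst e \<or> ?t v = snd e"
      using perfect_matching_cover[OF M adj_swap_mem[OF p v]] .
    show ?thesis
    proof (rule ex1I[of _ "map_prod ?t ?t e"])
      have "v = ?t (fst e) \<or> v = ?t (snd e)" using e(2) by (metis transpose_involutory)
      then show "map_prod ?t ?t e \<in> swap_edges p M \<and>
          (v = fst (map_prod ?t ?t e) \<or> v = snd (map_prod ?t ?t e))"
        using e by (auto simp: swap_edges_def)
    next
      fix f assume f: "f \<in> swap_edges p M \<and> (v = fst f \<or> v = snd f)"
      then obtain g where g: "g \<in> M" "f = map_prod ?t ?t g" by (auto simp: swap_edges_def)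
      then have "?t v = fst g \<or> ?t v = snd g" using f by auto
      then show "f = map_prod ?t ?t e" using perfect_matching_unique[OF M g(1) e(1)] g e by auto
    qed
  qed
  moreover have "1 \<le> ?t i \<and> ?t i < ?t j \<and> ?t j \<le> 2 * m" if "(i, j) \<in> M" for i j
  proof -
    have ij: "1 \<le> i" "i < j" "j \<le> 2 * m" using perfect_matching_edge[OF M that] by auto
    then show ?thesis using adj_swap_less[of i j p] e that adj_swap_mem[OF p, of i] adj_swap_mem[OF p, of j]
      by auto
  qed
  ultimately show ?thesis unfolding perfect_matchings_def by (auto simp: swap_edges_def)
qed

text \<open>Exchanging \<open>p\<close> and \<open>Suc p\<close> preserves the order of every other
  pair of vertices, so only the crossing between the edge at \<open>p\<close> and the edge at
  \<open>Suc p\<close> can change. These two edges are distinct because \<open>(p, Suc p)\<close> is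
  not an edge.\<close>

lemma swap_edges_sign:
  assumes M: "M \<in> perfect_matchings m" and p: "1 \<le> p" "Suc p \<le> 2 * m" and e: "(p, Suc p) \<notin> M"
  shows "(- 1 :: 'a::comm_ring_1) ^ crossing_number (swap_edges p M) = - ((- 1) ^ crossing_number M)"
proof -
  let ?t = "adj_swap p" and ?T = "map_prod (adj_swap p) (adj_swap p)"
  have fin: "finite M" using finite_perfect_matching[OF M] .
  obtain e1 where e1: "e1 \<in> M" "p = fst e1 \<or> p = snd e1"
    using perfect_matching_cover[OF M, of p] p by auto
  obtain e2 where e2: "e2 \<in> M" "Suc p = fst e2 \<or> Suc p = snd e2"
    using perfect_matching_cover[OF M, of "Suc p"] p by auto
  have lt: "fst e1 < snd e1" "fst e2 < snd e2" using perfect_matching_edge[OF M] e1 e2 by auto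
  have ne: "e1 \<noteq> e2"
  proof
    assume "e1 = e2"
    then have "e1 = (p, Suc p)" using e1 e2 lt by (cases e1) auto
    then show False using e e1 by simp
  qed
  have dj: "fst e1 \<noteq> fst e2" "fst e1 \<noteq> snd e2" "snd e1 \<noteq> fst e2" "snd e1 \<noteq> snd e2"
    using perfect_matching_disjoint[OF M e1(1) e2(1) ne] by auto
  define g g' :: "(nat \<times> nat) \<times> (nat \<times> nat) \<Rightarrow> 'a" where
    "g x = (if cross (fst x) (snd x) then - 1 else 1)" and
    "g' x = (if cross (?T (fst x)) (?T (snd x)) then - 1 else 1)" for x
  let ?P = "{(e1, e2), (e2, e1)}"
  have inj: "inj_on ?T M" by (intro inj_onI) (auto dest: transpose_eq_imp_eq)
  have "(- 1 :: 'a) ^ crossing_number (swap_edges p M) =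
      (\<Prod>x \<in> swap_edges p M \<times> swap_edges p M. g x)"
    using crossing_sign[of "swap_edges p M"] fin by (simp add: swap_edges_def g_def case_prod_unfold)
  also have "swap_edges p M \<times> swap_edges p M = map_prod ?T ?T ` (M \<times> M)"
    by (auto simp: swap_edges_def map_prod_surj_on)
  also have "(\<Prod>x \<in> map_prod ?T ?T ` (M \<times> M). g x) = (\<Prod>x \<in> M \<times> M. g' x)"
    by (subst prod.reindex) (auto simp: map_prod_inj_on inj g_def g'_def intro!: prod.cong)
  also have "\<dots> = (\<Prod>x \<in> M \<times> M - ?P. g' x) * (\<Prod>x \<in> ?P. g' x)"
    using fin e1 e2 by (intro prod.subset_diff) auto
  also have "(\<Prod>x \<in> M \<times> M - ?P. g' x) = (\<Prod>x \<in> M \<times> M - ?P. g x)"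
  proof (rule prod.cong)
    fix x assume x: "x \<in> M \<times> M - ?P"
    obtain i j k l where ijkl: "x = ((i, j), (k, l))" by (metis surj_pair)
    have xm: "(i, j) \<in> M" "(k, l) \<in> M" using x ijkl by auto
    have ij: "i < j" "k < l" using perfect_matching_edge[OF M xm(1)] perfect_matching_edge[OF M xm(2)] by auto
    have q1: "v = p \<Longrightarrow> v \<in> {i, j} \<Longrightarrow> (i, j) = e1" "v = p \<Longrightarrow> v \<in> {k, l} \<Longrightarrow> (k, l) = e1"
      "v = Suc p \<Longrightarrow> v \<in> {i, j} \<Longrightarrow> (i, j) = e2" "v = Suc p \<Longrightarrow> v \<in> {k, l} \<Longrightarrow> (k, l) = e2" for v
      using perfect_matching_unique[OF M xm(1) e1(1), of p] perfect_matching_unique[OF M xm(2) e1(1), of p]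
        perfect_matching_unique[OF M xm(1) e2(1), of "Suc p"] perfect_matching_unique[OF M xm(2) e2(1), of "Suc p"]
        e1 e2 by auto
    have ord: "?t a < ?t b \<longleftrightarrow> a < b" if "\<not> (a = p \<and> b = Suc p)" "\<not> (a = Suc p \<and> b = p)" for a b
      using that by (auto simp: transpose_def)
    have np: "\<not> (a = p \<and> b = Suc p)" "\<not> (b = p \<and> a = Suc p)" if "a \<in> {i, j}" "b \<in> {k, l}" for a b
      using q1[of a] q1[of b] that x ijkl ne by auto
    have np2: "\<not> (k = p \<and> j = Suc p)" "\<not> (k = Suc p \<and> j = p)" using np[of j k] by auto
    have "?t i < ?t k \<longleftrightarrow> i < k" by (rule ord) (use np[of i k] in auto)
    moreover have "?t k < ?t j \<longleftrightarrow> k < j" by (rule ord) (use np2 in auto)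
    moreover have "?t j < ?t l \<longleftrightarrow> j < l" by (rule ord) (use np[of j l] in auto)
    ultimately
    show "g' x = g x" by (simp add: g_def g'_def ijkl cross_def)
  qed simp
  also have "(\<Prod>x \<in> ?P. g' x) = - (\<Prod>x \<in> ?P. g x)"
  proof -
    obtain i j where ij: "e1 = (i, j)" by fastforce
    obtain k l where kl: "e2 = (k, l)" by fastforce
    have h: "i < j" "k < l" "i \<noteq> k" "i \<noteq> l" "j \<noteq> k" "j \<noteq> l" using lt dj ij kl by auto
    have c1: "i = p \<or> j = p" "k = Suc p \<or> l = Suc p" using e1 e2 ij kl by auto
    have o: "?t p = Suc p" "?t (Suc p) = p" "a \<noteq> p \<Longrightarrow> a \<noteq> Suc p \<Longrightarrow> ?t a = a" for a
      by (auto simp: transpose_def)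
    \<comment> \<open>In each of the four positions of the two edges, exactly one of the
      configurations before and after the exchange is a crossing.\<close>
    consider "i = p" "k = Suc p" | "i = p" "l = Suc p" | "j = p" "k = Suc p" | "j = p" "l = Suc p"
      using c1 by blast
    then have "g' (e1, e2) * g' (e2, e1) = - (g (e1, e2) * g (e2, e1))"
    proof cases
      case 1
      then have "?t i = Suc p" "?t k = p" "?t j = j" "?t l = l" using o h by auto
      then show ?thesis using 1 h by (auto simp: g_def g'_def cross_def ij kl)
    next
      case 2
      then have "?t i = Suc p" "?t k = k" "?t j = j" "?t l = p" using o h by auto
      then show ?thesis using 2 h by (auto simp: g_def g'_def cross_def ij kl)
    next
      case 3
      then have "?t i = i" "?t k = p" "?t j = Suc p" "?t l = l" using o h by auto
      then show ?thesis using 3 h by (auto simp: g_def g'_def cross_def ij kl)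
    next
      case 4
      then have "?t i = i" "?t k = k" "?t j = Suc p" "?t l = p" using o h by auto
      then show ?thesis using 4 h by (auto simp: g_def g'_def cross_def ij kl)
    qed
    then show ?thesis using ne by simp
  qed
  also have "(\<Prod>x \<in> M \<times> M - ?P. g x) * - (\<Prod>x \<in> ?P. g x) = - (\<Prod>x \<in> M \<times> M. g x)"
    using fin e1 e2 prod.subset_diff[of ?P "M \<times> M" g] by simp
  also have "(\<Prod>x \<in> M \<times> M. g x) = (- 1) ^ crossing_number M"
    using crossing_sign[OF fin, where 'a='a] by (simp add: g_def case_prod_unfold)
  finally show ?thesis .
qed

text \<open>The involution \<open>\<Phi>\<close> fixes the matchings that contain
  \<open>(p, Suc p)\<close> and relabels the others. The sign comes from skew symmetry of
  \<open>A\<close> in the former case and from the crossing number in the latter.\<close>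

lemma Pf_adj_swap:
  fixes A :: "nat \<Rightarrow> nat \<Rightarrow> 'a::comm_ring_1"
  assumes p: "1 \<le> p" "Suc p \<le> 2 * m" and skew: "\<And>x y. A y x = - A x y"
  shows "Pf m (\<lambda>a b. A (adj_swap p a) (adj_swap p b)) = - Pf m A"
proof -
  let ?t = "adj_swap p" and ?T = "map_prod (adj_swap p) (adj_swap p)"
  define \<Phi> where "\<Phi> M = (if (p, Suc p) \<in> M then M else swap_edges p M)" for M
  define G where "G M = (- 1) ^ crossing_number M * (\<Prod>(i, j) \<in> M. A i j)" for M
  have not_mem: "(p, Suc p) \<notin> swap_edges p M" if "M \<in> perfect_matchings m" for M
  proof
    assume "(p, Suc p) \<in> swap_edges p M"
    then obtain i j where "(i, j) \<in> M" "?t i = p" "?t j = Suc p" by (auto simp: swap_edges_def)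
    moreover from this have "i = Suc p" "j = p" by (metis transpose_apply_first transpose_apply_second transpose_involutory)+
    ultimately show False using perfect_matching_edge[OF that] by fastforce
  qed
  have \<Phi>: "\<Phi> M \<in> perfect_matchings m" "\<Phi> (\<Phi> M) = M" if "M \<in> perfect_matchings m" for M
    using swap_edges_perfect[OF that p] swap_edges_involutory not_mem[OF that] that
    by (auto simp: \<Phi>_def)
  have bij: "bij_betw \<Phi> (perfect_matchings m) (perfect_matchings m)"
    by (rule bij_betw_byWitness[of _ \<Phi>]) (use \<Phi> in auto)
  have "(- 1) ^ crossing_number M * (\<Prod>(i, j) \<in> M. A (?t i) (?t j)) = - G (\<Phi> M)"
    if M: "M \<in> perfect_matchings m" for M
  proof (cases "(p, Suc p) \<in> M")
    case True
    have fin: "finite M" using finite_perfect_matching[OF M] .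
    have "(\<Prod>(i, j) \<in> M. A (?t i) (?t j)) = A (Suc p) p * (\<Prod>(i, j) \<in> M - {(p, Suc p)}. A (?t i) (?t j))"
      using prod.remove[OF fin True, of "\<lambda>(i, j). A (?t i) (?t j)"] by simp
    also have "(\<Prod>(i, j) \<in> M - {(p, Suc p)}. A (?t i) (?t j)) = (\<Prod>(i, j) \<in> M - {(p, Suc p)}. A i j)"
    proof (rule prod.cong)
      fix e assume "e \<in> M - {(p, Suc p)}"
      then have "{fst e, snd e} \<inter> {fst (p, Suc p), snd (p, Suc p)} = {}"
        by (intro perfect_matching_disjoint[OF M _ True]) auto
      then show "(case e of (i, j) \<Rightarrow> A (?t i) (?t j)) = (case e of (i, j) \<Rightarrow> A i j)"
        by (auto simp: transpose_def split: prod.splits)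
    qed simp
    also have "A (Suc p) p = - A p (Suc p)" by (rule skew)
    also have "- A p (Suc p) * (\<Prod>(i, j) \<in> M - {(p, Suc p)}. A i j) = - (\<Prod>(i, j) \<in> M. A i j)"
      using prod.remove[OF fin True, of "\<lambda>(i, j). A i j"] by simp
    finally show ?thesis using True by (simp add: \<Phi>_def G_def)
  next
    case False
    have inj: "inj_on ?T M" by (intro inj_onI) (auto dest: transpose_eq_imp_eq)
    have "(\<Prod>(i, j) \<in> swap_edges p M. A i j) = (\<Prod>(i, j) \<in> M. A (?t i) (?t j))"
      unfolding swap_edges_def by (subst prod.reindex[OF inj]) (simp add: case_prod_unfold)
    then show ?thesis using False swap_edges_sign[OF M p False, where 'a='a] by (simp add: \<Phi>_def G_def)
  qed
  then have "Pf m (\<lambda>a b. A (?t a) (?t b)) = (\<Sum>M \<in> perfect_matchings m. - G (\<Phi> M))"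
    unfolding Pf_def by (intro sum.cong) auto
  also have "\<dots> = - (\<Sum>M \<in> perfect_matchings m. G M)"
    using sum.reindex_bij_betw[OF bij, of G] by (simp add: sum_negf)
  finally show ?thesis by (simp add: Pf_def G_def)
qed

text \<open>Exchanges of neighbours bring the equal rows together, and one more exchange gives
  \<open>Pf m A = - Pf m A\<close>. The entries are integers because this equation would say nothing
  in characteristic 2.\<close>

lemma Pf_equal_rows:
  fixes A :: "nat \<Rightarrow> nat \<Rightarrow> int"
  shows "1 \<le> p \<Longrightarrow> p < q \<Longrightarrow> q \<le> 2 * m \<Longrightarrow> (\<And>x y. A y x = - A x y) \<Longrightarrow>
    (\<And>x. A p x = A q x) \<Longrightarrow> Pf m A = 0"
proof (induction "q - p" arbitrary: q A)
  case 0
  show ?case using "0.hyps" "0.prems"(2) by simp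
next
  case (Suc d)
  have rows: "A x p = A x q" for x
    using Suc.prems(4)[of x p] Suc.prems(4)[of x q] Suc.prems(5)[of x] by simp
  let ?t = "adj_swap (q - 1)"
  have q: "1 \<le> q - 1" "Suc (q - 1) \<le> 2 * m" "Suc (q - 1) = q" using Suc.prems(1-3) by auto
  have swap: "Pf m (\<lambda>a b. A (?t a) (?t b)) = - Pf m A"
    using Pf_adj_swap[OF q(1,2) Suc.prems(4)] .
  show ?case
  proof (cases "p = q - 1")
    case True
    then have "A (?t a) (?t b) = A a b" for a b
      using rows Suc.prems(5) q(3) by (auto simp: transpose_def)
    then show ?thesis using swap by simp
  next
    case False
    have tp: "?t p = p" "?t (q - 1) = q" using False Suc.prems(1-3) q(3) by (auto simp: transpose_def)
    have "Pf m (\<lambda>a b. A (?t a) (?t b)) = 0"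
    proof (rule Suc.hyps(1)[of "q - 1"])
      show "d = q - 1 - p" using Suc.hyps(2) by simp
      show "p < q - 1" "q - 1 \<le> 2 * m" using False Suc.prems(2,3) by simp_all
      show "A (?t y) (?t x) = - A (?t x) (?t y)" for x y by (rule Suc.prems(4))
      show "A (?t p) (?t x) = A (?t (q - 1)) (?t x)" for x unfolding tp by (rule Suc.prems(5))
    qed (rule Suc.prems(1))
    then show ?thesis using swap by simp
  qed
qed

text \<open>As the edges are disjoint, choosing two indices for every edge amounts to choosing one
  function on the covered vertices; the rest is distributivity.\<close>

lemma prod_double_sum:
  fixes h :: "nat \<times> nat \<Rightarrow> 'b \<Rightarrow> 'b \<Rightarrow> 'a::comm_semiring_1"
  assumes "finite M" "finite E"
    and "\<And>e. e \<in> M \<Longrightarrow> fst e \<noteq> snd e"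
    and "\<And>e f. e \<in> M \<Longrightarrow> f \<in> M \<Longrightarrow> e \<noteq> f \<Longrightarrow> {fst e, snd e} \<inter> {fst f, snd f} = {}"
  shows "(\<Prod>e \<in> M. \<Sum>x\<in>E. \<Sum>y\<in>E. h e x y) =
    (\<Sum>f \<in> (\<Union>e\<in>M. {fst e, snd e}) \<rightarrow>\<^sub>E E. \<Prod>e \<in> M. h e (f (fst e)) (f (snd e)))"
  using assms
proof (induction M rule: finite_induct)
  case empty
  then show ?case by simp
next
  case (insert e M)
  define V where "V = (\<Union>e\<in>M. {fst e, snd e})"
  obtain a b where e: "e = (a, b)" by fastforce
  have ab: "a \<noteq> b" using insert.prems(2)[of e] e by simp
  have dj: "a \<notin> {fst f, snd f} \<and> b \<notin> {fst f, snd f}" if "f \<in> M" for f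
  proof -
    have "e \<noteq> f" using insert.hyps(2) that by blast
    then show ?thesis using insert.prems(3)[of e f] that e by auto
  qed
  then have aV: "a \<notin> insert b V" "b \<notin> V" using ab by (auto simp: V_def)
  have ins: "(\<Union>e\<in>insert e M. {fst e, snd e}) = insert a (insert b V)" by (auto simp: e V_def)
  have IH: "(\<Prod>e \<in> M. \<Sum>x\<in>E. \<Sum>y\<in>E. h e x y) =
    (\<Sum>f \<in> V \<rightarrow>\<^sub>E E. \<Prod>e \<in> M. h e (f (fst e)) (f (snd e)))"
    unfolding V_def by (rule insert.IH) (use insert.prems in auto)
  have split: "(\<Sum>f \<in> insert v W \<rightarrow>\<^sub>E E. F f) = (\<Sum>x\<in>E. \<Sum>f \<in> W \<rightarrow>\<^sub>E E. F (f(v := x)))"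
    if "v \<notin> W" for v W and F :: "(nat \<Rightarrow> 'b) \<Rightarrow> 'a"
    unfolding PiE_insert_eq
    by (subst sum.reindex[OF inj_combinator[OF that]])
      (simp add: sum.cartesian_product case_prod_unfold)
  have "(\<Sum>f \<in> insert a (insert b V) \<rightarrow>\<^sub>E E. \<Prod>e \<in> insert e M. h e (f (fst e)) (f (snd e))) =
    (\<Sum>x\<in>E. \<Sum>y\<in>E. \<Sum>f \<in> V \<rightarrow>\<^sub>E E. h e x y * (\<Prod>e \<in> M. h e (f (fst e)) (f (snd e))))"
    unfolding split[OF aV(1)] split[OF aV(2)]
  proof (intro sum.cong refl)
    fix x y f
    have "(\<Prod>e \<in> M. h e ((f(b := y, a := x)) (fst e)) ((f(b := y, a := x)) (snd e))) =
      (\<Prod>e \<in> M. h e (f (fst e)) (f (snd e)))"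
      using dj by (intro prod.cong) auto
    then show "(\<Prod>e \<in> insert e M. h e ((f(b := y, a := x)) (fst e)) ((f(b := y, a := x)) (snd e))) =
      h e x y * (\<Prod>e \<in> M. h e (f (fst e)) (f (snd e)))"
      using insert.hyps ab by (simp add: e)
  qed
  also have "\<dots> = (\<Sum>x\<in>E. \<Sum>y\<in>E. h e x y) * (\<Prod>e \<in> M. \<Sum>x\<in>E. \<Sum>y\<in>E. h e x y)"
    unfolding IH by (simp only: sum_distrib_right) (simp only: sum_distrib_left)
  finally show ?case unfolding ins prod.insert[OF insert.hyps(1,2)] by (rule sym)
qed

text \<open>The matrix is a product of \<open>C\<close>, \<open>G\<close> and the transpose of
  \<open>C\<close>. Expanding gives a combination of Pfaffians of matrices
  \<open>G (f a) (f b)\<close>, and with fewer than \<open>2 * m\<close> indices some value of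
  \<open>f\<close> repeats, which produces equal rows. Integrality of \<open>G\<close> allows the
  vanishing to be shown over the integers and carried over by \<open>of_int\<close>.\<close>

lemma Pf_low_rank:
  fixes C :: "nat \<Rightarrow> 'b \<Rightarrow> 'a::comm_ring_1" and G :: "'b \<Rightarrow> 'b \<Rightarrow> int"
  assumes E: "finite E" "card E < 2 * m" and skew: "\<And>x y. G y x = - G x y"
  shows "Pf m (\<lambda>a b. \<Sum>x\<in>E. \<Sum>y\<in>E. C a x * C b y * of_int (G x y)) = 0"
proof -
  let ?V = "{1..2 * m}"
  have M: "(\<Prod>(a, b) \<in> M. \<Sum>x\<in>E. \<Sum>y\<in>E. C a x * C b y * of_int (G x y)) =
    (\<Sum>f \<in> ?V \<rightarrow>\<^sub>E E. (\<Prod>v \<in> ?V. C v (f v)) * (\<Prod>(a, b) \<in> M. of_int (G (f a) (f b))))"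
    if "M \<in> perfect_matchings m" for M
  proof -
    note dj = perfect_matching_disjoint[OF that] and V = perfect_matching_vertices[OF that]
      and fin = finite_perfect_matching[OF that] and lt = perfect_matching_edge(2)[OF that]
    have "(\<Prod>e \<in> M. \<Sum>x\<in>E. \<Sum>y\<in>E. C (fst e) x * C (snd e) y * of_int (G x y)) =
      (\<Sum>f \<in> ?V \<rightarrow>\<^sub>E E. \<Prod>e \<in> M. C (fst e) (f (fst e)) * C (snd e) (f (snd e)) * of_int (G (f (fst e)) (f (snd e))))"
      unfolding V[symmetric]
    proof (rule prod_double_sum[OF fin E(1)])
      show "fst e \<noteq> snd e" if "e \<in> M" for e using lt[OF that] by simp
    qed (rule dj)
    moreover have "(\<Prod>e \<in> M. C (fst e) (f (fst e)) * C (snd e) (f (snd e))) = (\<Prod>v \<in> ?V. C v (f v))" for f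
    proof -
      have "(\<Prod>v \<in> (\<Union>e\<in>M. {fst e, snd e}). C v (f v)) = (\<Prod>e \<in> M. \<Prod>v \<in> {fst e, snd e}. C v (f v))"
        by (rule prod.UNION_disjoint) (use fin dj in auto)
      also have "\<dots> = (\<Prod>e \<in> M. C (fst e) (f (fst e)) * C (snd e) (f (snd e)))"
      proof (rule prod.cong)
        fix e assume "e \<in> M"
        then have "fst e \<noteq> snd e" using lt by fastforce
        then show "(\<Prod>v \<in> {fst e, snd e}. C v (f v)) = C (fst e) (f (fst e)) * C (snd e) (f (snd e))"
          by simp
      qed simp
      finally show ?thesis by (simp add: V)
    qed
    ultimately show ?thesis by (simp add: prod.distrib case_prod_unfold)
  qed
  have "Pf m (\<lambda>a b. \<Sum>x\<in>E. \<Sum>y\<in>E. C a x * C b y * of_int (G x y)) =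
    (\<Sum>M \<in> perfect_matchings m. \<Sum>f \<in> ?V \<rightarrow>\<^sub>E E. (\<Prod>v \<in> ?V. C v (f v)) *
      ((- 1) ^ crossing_number M * (\<Prod>(a, b) \<in> M. of_int (G (f a) (f b)))))"
    unfolding Pf_def using M by (intro sum.cong) (auto simp: sum_distrib_left algebra_simps)
  also have "\<dots> = (\<Sum>f \<in> ?V \<rightarrow>\<^sub>E E. (\<Prod>v \<in> ?V. C v (f v)) * Pf m (\<lambda>a b. of_int (G (f a) (f b))))"
    unfolding Pf_def sum_distrib_left by (rule sum.swap)
  also have "\<dots> = 0"
  proof (rule sum.neutral, clarify)
    fix f assume f: "f \<in> ?V \<rightarrow>\<^sub>E E"
    have "\<not> inj_on f ?V"
    proof
      assume "inj_on f ?V"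
      then have "card ?V \<le> card E" using f E by (intro card_inj_on_le[of f]) (auto simp: PiE_def)
      then show False using E by simp
    qed
    then obtain p q where pq: "p \<in> ?V" "q \<in> ?V" "f p = f q" "p < q"
      unfolding inj_on_def by (metis linorder_neqE_nat)
    have "Pf m (\<lambda>a b. G (f a) (f b)) = 0"
    proof (rule Pf_equal_rows[of p q])
      show "G (f y) (f x) = - G (f x) (f y)" for x y by (rule skew)
    qed (use pq in auto)
    then have "Pf m (\<lambda>a b. of_int (G (f a) (f b)) :: 'a) = 0"
      using Pf_hom[of "of_int :: int \<Rightarrow> 'a" m "\<lambda>a b. G (f a) (f b)"] by simp
    then show "(\<Prod>v \<in> ?V. C v (f v)) * Pf m (\<lambda>a b. of_int (G (f a) (f b))) = 0" by simp
  qed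
  finally show ?thesis .
qed

section \<open>Nest-free sets and families of paths\<close>


definition inside :: "nat \<times> nat \<Rightarrow> nat \<times> nat \<Rightarrow> bool" where
  "inside f g \<longleftrightarrow> fst g < fst f \<and> snd f < snd g"

text \<open>The members of \<open>F\<close> at the outer end of a chain of \<open>k + 1\<close>
  nested members. The levels decrease with \<open>k\<close>, so an element need not have a single
  depth; emptiness of \<open>nest_level F r\<close> is the nest-free condition.\<close>

primrec nest_level :: "(nat \<times> nat) set \<Rightarrow> nat \<Rightarrow> (nat \<times> nat) set" where
  "nest_level F 0 = F"
| "nest_level F (Suc k) = {g \<in> F. \<exists>f \<in> nest_level F k. inside f g}"

definition vsum :: "nat \<times> nat \<Rightarrow> int" where
  "vsum v = int (fst v) + int (snd v)"

text \<open>The column in which the antidiagonal \<open>s\<close> meets the hook of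
  \<open>f\<close>: up the column of \<open>f\<close> as far as \<open>f\<close>, then along its
  row. The hook bounds the shadow of \<open>f\<close>, and its only NE-turn is \<open>f\<close>
  itself.\<close>

definition reach :: "nat \<times> nat \<Rightarrow> int \<Rightarrow> int" where
  "reach f s = int (snd f) + max 0 (s - vsum f)"

lemma nest_level_subset: "nest_level F k \<subseteq> F"
  by (cases k) auto

lemma nest_level_mono: "F \<subseteq> G \<Longrightarrow> nest_level F k \<subseteq> nest_level G k"
  by (induction k) auto

lemma nest_level_iff_chain:
  "g \<in> nest_level F k \<longleftrightarrow>
     (\<exists>c. c k = g \<and> (\<forall>a\<le>k. c a \<in> F) \<and> (\<forall>a<k. inside (c a) (c (Suc a))))"
proof (induction k arbitrary: g)
  case 0
  show ?case by auto
next
  case (Suc k)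
  show ?case
  proof
    assume "g \<in> nest_level F (Suc k)"
    then obtain f where g: "g \<in> F" and f: "f \<in> nest_level F k" and fg: "inside f g" by auto
    from Suc.IH f obtain c where c: "c k = f" "\<forall>a\<le>k. c a \<in> F"
      "\<forall>a<k. inside (c a) (c (Suc a))" by blast
    let ?c = "c(Suc k := g)"
    have "?c (Suc k) = g \<and> (\<forall>a\<le>Suc k. ?c a \<in> F) \<and> (\<forall>a<Suc k. inside (?c a) (?c (Suc a)))"
      using c g fg by (auto simp: le_Suc_eq less_Suc_eq)
    then show "\<exists>c. c (Suc k) = g \<and> (\<forall>a\<le>Suc k. c a \<in> F) \<and> (\<forall>a<Suc k. inside (c a) (c (Suc a)))"
      by blast
  next
    assume "\<exists>c. c (Suc k) = g \<and> (\<forall>a\<le>Suc k. c a \<in> F) \<and> (\<forall>a<Suc k. inside (c a) (c (Suc a)))"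
    then obtain c where c: "c (Suc k) = g" "\<forall>a\<le>Suc k. c a \<in> F"
      "\<forall>a<Suc k. inside (c a) (c (Suc a))" by blast
    then have "c k \<in> nest_level F k" using Suc.IH by (metis le_SucI less_SucI)
    then show "g \<in> nest_level F (Suc k)" using c by auto
  qed
qed

text \<open>This turns nesting into a comparison of columns on one antidiagonal, the form in which
  it can be compared with paths.\<close>

lemma inside_reach: "inside f g \<longleftrightarrow> reach f (vsum g) < int (snd g)"
  by (auto simp: inside_def reach_def vsum_def max_def)

lemma reach_step: "reach f (s + 1) = reach f s \<or> reach f (s + 1) = reach f s + 1"
  by (auto simp: reach_def max_def)

lemma inside_reach_less: "inside f g \<Longrightarrow> reach f s < reach g s"
  by (auto simp: inside_def reach_def vsum_def max_def)

lemma reach_self [simp]: "reach f (vsum f) = int (snd f)"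
  by (simp add: reach_def)

lemma reach_diag: "fst f < snd f \<Longrightarrow> s < 2 * reach f s"
  by (auto simp: reach_def vsum_def max_def)

text \<open>The lower envelope of the hooks of one level, that is, the boundary of the union of
  their shadows.\<close>

definition nest_min :: "(nat \<times> nat) set \<Rightarrow> nat \<Rightarrow> int \<Rightarrow> int" where
  "nest_min G k s = Min ((\<lambda>f. reach f s) ` nest_level G k)"

text \<open>With \<open>c 0\<close> innermost, every member must leave room for \<open>a\<close>
  members inside it and \<open>k - a\<close> members around it.\<close>

lemma chain_bounds:
  assumes F: "F \<subseteq> skew_vars n" and c: "\<forall>a\<le>k. c a \<in> F" "\<forall>a<k. inside (c a) (c (Suc a))"
    and a: "a \<le> k"
  shows "snd (c a) \<ge> fst (c a) + 1 + 2 * a" and "fst (c a) \<ge> 1 + (k - a)"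
    and "snd (c a) + (k - a) \<le> n"
proof -
  show "snd (c a) \<ge> fst (c a) + 1 + 2 * a" using a
  proof (induction a)
    case 0
    then show ?case using c(1) F by (auto simp: skew_vars_def)
  next
    case (Suc a)
    then have "inside (c a) (c (Suc a))" using c(2) by simp
    then show ?case using Suc by (auto simp: inside_def)
  qed
  have "fst (c (k - b)) \<ge> 1 + b \<and> snd (c (k - b)) + b \<le> n" if "b \<le> k" for b using that
  proof (induction b)
    case 0
    then show ?case using c(1) F by (auto simp: skew_vars_def)
  next
    case (Suc b)
    then have "inside (c (k - Suc b)) (c (k - b))"
      using c(2)[rule_format, of "k - Suc b"] by (simp add: Suc_diff_Suc)
    then show ?case using Suc by (auto simp: inside_def)
  qed
  from this[of "k - a"] a show "fst (c a) \<ge> 1 + (k - a)" "snd (c a) + (k - a) \<le> n" by auto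
qed

section \<open>The strip of antidiagonals between the start and end points\<close>

locale pfaffian_setting =
  fixes n r :: nat
  assumes r_pos: "1 \<le> r" and n_ge: "2 * r \<le> n"
begin

text \<open>With the lattice point \<open>(x, y)\<close> read as the variable
  \<open>(y, x + 1)\<close>, all start points lie on the antidiagonal \<open>lo\<close> and all end
  points on \<open>hi\<close>.\<close>

definition lo :: int where "lo = 2 * int r + 1"
definition hi :: int where "hi = 2 * int n - 2 * int r + 1"

lemma lo_le_hi: "lo \<le> hi"
  using n_ge by (auto simp: lo_def hi_def)

definition zigzag :: "nat \<Rightarrow> int \<Rightarrow> int" where
  "zigzag k s = s div 2 + int k + 1"

text \<open>A family \<open>q\<close> gives for every path \<open>k\<close> and every antidiagonal \<open>i + j = s\<close> the column
  \<open>j\<close> in which the path crosses it. The paths are prolonged by zigzags below \<open>lo\<close> and above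
  \<open>hi\<close>, so that they also sweep out the variables that lie in no nesting of \<open>r + 1\<close>.\<close>

definition good_family :: "(nat \<Rightarrow> int \<Rightarrow> int) \<Rightarrow> bool" where
  "good_family q \<longleftrightarrow>
     (\<forall>k<r. \<forall>s. q k (s + 1) = q k s \<or> q k (s + 1) = q k s + 1) \<and>
     (\<forall>k<r. \<forall>s. s \<le> lo \<or> hi \<le> s \<longrightarrow> q k s = zigzag k s) \<and>
     (\<forall>k. Suc k < r \<longrightarrow> (\<forall>s. q k s < q (Suc k) s)) \<and>
     (\<forall>s. s < 2 * q 0 s)"

definition covers :: "(nat \<Rightarrow> int \<Rightarrow> int) \<Rightarrow> (nat \<times> nat) set" where
  "covers q = {v \<in> skew_vars n. \<exists>k<r. q k (vsum v) = int (snd v)}"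

text \<open>A constant column is a vertical step and an increasing one a horizontal step. The strict
  bounds exclude the end points and the corners of the zigzags, which are not NE-turns of the finite
  paths.\<close>

definition turn_at :: "(int \<Rightarrow> int) \<Rightarrow> int \<Rightarrow> bool" where
  "turn_at p s \<longleftrightarrow> lo < s \<and> s < hi \<and> p (s - 1) = p s \<and> p (s + 1) = p s + 1"

definition turns :: "(nat \<Rightarrow> int \<Rightarrow> int) \<Rightarrow> (nat \<times> nat) set" where
  "turns q = {v \<in> skew_vars n. \<exists>k<r. q k (vsum v) = int (snd v) \<and> turn_at (q k) (vsum v)}"

definition start_var :: "nat \<Rightarrow> nat \<times> nat" where "start_var k = (r - k, r + 1 + k)"
definition end_var :: "nat \<Rightarrow> nat \<times> nat" where "end_var k = (n - r - k, n - r + k + 1)"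

text \<open>The end points act as additional obstacles to the light: they make every level below
  \<open>r\<close> nonempty, so that its minimum is meaningful, and they force the boundaries
  through the prescribed ends. Variables outside the strip are left to the zigzags.\<close>

definition trunc :: "(nat \<times> nat) set \<Rightarrow> (nat \<times> nat) set" where
  "trunc F = {f \<in> F. lo \<le> vsum f \<and> vsum f \<le> hi} \<union> start_var ` {..<r} \<union> end_var ` {..<r}"

lemma start_var_props:
  assumes "k < r"
  shows "start_var k \<in> skew_vars n" "vsum (start_var k) = lo" "int (snd (start_var k)) = zigzag k lo"
  using assms n_ge by (auto simp: start_var_def skew_vars_def vsum_def lo_def zigzag_def)

lemma end_var_props:
  assumes "k < r"
  shows "end_var k \<in> skew_vars n" "vsum (end_var k) = hi" "int (snd (end_var k)) = zigzag k hi"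
  using assms n_ge by (auto simp: end_var_def skew_vars_def vsum_def hi_def zigzag_def)

lemma trunc_subset: "F \<subseteq> skew_vars n \<Longrightarrow> trunc F \<subseteq> skew_vars n"
  using start_var_props end_var_props by (auto simp: trunc_def)

lemma finite_skew_vars: "finite (skew_vars n)"
  by (rule finite_subset[of _ "{..n} \<times> {..n}"]) (auto simp: skew_vars_def)

lemma trunc_vsum: "f \<in> trunc F \<Longrightarrow> lo \<le> vsum f \<and> vsum f \<le> hi"
  using start_var_props end_var_props lo_le_hi by (auto simp: trunc_def)

text \<open>Members of a chain of \<open>r + 1\<close> lie strictly between the antidiagonals
  \<open>lo\<close> and \<open>hi\<close>, so none of the added end points can take part in
  one.\<close>

lemma nest_free_trunc:
  assumes F: "F \<subseteq> skew_vars n" and free: "nest_level F r = {}"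
  shows "nest_level (trunc F) r = {}"
proof (rule ccontr)
  assume "nest_level (trunc F) r \<noteq> {}"
  then obtain c where c: "\<forall>a\<le>r. c a \<in> trunc F" "\<forall>a<r. inside (c a) (c (Suc a))"
    by (metis all_not_in_conv nest_level_iff_chain)
  have "c a \<in> F" if a: "a \<le> r" for a
  proof -
    note b = chain_bounds[OF trunc_subset[OF F] c a]
    have "lo < vsum (c a)" "vsum (c a) < hi"
      using b a n_ge by (auto simp: lo_def hi_def vsum_def)
    then show ?thesis using c(1) a start_var_props(2) end_var_props(2)
      by (fastforce simp: trunc_def)
  qed
  then have "c r \<in> nest_level F r" using c nest_level_iff_chain by blast
  then show False using free by simp
qed

lemma start_var_level: "k < r \<Longrightarrow> start_var k \<in> nest_level (trunc F) k"
proof (induction k)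
  case 0
  then show ?case by (auto simp: trunc_def)
next
  case (Suc k)
  have "inside (start_var k) (start_var (Suc k))" using Suc.prems by (auto simp: inside_def start_var_def)
  then show ?case using Suc by (auto simp: trunc_def)
qed

lemma end_var_level: "k < r \<Longrightarrow> end_var k \<in> nest_level (trunc F) k"
proof (induction k)
  case 0
  then show ?case by (auto simp: trunc_def)
next
  case (Suc k)
  have "inside (end_var k) (end_var (Suc k))" using Suc.prems n_ge by (auto simp: inside_def end_var_def)
  then show ?case using Suc by (auto simp: trunc_def)
qed

section \<open>The paths cast by a set of variables\<close>

context
  fixes F :: "(nat \<times> nat) set"
  assumes F: "F \<subseteq> skew_vars n"
begin

lemma finite_level: "finite (nest_level (trunc F) k)"
  using finite_skew_vars trunc_subset[OF F] nest_level_subset by (meson finite_subset)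

lemma nest_min_le: "f \<in> nest_level (trunc F) k \<Longrightarrow> nest_min (trunc F) k s \<le> reach f s"
  unfolding nest_min_def using finite_level by simp

lemma nest_min_attained:
  "k < r \<Longrightarrow> \<exists>f \<in> nest_level (trunc F) k. nest_min (trunc F) k s = reach f s"
proof -
  assume k: "k < r"
  have "Min ((\<lambda>f. reach f s) ` nest_level (trunc F) k) \<in> (\<lambda>f. reach f s) ` nest_level (trunc F) k"
    by (rule Min_in) (use finite_level start_var_level[OF k] in auto)
  then show ?thesis unfolding nest_min_def by blast
qed

lemma nest_min_step:
  assumes k: "k < r"
  shows "nest_min (trunc F) k (s + 1) = nest_min (trunc F) k s \<or>
    nest_min (trunc F) k (s + 1) = nest_min (trunc F) k s + 1"
proof -
  obtain f where f: "f \<in> nest_level (trunc F) k" "nest_min (trunc F) k s = reach f s"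
    using nest_min_attained[OF k] by blast
  obtain g where g: "g \<in> nest_level (trunc F) k" "nest_min (trunc F) k (s + 1) = reach g (s + 1)"
    using nest_min_attained[OF k] by blast
  show ?thesis
    using nest_min_le[OF f(1), of "s+1"] nest_min_le[OF g(1), of s] f(2) g(2)
      reach_step[of f s] reach_step[of g s] by linarith
qed

lemma nest_min_strict:
  assumes k: "Suc k < r"
  shows "nest_min (trunc F) k s < nest_min (trunc F) (Suc k) s"
proof -
  obtain g where g: "g \<in> nest_level (trunc F) (Suc k)" "nest_min (trunc F) (Suc k) s = reach g s"
    using nest_min_attained[OF k] by blast
  then obtain f where "f \<in> nest_level (trunc F) k" "inside f g" by auto
  then show ?thesis using nest_min_le[of f k s] inside_reach_less[of f g s] g(2) by linarith
qed

lemma nest_min_diag: "s < 2 * nest_min (trunc F) 0 s"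
proof -
  have "0 < r" using r_pos by simp
  then obtain f where f: "f \<in> nest_level (trunc F) 0" "nest_min (trunc F) 0 s = reach f s"
    using nest_min_attained by blast
  then have "fst f < snd f" using trunc_subset[OF F] by (auto simp: skew_vars_def)
  then show ?thesis using reach_diag f(2) by simp
qed

lemma nest_min_lower: "k < r \<Longrightarrow> nest_min (trunc F) 0 s + int k \<le> nest_min (trunc F) k s"
proof (induction k)
  case 0
  then show ?case by simp
next
  case (Suc k)
  then show ?case using nest_min_strict[of k s] by simp
qed

text \<open>The value is squeezed: \<open>start_var k\<close> bounds it from above, while the
  diagonal condition for level 0 and the strict increase from level to level bound it from
  below.\<close>

lemma nest_min_lo: "k < r \<Longrightarrow> nest_min (trunc F) k lo = zigzag k lo"
  using nest_min_le[OF start_var_level, of k lo] start_var_props[of k] nest_min_lower[of k lo]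
    nest_min_diag[of lo] reach_self[of "start_var k"]
  by (auto simp: zigzag_def lo_def)

lemma nest_min_hi: "k < r \<Longrightarrow> nest_min (trunc F) k hi = zigzag k hi"
  using nest_min_le[OF end_var_level, of k hi] end_var_props[of k] nest_min_lower[of k hi]
    nest_min_diag[of hi] reach_self[of "end_var k"]
  by (auto simp: zigzag_def hi_def)

end

definition light_family :: "(nat \<times> nat) set \<Rightarrow> nat \<Rightarrow> int \<Rightarrow> int" where
  "light_family F k s = (if lo \<le> s \<and> s \<le> hi then nest_min (trunc F) k s else zigzag k s)"

lemma light_family_good:
  assumes F: "F \<subseteq> skew_vars n"
  shows "good_family (light_family F)"
  unfolding good_family_def
proof (intro conjI allI impI)
  fix k s assume k: "k < r"
  have z: "zigzag k (s + 1) = zigzag k s \<or> zigzag k (s + 1) = zigzag k s + 1"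
    unfolding zigzag_def by linarith
  consider "lo \<le> s" "s + 1 \<le> hi" | "s + 1 = lo" | "s = hi" | "s + 1 < lo \<or> hi < s" by linarith
  then show "light_family F k (s + 1) = light_family F k s \<or>
      light_family F k (s + 1) = light_family F k s + 1"
    by cases (use z nest_min_step[OF F k, of s] nest_min_lo[OF F k] nest_min_hi[OF F k] lo_le_hi
        in \<open>auto simp: light_family_def\<close>)
next
  fix k s assume "k < r" "s \<le> lo \<or> hi \<le> s"
  then show "light_family F k s = zigzag k s"
    using nest_min_lo[OF F] nest_min_hi[OF F] by (auto simp: light_family_def)
next
  fix k s assume "Suc k < r"
  then show "light_family F k s < light_family F (Suc k) s"
    using nest_min_strict[OF F] by (auto simp: light_family_def zigzag_def)
next
  fix s
  show "s < 2 * light_family F 0 s" using nest_min_diag[OF F]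
    by (auto simp: light_family_def zigzag_def)
qed

text \<open>An element of the strip lies on the boundary of its deepest level \<open>k\<close>:
  membership in level \<open>k\<close> keeps the envelope from passing beyond it, and no member of
  level \<open>k\<close> is inside it to pull the envelope below. Outside the strip the zigzags
  sweep out all variables.\<close>

lemma covers_light_family:
  assumes F: "F \<subseteq> skew_vars n" and free: "nest_level F r = {}"
  shows "F \<subseteq> covers (light_family F)"
proof
  fix f assume f: "f \<in> F"
  then have fv: "f \<in> skew_vars n" using F by auto
  have "\<exists>k<r. light_family F k (vsum f) = int (snd f)"
  proof (cases "lo \<le> vsum f \<and> vsum f \<le> hi")
    case True
    then have f0: "f \<in> nest_level (trunc F) 0" using f by (auto simp: trunc_def)
    define k where "k = (LEAST k. f \<notin> nest_level (trunc F) (Suc k))"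
    have ex: "f \<notin> nest_level (trunc F) (Suc (r - 1))" using nest_free_trunc[OF F free] r_pos by auto
    have k1: "f \<notin> nest_level (trunc F) (Suc k)" unfolding k_def by (rule LeastI, rule ex)
    have kr: "k < r" using Least_le[of "\<lambda>k. f \<notin> nest_level (trunc F) (Suc k)", OF ex] r_pos
      unfolding k_def by linarith
    have k2: "f \<in> nest_level (trunc F) k"
    proof (cases k)
      case 0
      then show ?thesis using f0 by simp
    next
      case (Suc l)
      then have "l < k" by simp
      then show ?thesis using not_less_Least[of l "\<lambda>k. f \<notin> nest_level (trunc F) (Suc k)"] Suc
        unfolding k_def by simp
    qed
    obtain g where g: "g \<in> nest_level (trunc F) k" "nest_min (trunc F) k (vsum f) = reach g (vsum f)"
      using nest_min_attained[OF F kr] by blast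
    have "\<not> inside g f" using k1 g(1) f0 by auto
    then have "nest_min (trunc F) k (vsum f) = int (snd f)"
      using nest_min_le[OF F k2, of "vsum f"] g(2) by (simp add: inside_reach)
    then show ?thesis using kr True by (auto simp: light_family_def)
  next
    case False
    let ?k = "nat (int (snd f) - vsum f div 2 - 1)"
    have "1 \<le> fst f" "fst f < snd f" "snd f \<le> n" using fv by (auto simp: skew_vars_def)
    then have "?k < r" "zigzag ?k (vsum f) = int (snd f)"
      using False by (auto simp: zigzag_def vsum_def lo_def hi_def)
    then show ?thesis using False by (intro exI[of _ ?k]) (auto simp: light_family_def)
  qed
  then show "f \<in> covers (light_family F)" using fv by (auto simp: covers_def)
qed

text \<open>A hook attaining the minimum at a turn lies above the envelope on both neighbouring
  antidiagonals, so it turns there too; the only turn of a hook is its own variable.\<close>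

lemma turns_light_family:
  assumes F: "F \<subseteq> skew_vars n"
  shows "turns (light_family F) \<subseteq> F"
proof
  fix v assume "v \<in> turns (light_family F)"
  then obtain k where k: "k < r" and v: "light_family F k (vsum v) = int (snd v)"
    and t: "turn_at (light_family F k) (vsum v)" by (auto simp: turns_def)
  let ?s = "vsum v"
  have s: "lo < ?s" "?s < hi" using t by (auto simp: turn_at_def)
  let ?m = "nest_min (trunc F) k"
  have m: "?m ?s = int (snd v)" "?m (?s - 1) = ?m ?s" "?m (?s + 1) = ?m ?s + 1"
    using t v s by (auto simp: turn_at_def light_family_def)
  obtain f where f: "f \<in> nest_level (trunc F) k" "?m ?s = reach f ?s"
    using nest_min_attained[OF F k] by blast
  have "?m (?s + 1) \<le> reach f (?s + 1)" "?m (?s - 1) \<le> reach f (?s - 1)"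
    using nest_min_le[OF F f(1)] by auto
  then have vs: "vsum f = ?s" using m f(2) by (auto simp: reach_def max_def split: if_splits)
  then have "snd f = snd v" using f(2) m by (simp add: reach_def)
  with vs have "f = v" by (auto simp: vsum_def prod_eq_iff)
  moreover have "f \<in> trunc F" using f(1) nest_level_subset by blast
  ultimately show "v \<in> F" using s start_var_props(2) end_var_props(2)
    by (fastforce simp: trunc_def)
qed

section \<open>Uniqueness and size of a covering family\<close>

context
  fixes q :: "nat \<Rightarrow> int \<Rightarrow> int"
  assumes q: "good_family q"
begin

lemma good_step: "k < r \<Longrightarrow> q k (s + 1) = q k s \<or> q k (s + 1) = q k s + 1"
  and good_zigzag: "k < r \<Longrightarrow> s \<le> lo \<or> hi \<le> s \<Longrightarrow> q k s = zigzag k s"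
  and good_strict: "Suc k < r \<Longrightarrow> q k s < q (Suc k) s"
  and good_diag: "s < 2 * q 0 s"
  using q by (auto simp: good_family_def)

lemma good_lipschitz:
  assumes "k < r" "s \<le> t" shows "q k s \<le> q k t" "q k t \<le> q k s + (t - s)"
proof -
  have "q k s \<le> q k t \<and> q k t \<le> q k s + (t - s)" using assms(2)
  proof (induction t rule: int_ge_induct)
    case base
    then show ?case by simp
  next
    case (step t)
    then show ?case using good_step[OF assms(1), of t] by linarith
  qed
  then show "q k s \<le> q k t" "q k t \<le> q k s + (t - s)" by auto
qed

lemma good_ordered:
  assumes "k \<le> l" "l < r" shows "q k s + int (l - k) \<le> q l s"
  using assms
proof (induction l rule: dec_induct)
  case base
  then show ?case by simp
next
  case (step l)
  then show ?case using good_strict[of l s] by (simp add: Suc_diff_le)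
qed

lemma good_inj: assumes "k < r" "l < r" "q k s = q l s" shows "k = l"
proof (rule ccontr)
  assume "k \<noteq> l"
  then consider "k < l" | "l < k" by linarith
  then show False using good_ordered[of k l s] good_ordered[of l k s] assms by cases auto
qed

lemma good_diag': "k < r \<Longrightarrow> s < 2 * q k s"
  using good_ordered[of 0 k s] good_diag[of s] by simp

text \<open>A path through \<open>v\<close> cannot leave the hook of \<open>v\<close> outwards, as
  columns never decrease and grow by at most one per antidiagonal.\<close>

lemma good_le_reach:
  assumes k: "k < r" and v: "q k (vsum v) = int (snd v)"
  shows "q k s \<le> reach v s"
  using good_lipschitz[OF k, of s "vsum v"] good_lipschitz[OF k, of "vsum v" s] v
  by (cases "s \<le> vsum v") (auto simp: reach_def)

text \<open>If \<open>g\<close> is inside \<open>f\<close>, the path through \<open>g\<close> stays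
  within the hook of \<open>g\<close> and so passes strictly below \<open>f\<close> on the
  antidiagonal of \<open>f\<close>. Hence path indices increase along a nested chain.\<close>

lemma level_le_path:
  assumes F: "F \<subseteq> covers q"
  shows "f \<in> nest_level F m \<Longrightarrow> k < r \<Longrightarrow> q k (vsum f) = int (snd f) \<Longrightarrow> m \<le> k"
proof (induction m arbitrary: f k)
  case 0
  then show ?case by simp
next
  case (Suc m)
  then obtain g where g: "g \<in> nest_level F m" "inside g f" by auto
  then have "g \<in> covers q" using F nest_level_subset by blast
  then obtain l where l: "l < r" "q l (vsum g) = int (snd g)" by (auto simp: covers_def)
  have "m \<le> l" using Suc.IH[OF g(1) l] .
  moreover have "q l (vsum f) < q k (vsum f)"
    using good_le_reach[OF l, of "vsum f"] g(2) Suc.prems by (simp add: inside_reach)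
  then have "l < k" using good_ordered[of k l "vsum f"] l by (cases "k \<le> l") auto
  ultimately show ?case by simp
qed

lemma nest_free_covers: "nest_level (covers q) r = {}"
proof (rule ccontr)
  assume "nest_level (covers q) r \<noteq> {}"
  then obtain f where f: "f \<in> nest_level (covers q) r" by auto
  then have "f \<in> covers q" using nest_level_subset by blast
  then obtain k where "k < r" "q k (vsum f) = int (snd f)" by (auto simp: covers_def)
  then show False using level_le_path[OF subset_refl f] by fastforce
qed

text \<open>The zigzag enters row 1 at antidiagonal \<open>2 * k + 3\<close> and leaves column
  \<open>n\<close> after \<open>2 * n - 2 * k - 1\<close>; both lie outside or at the edge of the
  strip. Monotonicity of rows and columns settles everything in between.\<close>

lemma in_triangle_iff:
  assumes k: "k < r"
  shows "1 \<le> s - q k s \<and> q k s \<le> int n \<longleftrightarrow> 2 * int k + 3 \<le> s \<and> s \<le> 2 * int n - 2 * int k - 1"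
proof -
  let ?a = "2 * int k + 3" and ?b = "2 * int n - 2 * int k - 1"
  have "?a \<le> lo" "hi \<le> ?b" using k by (auto simp: lo_def hi_def)
  then have e: "q k ?a = zigzag k ?a" "q k (?a - 1) = zigzag k (?a - 1)"
    "q k ?b = zigzag k ?b" "q k (?b + 1) = zigzag k (?b + 1)"
    using good_zigzag[OF k] by auto
  have z: "zigzag k ?a = 2 * int k + 2" "zigzag k (?a - 1) = 2 * int k + 2"
    "zigzag k ?b = int n" "zigzag k (?b + 1) = int n + 1"
    by (auto simp: zigzag_def)
  show ?thesis
  proof
    assume l: "1 \<le> s - q k s \<and> q k s \<le> int n"
    show "?a \<le> s \<and> s \<le> ?b"
    proof (rule ccontr)
      assume "\<not> (?a \<le> s \<and> s \<le> ?b)"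
      then consider "s \<le> ?a - 1" | "?b + 1 \<le> s" by linarith
      then show False
        using good_lipschitz[OF k, of s "?a - 1"] good_lipschitz[OF k, of "?b + 1" s] e z l
        by cases auto
    qed
  next
    assume "?a \<le> s \<and> s \<le> ?b"
    then show "1 \<le> s - q k s \<and> q k s \<le> int n"
      using good_lipschitz[OF k, of ?a s] good_lipschitz[OF k, of s ?b] e z by auto
  qed
qed

lemma path_point_var:
  assumes k: "k < r" and s: "lo \<le> s" "s \<le> hi"
  obtains v where "v \<in> skew_vars n" "vsum v = s" "int (snd v) = q k s"
proof -
  have "1 \<le> s - q k s \<and> q k s \<le> int n"
    using in_triangle_iff[OF k] s k by (auto simp: lo_def hi_def)
  moreover have "s < 2 * q k s" using good_diag'[OF k] .
  ultimately have "(nat (s - q k s), nat (q k s)) \<in> skew_vars n"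
    "vsum (nat (s - q k s), nat (q k s)) = s" "int (snd (nat (s - q k s), nat (q k s))) = q k s"
    by (auto simp: skew_vars_def vsum_def)
  then show ?thesis using that by blast
qed

text \<open>A path is made of pieces of the hooks at its NE-turns and end points. Every point lies
  on a vertical run leading up to such a point, or on a horizontal run issuing from one.\<close>

lemma reach_attained:
  assumes T: "turns q \<subseteq> F" and k: "k < r" and s: "lo \<le> s" "s \<le> hi"
  shows "\<exists>f \<in> trunc F. q k (vsum f) = int (snd f) \<and> reach f s = q k s"
proof -
  have start: "\<exists>f \<in> trunc F. vsum f = lo \<and> int (snd f) = q k lo"
    using start_var_props[OF k] k good_zigzag[OF k, of lo]
    by (intro bexI[of _ "start_var k"]) (auto simp: trunc_def)
  have fin: "\<exists>f \<in> trunc F. vsum f = hi \<and> int (snd f) = q k hi"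
    using end_var_props[OF k] k good_zigzag[OF k, of hi]
    by (intro bexI[of _ "end_var k"]) (auto simp: trunc_def)
  have turn: "\<exists>f \<in> trunc F. vsum f = u \<and> int (snd f) = q k u" if u: "turn_at (q k) u" for u
  proof -
    have u': "lo \<le> u" "u \<le> hi" using u by (auto simp: turn_at_def)
    obtain v where v: "v \<in> skew_vars n" "vsum v = u" "int (snd v) = q k u"
      using path_point_var[OF k u'] by blast
    then have "v \<in> turns q" using k u by (auto simp: turns_def)
    then show ?thesis using T v u' by (auto simp: trunc_def)
  qed
  \<comment> \<open>The end of the vertical run from \<open>s\<close>: the first antidiagonal where
    the path steps horizontally, or \<open>hi\<close>.\<close>
  define A where "A = {u \<in> {s..hi}. u = hi \<or> q k (u + 1) = q k u + 1}"
  define u where "u = Min A"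
  have finA: "finite A" "A \<noteq> {}"
    using s by (auto simp: A_def intro: finite_subset[of _ "{s..hi}"])
  then have uA: "u \<in> A" unfolding u_def by (rule Min_in)
  have umin: "q k (w + 1) = q k w" if "s \<le> w" "w < u" for w
  proof -
    have "w \<notin> A" using Min_le[OF finA(1), of w] that unfolding u_def by auto
    then show ?thesis using that uA good_step[OF k, of w] by (auto simp: A_def)
  qed
  have const: "q k w = q k s" if "s \<le> w" "w \<le> u" for w using that
  proof (induction w rule: int_ge_induct)
    case base
    then show ?case by simp
  next
    case (step w)
    then show ?case using umin[of w] by simp
  qed
  have su: "s \<le> u" "u \<le> hi" using uA by (auto simp: A_def)
  show ?thesis
  proof (cases "u = hi \<or> (lo < u \<and> q k (u - 1) = q k u)")
    case True
    then have "\<exists>f \<in> trunc F. vsum f = u \<and> int (snd f) = q k u"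
      using fin turn[of u] uA by (cases "u = hi") (auto simp: turn_at_def A_def)
    then obtain f where f: "f \<in> trunc F" "vsum f = u" "int (snd f) = q k u" by blast
    then have "reach f s = q k s" using const[of u] su by (auto simp: reach_def)
    then show ?thesis using f by (intro bexI[of _ f]) auto
  next
    case False
    then have us: "u = s" using umin[of "u - 1"] su s by (cases "u = s") auto
    \<comment> \<open>Here the path has no vertical run to follow, so its horizontal run is traced
      back to the last vertical step before \<open>s\<close>, or to \<open>lo\<close>.\<close>
    define B where "B = {w \<in> {lo..s}. w = lo \<or> q k (w - 1) = q k w}"
    define w where "w = Max B"
    have finB: "finite B" "B \<noteq> {}"
      using s by (auto simp: B_def intro: finite_subset[of _ "{lo..s}"])
    then have wB: "w \<in> B" unfolding w_def by (rule Max_in)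
    have wmax: "q k x = q k (x - 1) + 1" if "w < x" "x \<le> s" for x
    proof -
      have "x \<notin> B" using Max_ge[OF finB(1), of x] that unfolding w_def by auto
      then show ?thesis using that wB good_step[OF k, of "x - 1"] by (auto simp: B_def)
    qed
    have lin: "q k x = q k w + (x - w)" if "w \<le> x" "x \<le> s" for x using that
    proof (induction x rule: int_ge_induct)
      case base
      then show ?case by simp
    next
      case (step x)
      then show ?case using wmax[of "x + 1"] by simp
    qed
    have ws: "lo \<le> w" "w \<le> s" using wB by (auto simp: B_def)
    have "\<exists>f \<in> trunc F. vsum f = w \<and> int (snd f) = q k w"
    proof (cases "w = lo")
      case True
      then show ?thesis using start by simp
    next
      case w: False
      then have v: "q k (w - 1) = q k w" using wB by (auto simp: B_def)
      have "w \<noteq> s" using False us v w ws by auto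
      then have "q k (w + 1) = q k w + 1" using wmax[of "w + 1"] ws by simp
      then show ?thesis using turn[of w] v w ws \<open>w \<noteq> s\<close> s by (auto simp: turn_at_def)
    qed
    then obtain f where f: "f \<in> trunc F" "vsum f = w" "int (snd f) = q k w" by blast
    then have "reach f s = q k s" using lin[of s] ws by (auto simp: reach_def)
    then show ?thesis using f by (intro bexI[of _ f]) auto
  qed
qed

lemma trunc_covers:
  assumes "F \<subseteq> covers q" shows "trunc F \<subseteq> covers q"
proof -
  have "start_var k \<in> covers q" if "k < r" for k
    using start_var_props[OF that] good_zigzag[OF that, of lo] that by (auto simp: covers_def)
  moreover have "end_var k \<in> covers q" if "k < r" for k
    using end_var_props[OF that] good_zigzag[OF that, of hi] that by (auto simp: covers_def)
  ultimately show ?thesis using assms by (auto simp: trunc_def)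
qed

text \<open>A point of path \<open>k + 1\<close> lies beyond path \<open>k\<close>, which at that
  antidiagonal is part of a hook of a variable of \<open>trunc F\<close> on path \<open>k\<close>.
  That variable is therefore inside the given one, and a chain is built downwards.\<close>

lemma path_in_level:
  assumes T: "turns q \<subseteq> F"
  shows "k < r \<Longrightarrow> f \<in> trunc F \<Longrightarrow> q k (vsum f) = int (snd f) \<Longrightarrow> f \<in> nest_level (trunc F) k"
proof (induction k arbitrary: f)
  case 0
  then show ?case by simp
next
  case (Suc k)
  have s: "lo \<le> vsum f" "vsum f \<le> hi" using trunc_vsum[OF Suc.prems(2)] by auto
  obtain g where g: "g \<in> trunc F" "q k (vsum g) = int (snd g)" "reach g (vsum f) = q k (vsum f)"
    using reach_attained[OF T _ s, of k] Suc.prems by auto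
  then have "g \<in> nest_level (trunc F) k" using Suc by simp
  moreover have "inside g f" using g(3) good_strict[of k "vsum f"] Suc.prems by (simp add: inside_reach)
  ultimately show ?case using Suc.prems by auto
qed

text \<open>Each point of path \<open>k\<close> lies on a hook of level \<open>k\<close>, so the
  envelope is not above the path. Conversely a member of level \<open>k\<close> lies on a path of
  index at least \<open>k\<close>, so its hook is not below path \<open>k\<close>.\<close>

lemma good_eq_light_family:
  assumes T: "turns q \<subseteq> F" and F: "F \<subseteq> covers q" and k: "k < r"
  shows "q k s = light_family F k s"
proof (cases "lo \<le> s \<and> s \<le> hi")
  case True
  then have s: "lo \<le> s" "s \<le> hi" by auto
  have Fv: "F \<subseteq> skew_vars n" using F by (auto simp: covers_def)
  obtain f where f: "f \<in> trunc F" "q k (vsum f) = int (snd f)" "reach f s = q k s"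
    using reach_attained[OF T k s] by blast
  have "nest_min (trunc F) k s \<le> q k s"
    using nest_min_le[OF Fv path_in_level[OF T k f(1,2)], of s] f(3) by simp
  moreover obtain g where g: "g \<in> nest_level (trunc F) k" "nest_min (trunc F) k s = reach g s"
    using nest_min_attained[OF Fv k] by blast
  have "g \<in> covers q" using g(1) nest_level_subset trunc_covers[OF F] by blast
  then obtain l where l: "l < r" "q l (vsum g) = int (snd g)" by (auto simp: covers_def)
  have "k \<le> l" using level_le_path[OF trunc_covers[OF F] g(1) l] .
  then have "q k s \<le> nest_min (trunc F) k s"
    using good_ordered[of k l s] good_le_reach[OF l, of s] g(2) l by linarith
  ultimately show ?thesis using True by (simp add: light_family_def)
next
  case False
  then show ?thesis using good_zigzag[OF k, of s] by (auto simp: light_family_def)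
qed

text \<open>Distinct paths share no point, and path \<open>k\<close> contributes
  \<open>2 * n - 4 * k - 3\<close> variables whatever the family.\<close>

lemma card_covers: "card (covers q) = r * (2 * n - 2 * r - 1)"
proof -
  define I where "I k = {2 * int k + 3 .. 2 * int n - 2 * int k - 1}" for k
  define g where "g = (\<lambda>(k, s). (nat (s - q k s), nat (q k s)))"
  have b: "1 \<le> s - q k s" "q k s \<le> int n" "s < 2 * q k s" if "k < r" "s \<in> I k" for k s
    using in_triangle_iff[OF that(1), of s] good_diag'[OF that(1), of s] that(2) by (auto simp: I_def)
  have "bij_betw g (Sigma {..<r} I) (covers q)"
    unfolding bij_betw_def
  proof (intro conjI)
    show "inj_on g (Sigma {..<r} I)"
    proof (rule inj_onI, clarify)
      fix k s l t assume a: "k < r" "s \<in> I k" "l < r" "t \<in> I l" "g (k, s) = g (l, t)"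
      have e: "nat (s - q k s) = nat (t - q l t)" "nat (q k s) = nat (q l t)"
        using a(5) by (auto simp: g_def)
      then have "q k s = q l t" "s - q k s = t - q l t" using b[OF a(1,2)] b[OF a(3,4)] by auto
      then show "k = l \<and> s = t" using good_inj[OF a(1,3)] by auto
    qed
    show "g ` Sigma {..<r} I = covers q"
    proof (intro equalityI subsetI)
      fix v assume "v \<in> g ` Sigma {..<r} I"
      then obtain k s where k: "k < r" "s \<in> I k" "v = (nat (s - q k s), nat (q k s))"
        by (auto simp: g_def)
      then show "v \<in> covers q" using b[OF k(1,2)]
        by (auto simp: covers_def skew_vars_def vsum_def intro!: exI[of _ k])
    next
      fix v assume "v \<in> covers q"
      then obtain k where k: "v \<in> skew_vars n" "k < r" "q k (vsum v) = int (snd v)"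
        by (auto simp: covers_def)
      then have "vsum v \<in> I k" using in_triangle_iff[OF k(2), of "vsum v"]
        by (auto simp: I_def skew_vars_def vsum_def)
      moreover have "v = g (k, vsum v)" using k by (auto simp: g_def vsum_def prod_eq_iff)
      ultimately show "v \<in> g ` Sigma {..<r} I" using k by blast
    qed
  qed
  then have "card (covers q) = card (Sigma {..<r} I)" by (simp add: bij_betw_same_card)
  also have "\<dots> = (\<Sum>k<r. card (I k))" by (subst card_SigmaI) (auto simp: I_def)
  also have "int \<dots> = (\<Sum>k<r. 2 * int n - 4 * int k - 3)"
    unfolding of_nat_sum
  proof (rule sum.cong)
    fix k assume "k \<in> {..<r}"
    then show "int (card (I k)) = 2 * int n - 4 * int k - 3" using n_ge by (auto simp: I_def)
  qed simp
  also have "\<dots> = int r * (2 * int n - 2 * int r - 1)"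
    by (induction r) (auto simp: algebra_simps)
  also have "\<dots> = int (r * (2 * n - 2 * r - 1))"
    using n_ge r_pos by (simp add: of_nat_diff)
  finally show ?thesis by linarith
qed

end

end

section \<open>The nested matching is minimal\<close>


lemma perfect_matchingsI:
  assumes edges: "\<And>e. e \<in> M \<Longrightarrow> 1 \<le> fst e \<and> fst e < snd e \<and> snd e \<le> 2 * m"
    and dj: "\<And>e f. e \<in> M \<Longrightarrow> f \<in> M \<Longrightarrow> e \<noteq> f \<Longrightarrow> {fst e, snd e} \<inter> {fst f, snd f} = {}"
    and cov: "{1..2 * m} \<subseteq> (\<Union>e\<in>M. {fst e, snd e})"
  shows "M \<in> perfect_matchings m"
proof -
  have "\<exists>!e. e \<in> M \<and> (v = fst e \<or> v = snd e)" if v: "v \<in> {1..2 * m}" for v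
  proof -
    obtain e where e: "e \<in> M" "v = fst e \<or> v = snd e" using cov v by blast
    show ?thesis
    proof (rule ex1I[of _ e])
      show "e \<in> M \<and> (v = fst e \<or> v = snd e)" using e by simp
      fix f assume "f \<in> M \<and> (v = fst f \<or> v = snd f)"
      then show "f = e" using dj[of e f] e by blast
    qed
  qed
  moreover have "M \<subseteq> {(i, j). 1 \<le> i \<and> i < j \<and> j \<le> 2 * m}"
    using edges by (auto dest!: edges)
  ultimately show ?thesis unfolding perfect_matchings_def by blast
qed

definition nesting :: "nat \<Rightarrow> (nat \<times> nat) set" where
  "nesting m = (\<lambda>a. (a, 2 * m + 1 - a)) ` {1..m}"

lemma nesting_perfect: "nesting m \<in> perfect_matchings m"
proof (rule perfect_matchingsI)
  show "{1..2 * m} \<subseteq> (\<Union>e\<in>nesting m. {fst e, snd e})"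
  proof
    fix v assume v: "v \<in> {1..2 * m}"
    show "v \<in> (\<Union>e\<in>nesting m. {fst e, snd e})"
    proof (cases "v \<le> m")
      case True
      then show ?thesis using v by (auto simp: nesting_def intro!: bexI[of _ v])
    next
      case False
      then show ?thesis using v by (auto simp: nesting_def intro!: bexI[of _ "2 * m + 1 - v"])
    qed
  qed
qed (auto simp: nesting_def)

text \<open>The edges around \<open>e\<close> have as left ends exactly the vertices before
  \<open>fst e\<close> and as right ends exactly those after \<open>snd e\<close>. Equal numbers
  force \<open>fst e + snd e = 2 * m + 1\<close>.\<close>

lemma nested_perfect_matching:
  assumes M: "M \<in> perfect_matchings m"
    and nested: "\<And>e f. e \<in> M \<Longrightarrow> f \<in> M \<Longrightarrow> fst e < fst f \<Longrightarrow> snd f < snd e"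
  shows "M = nesting m"
proof -
  note edge = perfect_matching_edge[OF M] and uniq = perfect_matching_unique[OF M]
  have fst_inj: "inj_on fst M" using uniq by (intro inj_onI) blast
  have snd_inj: "inj_on snd M" using uniq by (intro inj_onI) blast
  have sum: "fst e + snd e = 2 * m + 1" if e: "e \<in> M" for e
  proof -
    define X where "X = {f \<in> M. fst f < fst e}"
    have "fst ` X = {1..<fst e}"
    proof (intro equalityI subsetI)
      fix v assume v: "v \<in> {1..<fst e}"
      then have "v \<in> {1..2 * m}" using edge[OF e] by auto
      then obtain f where f: "f \<in> M" "v = fst f \<or> v = snd f" using perfect_matching_cover[OF M] by blast
      have "v = fst f"
      proof (rule ccontr)
        assume "v \<noteq> fst f"
        then have "snd f < fst e" "fst f < fst e" using f v edge[OF f(1)] by auto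
        then show False using nested[OF f(1) e] edge[OF e] by simp
      qed
      then show "v \<in> fst ` X" using f v by (auto simp: X_def)
    qed (use edge in \<open>auto simp: X_def\<close>)
    moreover have "snd ` X = {snd e<..2 * m}"
    proof (intro equalityI subsetI)
      fix v assume "v \<in> snd ` X"
      then obtain f where f: "f \<in> M" "fst f < fst e" "v = snd f" by (auto simp: X_def)
      then show "v \<in> {snd e<..2 * m}" using nested[OF f(1) e] edge[OF f(1)] by simp
    next
      fix v assume v: "v \<in> {snd e<..2 * m}"
      then have "v \<in> {1..2 * m}" by auto
      then obtain f where f: "f \<in> M" "v = fst f \<or> v = snd f" using perfect_matching_cover[OF M] by blast
      have "\<not> fst e < fst f" using nested[OF e f(1)] f v edge[OF f(1)] by auto
      moreover have "fst e \<noteq> fst f"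
      proof
        assume "fst e = fst f"
        then have "e = f" using uniq[OF e f(1), of "fst e"] by simp
        then show False using f v edge[OF e] by auto
      qed
      ultimately have "fst f < fst e" by simp
      moreover have "v = snd f" using f(2) v \<open>fst f < fst e\<close> edge[OF e] by auto
      ultimately show "v \<in> snd ` X" using f by (auto simp: X_def)
    qed
    moreover have "card (fst ` X) = card (snd ` X)"
      using fst_inj snd_inj by (simp add: X_def card_image inj_on_subset)
    ultimately have "fst e - 1 = 2 * m - snd e" by simp
    then show ?thesis using edge[OF e] by simp
  qed
  have sub: "M \<subseteq> nesting m"
  proof
    fix e assume e: "e \<in> M"
    then show "e \<in> nesting m" using sum[OF e] edge[OF e]
      by (auto simp: nesting_def prod_eq_iff image_iff)
  qed
  moreover have "nesting m \<subseteq> M"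
  proof
    fix e assume "e \<in> nesting m"
    then obtain a where a: "a \<in> {1..m}" "e = (a, 2 * m + 1 - a)" by (auto simp: nesting_def)
    then have "a \<in> {1..2 * m}" by auto
    then obtain f where f: "f \<in> M" "a = fst f \<or> a = snd f" using perfect_matching_cover[OF M] by blast
    then have "f = e" using a sum[OF f(1)] edge[OF f(1)] by (cases f) auto
    then show "e \<in> M" using f by simp
  qed
  ultimately show ?thesis by blast
qed

definition matching_weight :: "(nat \<Rightarrow> nat) \<Rightarrow> (nat \<times> nat) set \<Rightarrow> nat" where
  "matching_weight s M = (\<Sum>e\<in>M. s (fst e) * s (snd e))"

lemma uncross_weight:
  fixes a b c d :: nat
  assumes "a < b" "c < d"
  shows "a * d + b * c < a * c + b * d"
proof -
  obtain x y where "b = a + Suc x" "d = c + Suc y" using assms by (auto dest!: less_imp_Suc_add)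
  then show ?thesis by (simp add: algebra_simps)
qed

text \<open>Edges \<open>(i, j)\<close> and \<open>(k, l)\<close> with \<open>i < k\<close> and
  \<open>j < l\<close> are exchanged for \<open>(i, l)\<close> and the edge between \<open>j\<close>
  and \<open>k\<close>. The weight drops by \<open>(s k - s i) * (s l - s j)\<close>.\<close>

lemma improve_matching:
  assumes M: "M \<in> perfect_matchings m" and ne: "M \<noteq> nesting m"
    and s: "strict_mono_on {1..2 * m} s"
  shows "\<exists>M' \<in> perfect_matchings m. matching_weight s M' < matching_weight s M"
proof -
  note edge = perfect_matching_edge[OF M] and dj = perfect_matching_disjoint[OF M]
  have fin: "finite M" using finite_perfect_matching[OF M] .
  obtain e f where ef: "e \<in> M" "f \<in> M" "fst e < fst f" "\<not> snd f < snd e"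
    using nested_perfect_matching[OF M] ne by blast
  obtain i j where e: "e = (i, j)" by fastforce
  obtain k l where f: "f = (k, l)" by fastforce
  have "e \<noteq> f" using ef by auto
  have ij: "1 \<le> i" "i < j" "k < l" "l \<le> 2 * m" "i < k" using edge[OF ef(1)] edge[OF ef(2)] ef e f by auto
  have jl: "j < l" "j \<noteq> k" using dj[OF ef(1,2) \<open>e \<noteq> f\<close>] ef e f by auto
  \<comment> \<open>The original edges cross when \<open>k < j\<close> and are separate when
    \<open>j < k\<close>; \<open>min\<close> and \<open>max\<close> treat both cases at
    once.\<close>
  define g where "g = (min j k, max j k)"
  define R where "R = M - {e, f}"
  let ?M = "insert (i, l) (insert g R)"
  have R: "{fst h, snd h} \<inter> {i, j, k, l} = {}" if "h \<in> R" for h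
    using dj[OF _ ef(1), of h] dj[OF _ ef(2), of h] that e f by (auto simp: R_def)
  have gset: "{fst g, snd g} = {j, k}" by (auto simp: g_def min_def max_def)
  have "?M \<in> perfect_matchings m"
  proof (rule perfect_matchingsI)
    fix h assume "h \<in> ?M"
    then show "1 \<le> fst h \<and> fst h < snd h \<and> snd h \<le> 2 * m"
      using edge[of h] ij jl by (auto simp: R_def g_def)
  next
    fix x y assume xy: "x \<in> ?M" "y \<in> ?M" "x \<noteq> y"
    define S where "S h = {fst h, snd h}" for h :: "nat \<times> nat"
    have S: "S (i, l) = {i, l}" "S g = {j, k}" using gset by (auto simp: S_def)
    have 1: "S h \<inter> S g = {}" "S h \<inter> S (i, l) = {}" if "h \<in> R" for h
      using R[OF that] unfolding S by (auto simp: S_def)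
    have 2: "S (i, l) \<inter> S g = {}" unfolding S using ij jl by auto
    have 3: "S x \<inter> S y = {}" if "x \<in> R" "y \<in> R"
      using dj[of x y] that xy(3) by (simp add: R_def S_def)
    have "S x \<inter> S y = {}"
      using xy 1 2 3 by (metis Int_commute insert_iff)
    then show "{fst x, snd x} \<inter> {fst y, snd y} = {}" by (simp add: S_def)
  next
    have "(\<Union>h\<in>M. {fst h, snd h}) = (\<Union>h\<in>insert e (insert f R). {fst h, snd h})"
      using ef by (auto simp: R_def)
    also have "\<dots> = (\<Union>h\<in>?M. {fst h, snd h})"
      using gset by (simp add: e f) blast
    finally show "{1..2 * m} \<subseteq> (\<Union>h\<in>?M. {fst h, snd h})" using perfect_matching_vertices[OF M] by simp
  qed
  moreover have "matching_weight s ?M < matching_weight s M"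
  proof -
    have nin: "(i, l) \<notin> insert g R" "g \<notin> R" using R[of "(i, l)"] R[of g] gset ij jl
      by (auto simp: g_def min_def max_def split: if_splits)
    have "finite R" using fin by (simp add: R_def)
    then have "matching_weight s ?M = s i * s l + (s (fst g) * s (snd g) + matching_weight s R)"
      using nin by (simp add: matching_weight_def)
    moreover have "s (fst g) * s (snd g) = s k * s j" by (auto simp: g_def min_def max_def)
    moreover have "M = insert e (insert f R)" "e \<notin> insert f R" "f \<notin> R"
      using ef \<open>e \<noteq> f\<close> by (auto simp: R_def)
    then have "matching_weight s M = s i * s j + (s k * s l + matching_weight s R)"
      using \<open>finite R\<close> e f by (simp add: matching_weight_def)
    moreover have "s i < s k" "s j < s l" using strict_mono_onD[OF s] ij jl by auto
    ultimately show ?thesis using uncross_weight[of "s i" "s k" "s j" "s l"] by simp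
  qed
  ultimately show ?thesis by blast
qed

lemma nesting_minimal:
  assumes s: "strict_mono_on {1..2 * m} s"
  shows "M \<in> perfect_matchings m \<Longrightarrow> matching_weight s (nesting m) \<le> matching_weight s M"
proof (induction "matching_weight s M" arbitrary: M rule: less_induct)
  case less
  show ?case
  proof (cases "M = nesting m")
    case False
    then obtain M' where "M' \<in> perfect_matchings m" "matching_weight s M' < matching_weight s M"
      using improve_matching[OF less.prems _ s] by blast
    then show ?thesis using less.hyps[of M'] by simp
  qed simp
qed

lemma nesting_strict_minimal:
  assumes s: "strict_mono_on {1..2 * m} s" and M: "M \<in> perfect_matchings m" "M \<noteq> nesting m"
  shows "matching_weight s (nesting m) < matching_weight s M"
  using improve_matching[OF M s] nesting_minimal[OF s] by fastforce

section \<open>Weight and degree of monomials\<close>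

lemma prod_single_one: "(\<Prod>x\<in>A. Poly_Mapping.single (f x) (1::'a::comm_semiring_1)) =
    Poly_Mapping.single (\<Sum>x\<in>A. f x :: 'b::comm_monoid_add) 1"
  by (induction A rule: infinite_finite_induct) (auto simp: mult_single)

text \<open>The grading that makes the nesting monomial the unique smallest one of a Pfaffian.\<close>

definition weight :: "monomial \<Rightarrow> nat" where
  "weight m = (\<Sum>v\<in>Poly_Mapping.keys m. Poly_Mapping.lookup m v * (fst v * snd v))"

lemma keys_sum_superset:
  fixes m :: monomial
  assumes "Poly_Mapping.keys m \<subseteq> A" "finite A"
  shows "(\<Sum>v\<in>Poly_Mapping.keys m. Poly_Mapping.lookup m v * w v) = (\<Sum>v\<in>A. Poly_Mapping.lookup m v * w v)"
  using assms by (intro sum.mono_neutral_left) (auto simp: in_keys_iff)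

lemma keys_add_nat: "Poly_Mapping.keys (m + m' :: monomial) = Poly_Mapping.keys m \<union> Poly_Mapping.keys m'"
  by (auto simp: in_keys_iff lookup_add)

lemma weighted_sum_add:
  fixes m m' :: monomial and w :: "nat \<times> nat \<Rightarrow> nat"
  shows "(\<Sum>v\<in>Poly_Mapping.keys (m + m'). Poly_Mapping.lookup (m + m') v * w v) =
    (\<Sum>v\<in>Poly_Mapping.keys m. Poly_Mapping.lookup m v * w v) +
    (\<Sum>v\<in>Poly_Mapping.keys m'. Poly_Mapping.lookup m' v * w v)"
proof -
  let ?A = "Poly_Mapping.keys (m + m')"
  have "Poly_Mapping.keys m \<subseteq> ?A" "Poly_Mapping.keys m' \<subseteq> ?A" by (auto simp: keys_add_nat)
  then show ?thesis
    using keys_sum_superset[of m ?A w] keys_sum_superset[of m' ?A w]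
    by (simp add: lookup_add sum.distrib add_mult_distrib)
qed

lemma weight_add: "weight (m + m') = weight m + weight m'"
  unfolding weight_def by (rule weighted_sum_add)

lemma total_degree_add: "total_degree (m + m') = total_degree m + total_degree m'"
  using weighted_sum_add[where w = "\<lambda>_. 1"] by (simp add: total_degree_def)

lemma weight_single [simp]: "weight (Poly_Mapping.single v c) = c * (fst v * snd v)"
  by (simp add: weight_def)

lemma total_degree_single [simp]: "total_degree (Poly_Mapping.single v c) = c"
  by (simp add: total_degree_def)

lemma weight_zero [simp]: "weight 0 = 0" and total_degree_zero [simp]: "total_degree 0 = 0"
  by (auto simp: weight_def total_degree_def)

lemma weight_sum: "weight (\<Sum>x\<in>A. f x) = (\<Sum>x\<in>A. weight (f x))"
  by (induction A rule: infinite_finite_induct) (auto simp: weight_add)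

lemma total_degree_sum: "total_degree (\<Sum>x\<in>A. f x) = (\<Sum>x\<in>A. total_degree (f x))"
  by (induction A rule: infinite_finite_induct) (auto simp: total_degree_add)

text \<open>The bound makes the rewriting terminate, since it preserves the degree and raises the
  weight.\<close>

lemma weight_le:
  assumes "Poly_Mapping.keys m \<subseteq> skew_vars n"
  shows "weight m \<le> total_degree m * (n * n)"
  unfolding weight_def total_degree_def sum_distrib_right
  using assms by (intro sum_mono mult_le_mono) (auto simp: skew_vars_def)

lemma keys_sum_nat: "finite A \<Longrightarrow> Poly_Mapping.keys (\<Sum>x\<in>A. f x :: monomial) = (\<Union>x\<in>A. Poly_Mapping.keys (f x))"
  by (induction A rule: finite_induct) (auto simp: keys_add_nat)

definition matching_monomial :: "(nat \<Rightarrow> nat) \<Rightarrow> (nat \<times> nat) set \<Rightarrow> monomial" where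
  "matching_monomial s M = (\<Sum>e\<in>M. Poly_Mapping.single (s (fst e), s (snd e)) 1)"

lemma weight_matching_monomial: "weight (matching_monomial s M) = matching_weight s M"
  by (simp add: matching_monomial_def weight_sum matching_weight_def)

lemma card_perfect_matching:
  assumes M: "M \<in> perfect_matchings m" shows "card M = m"
proof -
  have "2 * m = card (\<Union>e\<in>M. {fst e, snd e})" using perfect_matching_vertices[OF M] by simp
  also have "\<dots> = (\<Sum>e\<in>M. card {fst e, snd e})"
    using finite_perfect_matching[OF M] perfect_matching_disjoint[OF M] by (intro card_UN_disjoint) auto
  also have "\<dots> = (\<Sum>e\<in>M. 2)"
    using perfect_matching_edge(2)[OF M] by (intro sum.cong) (auto simp: card_insert_if dest: less_imp_neq)
  finally show ?thesis by simp
qed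

lemma total_degree_matching_monomial:
  "M \<in> perfect_matchings m \<Longrightarrow> total_degree (matching_monomial s M) = m"
  by (simp add: matching_monomial_def total_degree_sum card_perfect_matching)

lemma Pf_generic_skew:
  assumes s: "strict_mono_on {1..2 * m} s"
  shows "Pf m (\<lambda>a b. generic_skew (s a) (s b)) =
    (\<Sum>M\<in>perfect_matchings m. (- 1) ^ crossing_number M * Poly_Mapping.single (matching_monomial s M) (1::'k::field))"
  unfolding Pf_def
proof (rule sum.cong)
  fix M assume M: "M \<in> perfect_matchings m"
  have "(\<Prod>(i, j)\<in>M. generic_skew (s i) (s j)) =
      (\<Prod>e\<in>M. Poly_Mapping.single (Poly_Mapping.single (s (fst e), s (snd e)) 1) (1::'k))"
  proof (rule prod.cong)
    fix e assume e: "e \<in> M"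
    then have "s (fst e) < s (snd e)" using perfect_matching_edge[OF M e] strict_mono_onD[OF s] by auto
    then show "(case e of (i, j) \<Rightarrow> generic_skew (s i) (s j)) =
      Poly_Mapping.single (Poly_Mapping.single (s (fst e), s (snd e)) 1) (1::'k)"
      by (simp add: generic_skew_def mpoly_var_def case_prod_unfold)
  qed simp
  then show "(- 1) ^ crossing_number M * (\<Prod>(i, j)\<in>M. generic_skew (s i) (s j)) =
    (- 1) ^ crossing_number M * Poly_Mapping.single (matching_monomial s M) (1::'k)"
    by (simp add: prod_single_one matching_monomial_def)
qed simp

text \<open>As \<open>c 0\<close> is innermost, the rows are the left ends from \<open>c r\<close>
  inwards followed by the right ends from \<open>c 0\<close> outwards. The nesting then joins the
  two ends of each \<open>c a\<close>.\<close>

lemma nested_chain_minor: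
  assumes c: "\<forall>a\<le>r. c a \<in> F" "\<forall>a<r. inside (c a) (c (Suc a))" and F: "F \<subseteq> skew_vars n"
  obtains s where "strict_mono_on {1..2 * (r + 1)} s" "s ` {1..2 * (r + 1)} \<subseteq> {1..n}"
    "matching_monomial s (nesting (r + 1)) = (\<Sum>a\<le>r. Poly_Mapping.single (c a) 1)"
proof
  let ?s = "\<lambda>a. if a \<le> r + 1 then fst (c (r + 1 - a)) else snd (c (a - r - 2))"
  have cF: "c a \<in> skew_vars n" if "a \<le> r" for a using c that F by blast
  have cb: "1 \<le> fst (c a)" "fst (c a) < snd (c a)" "snd (c a) \<le> n" if "a \<le> r" for a
    using cF[OF that] by (auto simp: skew_vars_def)
  have inner: "fst (c b) < fst (c a) \<and> snd (c a) < snd (c b)" if "a < b" "b \<le> r" for a b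
    using that
  proof (induction b)
    case (Suc b)
    then have "inside (c b) (c (Suc b))" using c by simp
    then show ?case using Suc by (cases "a = b") (auto simp: inside_def)
  qed simp
  have mid: "fst (c a) < snd (c b)" if "a \<le> r" "b \<le> r" for a b
    using inner[of a b] inner[of b a] cb[OF that(1)] cb[OF that(2)] that
    by (cases a b rule: linorder_cases) auto
  show "strict_mono_on {1..2 * (r + 1)} ?s"
  proof (rule strict_mono_onI)
    fix a b assume ab: "a \<in> {1..2 * (r + 1)}" "b \<in> {1..2 * (r + 1)}" "a < b"
    show "?s a < ?s b"
      using ab inner[of "r + 1 - b" "r + 1 - a"] inner[of "a - r - 2" "b - r - 2"]
        mid[of "r + 1 - a" "b - r - 2"] by auto
  qed
  show "?s ` {1..2 * (r + 1)} \<subseteq> {1..n}"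
  proof (intro image_subsetI)
    fix a assume a: "a \<in> {1..2 * (r + 1)}"
    show "?s a \<in> {1..n}"
    proof (cases "a \<le> r + 1")
      case True
      then have "r + 1 - a \<le> r" using a by auto
      from cb[OF this] show ?thesis using True by simp
    next
      case False
      then have "a - r - 2 \<le> r" using a by auto
      from cb[OF this] show ?thesis using False by simp
    qed
  qed
  have "matching_monomial ?s (nesting (r + 1)) = (\<Sum>a\<in>{1..r + 1}. Poly_Mapping.single (c (r + 1 - a)) 1)"
    unfolding matching_monomial_def nesting_def
    by (subst sum.reindex) (auto simp: inj_on_def intro!: sum.cong)
  also have "\<dots> = (\<Sum>a\<le>r. Poly_Mapping.single (c a) 1)"
    by (rule sum.reindex_bij_witness[of _ "\<lambda>a. r + 1 - a" "\<lambda>a. r + 1 - a"]) auto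
  finally show "matching_monomial ?s (nesting (r + 1)) = (\<Sum>a\<le>r. Poly_Mapping.single (c a) 1)" .
qed

section \<open>Substituting a form of low rank\<close>


lemma crossing_exists:
  fixes f :: "int \<Rightarrow> int"
  assumes step: "\<And>s. f (s + 1) = f s \<or> f (s + 1) = f s + 1" and "a \<le> b" "f a \<le> x" "x < f b"
  shows "\<exists>s. f s = x \<and> f (s + 1) = x + 1"
  using assms(2,4)
proof (induction b rule: int_ge_induct)
  case base
  then show ?case using assms(3) by simp
next
  case (step b)
  then show ?case using assms(1)[of b] by (cases "x < f b") force+
qed

lemma int_antiderivative: "\<exists>F :: int \<Rightarrow> int. \<forall>u. F (u + 1) = F u + f u"
proof -
  let ?F = "\<lambda>u. if 0 \<le> u then \<Sum>t\<in>{0..<u}. f t else - (\<Sum>t\<in>{u..<0}. f t)"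
  have "?F (u + 1) = ?F u + f u" for u
  proof -
    consider "0 \<le> u" | "u = -1" | "u < -1" by linarith
    then show ?thesis
    proof cases
      case 1
      then have "{0..<u + 1} = insert u {0..<u}" by auto
      then show ?thesis using 1 by simp
    next
      case 2
      then have "{u..<0} = {u}" by auto
      then show ?thesis using 2 by simp
    next
      case 3
      then have "{u..<0} = insert u {u + 1..<0}" by auto
      then show ?thesis using 3 by simp
    qed
  qed
  then show ?thesis by (intro exI[of _ ?F]) blast
qed

lemma discrete_subgradient:
  fixes f :: "int \<Rightarrow> int"
  assumes "\<And>u. u < a \<Longrightarrow> f (u + 1) \<le> f u + c" "\<And>u. a \<le> u \<Longrightarrow> f u + c \<le> f (u + 1)"
  shows "f a + (u - a) * c \<le> f u"
proof (induction u rule: int_induct[of _ a])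
  case base
  then show ?case by simp
next
  case (step1 u)
  then show ?case using assms(2)[of u] by (simp add: algebra_simps)
next
  case (step2 u)
  then show ?case using assms(1)[of "u - 1"] by (simp add: algebra_simps)
qed

text \<open>Discrete Legendre duality: the potentials are convex functions whose slopes are read off
  the path, so that \<open>F u + G y - u y\<close> is at least the squared distance to the path.\<close>

lemma path_potentials:
  fixes p :: "int \<Rightarrow> int"
  assumes step: "\<And>s. p (s + 1) = p s \<or> p (s + 1) = p s + 1"
    and hor: "\<And>u. \<exists>s. p s = u \<and> p (s + 1) = u + 1"
    and ver: "\<And>y. \<exists>s. s - p s = y \<and> p (s + 1) = p s"
  obtains F G :: "int \<Rightarrow> int" where "\<And>u y. u * y \<le> F u + G y"
    "\<And>u y. u * y = F u + G y \<longleftrightarrow> p (u + y) = u"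
proof -
  have mono: "p s \<le> p t \<and> p t \<le> p s + (t - s)" if "s \<le> t" for s t using that
  proof (induction t rule: int_ge_induct)
    case (step t)
    then show ?case using assms(1)[of t] by linarith
  qed simp
  obtain h where h: "\<And>u. p (h u) = u \<and> p (h u + 1) = u + 1" using hor by metis
  obtain v where v: "\<And>y. v y - p (v y) = y \<and> p (v y + 1) = p (v y)" using ver by metis
  have h_eq: "h u = s" if "p s = u" "p (s + 1) = u + 1" for s u
    using mono[of "s + 1" "h u"] mono[of "h u + 1" s] h[of u] that
    by (cases "h u" s rule: linorder_cases) auto
  have v_eq: "v y = s" if "s - p s = y" "p (s + 1) = p s" for s y
    using mono[of "s + 1" "v y"] mono[of "v y + 1" s] v[of y] that
    by (cases "v y" s rule: linorder_cases) auto
  \<comment> \<open>\<open>h u\<close> is the antidiagonal on which the path leaves column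
    \<open>u\<close>, so \<open>h u - u\<close> is the row of that step; likewise
    \<open>v y - y\<close> is the column in which row \<open>y\<close> is left. Used as slopes,
    these make the two functions conjugate up to a constant.\<close>
  obtain F0 where F0: "\<And>u. F0 (u + 1) = F0 u + (h u - u)"
    using int_antiderivative[of "\<lambda>u. h u - u"] by blast
  obtain G where G: "\<And>y. G (y + 1) = G y + (v y - y)"
    using int_antiderivative[of "\<lambda>y. v y - y"] by blast
  \<comment> \<open>The error of duality on the path is constant along it, so subtracting one value
    from \<open>F0\<close> removes it.\<close>
  define e where "e s = F0 (p s) + G (s - p s) - p s * (s - p s)" for s
  have e_step: "e (s + 1) = e s" for s
    using step[of s]
  proof
    assume s: "p (s + 1) = p s"
    then have "v (s - p s) = s" by (intro v_eq) auto
    then have "G (s + 1 - p s) = G (s - p s) + p s" using G[of "s - p s"] by (simp add: algebra_simps)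
    then show ?thesis using s by (simp add: e_def algebra_simps)
  next
    assume s: "p (s + 1) = p s + 1"
    then have "h (p s) = s" by (intro h_eq) auto
    then show ?thesis using s F0[of "p s"] by (simp add: e_def algebra_simps)
  qed
  have e_const: "e s = e 0" for s
  proof (induction s rule: int_induct[of _ 0])
    case (step2 i)
    then show ?case using e_step[of "i - 1"] by simp
  qed (simp_all add: e_step)
  define F where "F u = F0 u - e 0" for u
  have on: "F (p s) + G (s - p s) = p s * (s - p s)" for s
    using e_const[of s] by (simp add: e_def F_def)
  have F_sub: "F (p s) + (u - p s) * (s - p s) \<le> F u" for u s
  proof (rule discrete_subgradient)
    fix w assume "w < p s"
    then have "h w < s" using h[of w] mono[of s "h w"] by (cases "h w < s") auto
    then show "F (w + 1) \<le> F w + (s - p s)" using F0[of w] h[of w] mono[of "h w" s] by (simp add: F_def)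
  next
    fix w assume "p s \<le> w"
    then have "s \<le> h w" using h[of w] mono[of "h w + 1" s] by (cases "s \<le> h w") auto
    then show "F w + (s - p s) \<le> F (w + 1)" using F0[of w] h[of w] mono[of s "h w"] by (simp add: F_def)
  qed
  have G_sub: "G (s - p s) + (y - (s - p s)) * p s \<le> G y" for y s
  proof (rule discrete_subgradient)
    fix w assume w: "w < s - p s"
    then have "v w < s" using v[of w] mono[of s "v w"] by (cases "v w < s") auto
    then show "G (w + 1) \<le> G w + p s" using G[of w] v[of w] mono[of "v w" s] by simp
  next
    fix w assume "s - p s \<le> w"
    then have "s \<le> v w" using v[of w] mono[of "v w + 1" s] by (cases "s \<le> v w") auto
    then show "G w + p s \<le> G (w + 1)" using G[of w] v[of w] mono[of s "v w"] by simp
  qed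
  \<comment> \<open>Both subgradient inequalities are taken at the point of the path on the
    antidiagonal \<open>u + y\<close>; their sum leaves exactly the square.\<close>
  have gap: "u * y + (p (u + y) - u) * (p (u + y) - u) \<le> F u + G y" for u y
    using F_sub[of "u + y" u] G_sub[of "u + y" y] on[of "u + y"] by (simp add: algebra_simps)
  show ?thesis
  proof (rule that)
    show "u * y \<le> F u + G y" for u y
      using gap[of u y] zero_le_square[of "p (u + y) - u"] by linarith
    show "u * y = F u + G y \<longleftrightarrow> p (u + y) = u" for u y
    proof
      assume "u * y = F u + G y"
      then have "(p (u + y) - u) * (p (u + y) - u) = 0"
        using gap[of u y] zero_le_square[of "p (u + y) - u"] by linarith
      then show "p (u + y) = u" by simp
    next
      assume "p (u + y) = u"
      then show "u * y = F u + G y" using on[of "u + y"] by simp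
    qed
  qed
qed

section \<open>Substitution and lowest forms\<close>

lemma poly_mapping_sum_single: "p = (\<Sum>m\<in>Poly_Mapping.keys p. Poly_Mapping.single m (Poly_Mapping.lookup p m))"
proof (rule poly_mapping_eqI)
  fix k
  have "Poly_Mapping.lookup (\<Sum>m\<in>Poly_Mapping.keys p. Poly_Mapping.single m (Poly_Mapping.lookup p m)) k =
    (\<Sum>m\<in>Poly_Mapping.keys p. if m = k then Poly_Mapping.lookup p m else 0)"
    by (simp add: lookup_sum lookup_single when_def)
  also have "\<dots> = Poly_Mapping.lookup p k" by (simp add: sum.delta in_keys_iff)
  finally show "Poly_Mapping.lookup p k =
    Poly_Mapping.lookup (\<Sum>m\<in>Poly_Mapping.keys p. Poly_Mapping.single m (Poly_Mapping.lookup p m)) k" by simp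
qed

definition monomial_subst :: "(nat \<times> nat \<Rightarrow> 'k mpoly) \<Rightarrow> monomial \<Rightarrow> 'k::field mpoly" where
  "monomial_subst f m = (\<Prod>v\<in>Poly_Mapping.keys m. f v ^ Poly_Mapping.lookup m v)"

definition poly_subst :: "(nat \<times> nat \<Rightarrow> 'k mpoly) \<Rightarrow> 'k mpoly \<Rightarrow> 'k::field mpoly" where
  "poly_subst f p = (\<Sum>m\<in>Poly_Mapping.keys p. mpoly_const (Poly_Mapping.lookup p m) * monomial_subst f m)"

lemma monomial_subst_superset:
  assumes "Poly_Mapping.keys m \<subseteq> A" "finite A"
  shows "monomial_subst f m = (\<Prod>v\<in>A. f v ^ Poly_Mapping.lookup m v)"
  unfolding monomial_subst_def using assms by (intro prod.mono_neutral_left) (auto simp: in_keys_iff)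

lemma monomial_subst_add: "monomial_subst f (m + m') = monomial_subst f m * monomial_subst f m'"
proof -
  let ?A = "Poly_Mapping.keys (m + m')"
  have "Poly_Mapping.keys m \<subseteq> ?A" "Poly_Mapping.keys m' \<subseteq> ?A" by (auto simp: keys_add_nat)
  then show ?thesis
    using monomial_subst_superset[of m ?A f] monomial_subst_superset[of m' ?A f]
      monomial_subst_superset[of "m + m'" ?A f]
    by (simp add: lookup_add power_add prod.distrib)
qed

lemma mpoly_const_simps: "mpoly_const (0::'k::field) = 0" "mpoly_const (1::'k) = 1"
  "mpoly_const (a + b :: 'k) = mpoly_const a + mpoly_const b"
  "mpoly_const (a * b :: 'k) = mpoly_const a * mpoly_const b"
  by (auto simp: mpoly_const_def single_add mult_single)

lemma poly_subst_superset:
  assumes "Poly_Mapping.keys p \<subseteq> A" "finite A"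
  shows "poly_subst f p = (\<Sum>m\<in>A. mpoly_const (Poly_Mapping.lookup p m) * monomial_subst f m)"
  unfolding poly_subst_def using assms
  by (intro sum.mono_neutral_left) (auto simp: in_keys_iff mpoly_const_simps)

lemma poly_subst_add: "poly_subst f (p + q) = poly_subst f p + poly_subst f q"
proof -
  let ?A = "Poly_Mapping.keys p \<union> Poly_Mapping.keys q"
  have "Poly_Mapping.keys (p + q) \<subseteq> ?A" by (rule keys_add)
  then show ?thesis
    using poly_subst_superset[of p ?A f] poly_subst_superset[of q ?A f]
      poly_subst_superset[of "p + q" ?A f]
    by (simp add: lookup_add mpoly_const_simps sum.distrib distrib_right)
qed

lemma poly_subst_zero [simp]: "poly_subst f 0 = 0"
  by (simp add: poly_subst_def)

lemma poly_subst_single [simp]: "poly_subst f (Poly_Mapping.single m c) = mpoly_const c * monomial_subst f m"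
  by (auto simp: poly_subst_def mpoly_const_simps)

lemma poly_subst_sum: "poly_subst f (\<Sum>x\<in>A. g x) = (\<Sum>x\<in>A. poly_subst f (g x))"
  by (induction A rule: infinite_finite_induct) (auto simp: poly_subst_add)

lemma poly_subst_one: "poly_subst f 1 = 1"
  using poly_subst_single[of f 0 1] by (simp add: mpoly_const_simps monomial_subst_def)

lemma poly_subst_mult: "poly_subst f (p * q) = poly_subst f p * poly_subst f q"
proof -
  have "poly_subst f (p * q) = poly_subst f
    ((\<Sum>m\<in>Poly_Mapping.keys p. Poly_Mapping.single m (Poly_Mapping.lookup p m)) *
     (\<Sum>m\<in>Poly_Mapping.keys q. Poly_Mapping.single m (Poly_Mapping.lookup q m)))"
    by (simp only: poly_mapping_sum_single[symmetric])
  also have "\<dots> = (\<Sum>m\<in>Poly_Mapping.keys p. \<Sum>m'\<in>Poly_Mapping.keys q.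
    (mpoly_const (Poly_Mapping.lookup p m) * monomial_subst f m) *
    (mpoly_const (Poly_Mapping.lookup q m') * monomial_subst f m'))"
    by (simp add: sum_product poly_subst_sum mult_single mpoly_const_simps monomial_subst_add mult_ac)
  also have "\<dots> = poly_subst f p * poly_subst f q"
    by (simp add: poly_subst_def sum_product)
  finally show ?thesis .
qed

lemma poly_subst_var: "poly_subst f (mpoly_var v) = f v"
  by (simp add: mpoly_var_def mpoly_const_simps monomial_subst_def)

lemma poly_subst_uminus: "poly_subst f (- p) = - poly_subst f p"
  using poly_subst_add[of f p "- p"] by (simp add: eq_neg_iff_add_eq_0 add.commute)

text \<open>The value \<open>Q = 0\<close> is allowed and then says that \<open>P\<close> has only
  terms of degree above \<open>w\<close>. This is the case of a variable off the paths.\<close>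

definition initial_form :: "(monomial \<Rightarrow> int) \<Rightarrow> 'k::field mpoly \<Rightarrow> int \<Rightarrow> 'k mpoly \<Rightarrow> bool" where
  "initial_form d P w Q \<longleftrightarrow> (\<forall>\<mu>\<in>Poly_Mapping.keys Q. d \<mu> = w) \<and> (\<forall>\<mu>\<in>Poly_Mapping.keys (P - Q). w < d \<mu>)"

lemma keys_minus_subset: "Poly_Mapping.keys (p - q :: 'a \<Rightarrow>\<^sub>0 'b::ab_group_add) \<subseteq> Poly_Mapping.keys p \<union> Poly_Mapping.keys q"
  by (auto simp: in_keys_iff lookup_minus)

lemma initial_form_keys:
  assumes "initial_form d P w Q" "\<mu> \<in> Poly_Mapping.keys P"
  shows "w \<le> d \<mu>"
proof -
  have "\<mu> \<in> Poly_Mapping.keys Q \<union> Poly_Mapping.keys (P - Q)"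
    using assms(2) by (auto simp: in_keys_iff lookup_minus)
  then show ?thesis using assms(1) by (auto simp: initial_form_def)
qed

lemma initial_form_lookup:
  assumes "initial_form d P w Q" "d \<mu> \<le> w"
  shows "Poly_Mapping.lookup P \<mu> = Poly_Mapping.lookup Q \<mu>"
proof -
  have "\<mu> \<notin> Poly_Mapping.keys (P - Q)" using assms by (fastforce simp: initial_form_def)
  then show ?thesis by (simp add: in_keys_iff lookup_minus)
qed

lemma initial_form_mult:
  assumes d: "\<And>a b. d (a + b) = d a + d b"
    and P: "initial_form d P w Q" and P': "initial_form d P' w' Q'"
  shows "initial_form d (P * P') (w + w') (Q * Q')"
proof -
  have split: "P * P' - Q * Q' = (P - Q) * P' + Q * (P' - Q')" by (simp add: algebra_simps)
  have "w + w' < d \<mu>" if \<mu>: "\<mu> \<in> Poly_Mapping.keys (P * P' - Q * Q')" for \<mu>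
  proof -
    have "\<mu> \<in> Poly_Mapping.keys ((P - Q) * P') \<or> \<mu> \<in> Poly_Mapping.keys (Q * (P' - Q'))"
      using \<mu> keys_add[of "(P - Q) * P'" "Q * (P' - Q')"] by (auto simp: split)
    then show ?thesis
    proof
      assume "\<mu> \<in> Poly_Mapping.keys ((P - Q) * P')"
      then obtain a b where ab: "\<mu> = a + b" "a \<in> Poly_Mapping.keys (P - Q)" "b \<in> Poly_Mapping.keys P'"
        using keys_mult[of "P - Q" P'] by blast
      then show ?thesis using P initial_form_keys[OF P' ab(3)] d[of a b] by (auto simp: initial_form_def)
    next
      assume "\<mu> \<in> Poly_Mapping.keys (Q * (P' - Q'))"
      then obtain a b where ab: "\<mu> = a + b" "a \<in> Poly_Mapping.keys Q" "b \<in> Poly_Mapping.keys (P' - Q')"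
        using keys_mult[of Q "P' - Q'"] by blast
      then show ?thesis using P P' d[of a b] by (auto simp: initial_form_def)
    qed
  qed
  moreover have "d \<mu> = w + w'" if \<mu>: "\<mu> \<in> Poly_Mapping.keys (Q * Q')" for \<mu>
  proof -
    obtain a b where "\<mu> = a + b" "a \<in> Poly_Mapping.keys Q" "b \<in> Poly_Mapping.keys Q'"
      using \<mu> keys_mult[of Q Q'] by blast
    then show ?thesis using P P' d[of a b] by (auto simp: initial_form_def)
  qed
  ultimately show ?thesis unfolding initial_form_def by blast
qed

lemma initial_form_one: "d 0 = 0 \<Longrightarrow> initial_form d 1 0 1"
  by (auto simp: initial_form_def)

lemma initial_form_power:
  assumes d: "\<And>a b. d (a + b) = d a + d b" "d 0 = 0" and P: "initial_form d P w Q"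
  shows "initial_form d (P ^ c) (int c * w) (Q ^ c)"
proof (induction c)
  case 0
  then show ?case using initial_form_one[of d, OF d(2)] by simp
next
  case (Suc c)
  then show ?case using initial_form_mult[OF d(1) P Suc] by (simp add: algebra_simps)
qed

lemma initial_form_prod:
  assumes d: "\<And>a b. d (a + b) = d a + d b" "d 0 = 0"
    and P: "\<And>x. x \<in> A \<Longrightarrow> initial_form d (P x) (w x) (Q x)" and "finite A"
  shows "initial_form d (\<Prod>x\<in>A. P x) (\<Sum>x\<in>A. w x) (\<Prod>x\<in>A. Q x)"
  using \<open>finite A\<close> P
proof (induction A rule: finite_induct)
  case empty
  show ?case using initial_form_one[of d, OF d(2)] by simp
next
  case (insert x A)
  then show ?case using initial_form_mult[OF d(1), of "P x" "w x" "Q x"] by simp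
qed

text \<open>The substitution stays within the same polynomial type, whose variables are index pairs;
  the parity of the first index separates the two kinds of variables.\<close>

definition form_var :: "nat \<Rightarrow> bool \<Rightarrow> nat \<Rightarrow> monomial" where
  "form_var k t v = Poly_Mapping.single (2 * k + of_bool t, v) 1"

text \<open>The Gram matrix of a sum of hyperbolic planes, one for each first component. Its values
  are integers, as \<open>Pf_low_rank\<close> demands.\<close>

definition form_sign :: "nat \<times> bool \<Rightarrow> nat \<times> bool \<Rightarrow> int" where
  "form_sign x y = (if fst x = fst y \<and> snd x \<noteq> snd y then (if snd x then 1 else - 1) else 0)"

text \<open>Here \<open>form_var k True v\<close> is the variable \<open>b\<^sub>k\<^sub>v\<close> and \<open>form_var k False v\<close> is \<open>a\<^sub>k\<^sub>v\<close>.\<close>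

definition low_rank_entry :: "nat \<Rightarrow> nat \<Rightarrow> nat \<Rightarrow> 'k::field mpoly" where
  "low_rank_entry r i j = (\<Sum>x\<in>{..<r} \<times> UNIV. \<Sum>y\<in>{..<r} \<times> UNIV.
     Poly_Mapping.single (form_var (fst x) (snd x) i) 1 *
     Poly_Mapping.single (form_var (fst y) (snd y) j) 1 * of_int (form_sign x y))"

lemma low_rank_entry_eq: "low_rank_entry r i j =
  (\<Sum>k<r. Poly_Mapping.single (form_var k True i + form_var k False j) (1::'k::field) -
          Poly_Mapping.single (form_var k False i + form_var k True j) 1)"
proof -
  let ?g = "\<lambda>k t l u. Poly_Mapping.single (form_var k t i) (1::'k) * Poly_Mapping.single (form_var l u j) 1 *
    of_int (form_sign (k, t) (l, u))"
  have pairs: "(\<Sum>x\<in>{..<r} \<times> UNIV. g x) = (\<Sum>k<r. \<Sum>t\<in>UNIV. g (k, t))"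
    for g :: "nat \<times> bool \<Rightarrow> 'k mpoly"
    by (simp add: sum.cartesian_product)
  have "low_rank_entry r i j = (\<Sum>k<r. \<Sum>t\<in>UNIV. \<Sum>l<r. \<Sum>u\<in>UNIV. ?g k t l u)"
    unfolding low_rank_entry_def pairs by simp
  also have "\<dots> = (\<Sum>k<r. \<Sum>t\<in>UNIV. \<Sum>u\<in>UNIV. ?g k t k u)"
  proof (intro sum.cong refl)
    fix k t assume "k \<in> {..<r}"
    have "(\<Sum>l<r. \<Sum>u\<in>UNIV. ?g k t l u) = (\<Sum>l<r. if l = k then \<Sum>u\<in>UNIV. ?g k t k u else 0)"
      by (intro sum.cong) (auto simp: form_sign_def)
    then show "(\<Sum>l<r. \<Sum>u\<in>UNIV. ?g k t l u) = (\<Sum>u\<in>UNIV. ?g k t k u)"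
      using \<open>k \<in> {..<r}\<close> by (simp add: sum.delta)
  qed
  also have "\<dots> = (\<Sum>k<r. Poly_Mapping.single (form_var k True i + form_var k False j) (1::'k) -
          Poly_Mapping.single (form_var k False i + form_var k True j) 1)"
    by (simp add: UNIV_bool form_sign_def mult_single)
  finally show ?thesis .
qed

definition rank_subst :: "nat \<Rightarrow> 'k mpoly \<Rightarrow> 'k::field mpoly" where
  "rank_subst r = poly_subst (\<lambda>v. low_rank_entry r (fst v) (snd v))"

text \<open>The substituted matrix factors through \<open>2 * r\<close> indices, fewer than the
  \<open>2 * (r + 1)\<close> rows of the minor.\<close>

lemma rank_subst_minor:
  assumes "p \<in> pfaffian_minors (r + 1) n"
  shows "rank_subst r p = 0"
proof -
  let ?N = "2 * (r + 1)"
  let ?h = "rank_subst r"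
  obtain s where s: "strict_mono_on {1..?N} s"
    and p: "p = Pf (r + 1) (\<lambda>a b. generic_skew (s a) (s b))"
    using assms by (auto simp: pfaffian_minors_def)
  have "?h p = Pf (r + 1) (\<lambda>a b. ?h (generic_skew (s a) (s b)))"
    unfolding p by (rule Pf_hom) (auto simp: rank_subst_def poly_subst_add poly_subst_mult poly_subst_one)
  also have "\<dots> = Pf (r + 1) (\<lambda>a b. low_rank_entry r (s a) (s b))"
    unfolding Pf_def
  proof (intro sum.cong refl arg_cong2[of _ _ _ _ "(*)"] prod.cong)
    fix M e assume M: "M \<in> perfect_matchings (r + 1)" "e \<in> M"
    have "s (fst e) < s (snd e)" using perfect_matching_edge[OF M] strict_mono_onD[OF s] by auto
    then show "(case e of (a, b) \<Rightarrow> ?h (generic_skew (s a) (s b))) =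
        (case e of (a, b) \<Rightarrow> low_rank_entry r (s a) (s b))"
      by (auto simp: generic_skew_def rank_subst_def poly_subst_var case_prod_unfold)
  qed
  also have "\<dots> = 0"
    unfolding low_rank_entry_def
  proof (rule Pf_low_rank)
    show "form_sign y x = - form_sign x y" for x y
      by (cases x; cases y; cases "fst x = fst y"; cases "snd x"; cases "snd y") (auto simp: form_sign_def)
  qed (simp_all add: card_cartesian_product)
  finally show ?thesis .
qed

context pfaffian_setting
begin

lemma covering_family:
  assumes "F \<subseteq> skew_vars n" "nest_level F r = {}"
  obtains q where "good_family q" "F \<subseteq> covers q"
  using light_family_good covers_light_family assms by blast

context
  fixes q :: "nat \<Rightarrow> int \<Rightarrow> int"
  assumes q: "good_family q"
begin

text \<open>The potentials require a path that crosses every row and every column; the zigzags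
  supply this by continuing the finite path in both directions.\<close>

lemma good_potentials:
  assumes k: "k < r"
  obtains F G :: "int \<Rightarrow> int" where "\<And>u y. u * y \<le> F u + G y"
    "\<And>u y. u * y = F u + G y \<longleftrightarrow> q k (u + y) = u"
proof (rule path_potentials[of "q k"])
  note zz = good_zigzag[OF q k] and st = good_step[OF q k]
  show "q k (s + 1) = q k s \<or> q k (s + 1) = q k s + 1" for s by (rule st)
  show "\<exists>s. q k s = u \<and> q k (s + 1) = u + 1" for u
  proof -
    let ?a = "min lo (2 * u - 2 * int k - 2)" and ?b = "max hi (2 * u + 2)"
    show ?thesis
    proof (rule crossing_exists[of "q k" ?a ?b u])
      show "q k (s + 1) = q k s \<or> q k (s + 1) = q k s + 1" for s by (rule st)
      show "q k ?a \<le> u" using zz[of ?a] by (auto simp: zigzag_def)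
      show "u < q k ?b" using zz[of ?b] by (auto simp: zigzag_def)
      show "?a \<le> ?b" using lo_le_hi by auto
    qed
  qed
  show "\<exists>s. s - q k s = y \<and> q k (s + 1) = q k s" for y
  proof -
    let ?a = "min lo (2 * y)" and ?b = "max hi (2 * y + 2 * int k + 4)"
    have "\<exists>s. s - q k s = y \<and> s + 1 - q k (s + 1) = y + 1"
    proof (rule crossing_exists[of "\<lambda>s. s - q k s" ?a ?b y])
      show "s + 1 - q k (s + 1) = s - q k s \<or> s + 1 - q k (s + 1) = s - q k s + 1" for s
        using st[of s] by auto
      show "?a - q k ?a \<le> y" using zz[of ?a] by (auto simp: zigzag_def)
      show "y < ?b - q k ?b" using zz[of ?b] by (auto simp: zigzag_def)
      show "?a \<le> ?b" using lo_le_hi by auto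
    qed
    then show ?thesis by fastforce
  qed
qed (use that in blast)

definition path_index :: "nat \<times> nat \<Rightarrow> nat" where
  "path_index v = (SOME k. k < r \<and> q k (vsum v) = int (snd v))"

lemma path_index:
  assumes "v \<in> covers q"
  shows "path_index v < r" "q (path_index v) (vsum v) = int (snd v)"
  using assms someI_ex[of "\<lambda>k. k < r \<and> q k (vsum v) = int (snd v)"]
  by (auto simp: covers_def path_index_def)

definition lead_monomial :: "nat \<times> nat \<Rightarrow> monomial" where
  "lead_monomial v = form_var (path_index v) True (fst v) + form_var (path_index v) False (snd v)"

definition lead_image :: "monomial \<Rightarrow> monomial" where
  "lead_image m = (\<Sum>v\<in>Poly_Mapping.keys m. \<Sum>_<Poly_Mapping.lookup m v. lead_monomial v)"

lemma lookup_lead_image: "Poly_Mapping.lookup (lead_image m) x =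
    (\<Sum>v\<in>Poly_Mapping.keys m. Poly_Mapping.lookup m v * Poly_Mapping.lookup (lead_monomial v) x)"
  by (simp add: lead_image_def lookup_sum)

lemma lookup_lead_image_superset:
  assumes "Poly_Mapping.keys m \<subseteq> A" "finite A"
  shows "Poly_Mapping.lookup (lead_image m) x =
    (\<Sum>v\<in>A. Poly_Mapping.lookup m v * Poly_Mapping.lookup (lead_monomial v) x)"
  unfolding lookup_lead_image using assms by (rule keys_sum_superset)

lemma lookup_lead_monomial:
  "Poly_Mapping.lookup (lead_monomial v) (2 * k, j) = (if path_index v = k \<and> snd v = j then 1 else 0)"
  "Poly_Mapping.lookup (lead_monomial v) (2 * k + 1, i) = (if path_index v = k \<and> fst v = i then 1 else 0)"
proof -
  have "2 * a + 1 \<noteq> 2 * b" for a b :: nat by presburger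
  then show "Poly_Mapping.lookup (lead_monomial v) (2 * k, j) = (if path_index v = k \<and> snd v = j then 1 else 0)"
    by (auto simp: lead_monomial_def form_var_def lookup_add lookup_single when_def)
  have "2 * b \<noteq> 2 * a + 1" for a b :: nat by presburger
  then show "Poly_Mapping.lookup (lead_monomial v) (2 * k + 1, i) = (if path_index v = k \<and> fst v = i then 1 else 0)"
    by (auto simp: lead_monomial_def form_var_def lookup_add lookup_single when_def)
qed

text \<open>At the first point of a path where two monomials differ, the path leaves either the row or
  the column of that point, so the exponent of the corresponding variable tells them apart.\<close>

lemma lead_image_inj:
  assumes m: "Poly_Mapping.keys m \<subseteq> covers q" "Poly_Mapping.keys m' \<subseteq> covers q"
    and eq: "lead_image m = lead_image m'"
  shows "m = m'"
proof (rule ccontr)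
  assume "m \<noteq> m'"
  define D where "D = {v. Poly_Mapping.lookup m v \<noteq> Poly_Mapping.lookup m' v}"
  have D_sub: "D \<subseteq> Poly_Mapping.keys m \<union> Poly_Mapping.keys m'" by (auto simp: D_def in_keys_iff)
  then have "finite D" by (rule finite_subset) simp
  moreover have "D \<noteq> {}" using \<open>m \<noteq> m'\<close> by (auto simp: D_def intro: poly_mapping_eqI)
  ultimately obtain v where v: "v \<in> D" "\<And>u. u \<in> D \<Longrightarrow> vsum v \<le> vsum u"
    using ex_is_arg_min_if_finite[of D vsum] by (force simp: is_arg_min_linorder)
  have Dc: "D \<subseteq> covers q" using D_sub m by blast
  let ?k = "path_index v" and ?s = "vsum v"
  have k: "?k < r" "q ?k ?s = int (snd v)" using path_index[of v] v(1) Dc by auto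
  let ?A = "Poly_Mapping.keys m \<union> Poly_Mapping.keys m'"
  \<comment> \<open>If \<open>v\<close> is the only place of difference whose leading monomial
    contains \<open>x\<close>, all other terms of the two exponents of \<open>x\<close> agree, and
    so must those at \<open>v\<close>.\<close>
  have clash: False if x: "Poly_Mapping.lookup (lead_monomial v) x = 1"
    and other: "\<And>u. u \<in> D \<Longrightarrow> Poly_Mapping.lookup (lead_monomial u) x \<noteq> 0 \<Longrightarrow> u = v" for x
  proof -
    have "(\<Sum>u\<in>?A. Poly_Mapping.lookup m u * Poly_Mapping.lookup (lead_monomial u) x) =
      (\<Sum>u\<in>?A. Poly_Mapping.lookup m' u * Poly_Mapping.lookup (lead_monomial u) x)"
      using eq lookup_lead_image_superset[of m ?A x] lookup_lead_image_superset[of m' ?A x] by simp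
    moreover have vA: "v \<in> ?A" using v D_sub by blast
    have "(\<Sum>u\<in>?A - {v}. Poly_Mapping.lookup m u * Poly_Mapping.lookup (lead_monomial u) x) =
      (\<Sum>u\<in>?A - {v}. Poly_Mapping.lookup m' u * Poly_Mapping.lookup (lead_monomial u) x)"
      using other by (intro sum.cong) (auto simp: D_def)
    ultimately have "Poly_Mapping.lookup m v = Poly_Mapping.lookup m' v"
      using x vA by (simp add: sum.remove[of ?A v])
    then show False using v by (simp add: D_def)
  qed
  have same: "vsum u = ?s \<Longrightarrow> u = v" if "u \<in> D" "path_index u = ?k" for u
    using path_index[of u] that Dc k by (auto simp: vsum_def prod_eq_iff)
  show False
    using good_step[OF q k(1), of ?s]
  proof
    \<comment> \<open>A vertical step leaves row \<open>fst v\<close> for good, so its row variable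
      occurs at no later point of the path; the choice of \<open>v\<close> rules out earlier points.
      After a horizontal step the column variable plays this part.\<close>
    assume st: "q ?k (?s + 1) = q ?k ?s"
    show False
    proof (rule clash[of "(2 * ?k + 1, fst v)"])
      fix u assume u: "u \<in> D" "Poly_Mapping.lookup (lead_monomial u) (2 * ?k + 1, fst v) \<noteq> 0"
      from u(2) have uk: "path_index u = ?k" "fst u = fst v"
        unfolding lookup_lead_monomial by (auto split: if_splits)
      have "q ?k (vsum u) = int (snd u)" using path_index[of u] u(1) uk(1) Dc by auto
      then have "\<not> ?s + 1 \<le> vsum u"
        using good_lipschitz[OF q k(1), of "?s + 1" "vsum u"] st k uk by (auto simp: vsum_def)
      then show "u = v" using same[OF u(1) uk(1)] v(2)[OF u(1)] by simp
    qed (simp only: lookup_lead_monomial, simp)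
  next
    assume st: "q ?k (?s + 1) = q ?k ?s + 1"
    show False
    proof (rule clash[of "(2 * ?k, snd v)"])
      fix u assume u: "u \<in> D" "Poly_Mapping.lookup (lead_monomial u) (2 * ?k, snd v) \<noteq> 0"
      from u(2) have uk: "path_index u = ?k" "snd u = snd v"
        unfolding lookup_lead_monomial by (auto split: if_splits)
      have "q ?k (vsum u) = int (snd u)" using path_index[of u] u(1) uk(1) Dc by auto
      then have "\<not> ?s + 1 \<le> vsum u"
        using good_lipschitz[OF q k(1), of "?s + 1" "vsum u"] st k uk by (auto simp: vsum_def)
      then show "u = v" using same[OF u(1) uk(1)] v(2)[OF u(1)] by simp
    qed (simp only: lookup_lead_monomial, simp)
  qed
qed

end

end

section \<open>Independence and spanning modulo the Pfaffian ideal\<close>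


lemma lookup_mpoly_const_mult:
  "Poly_Mapping.lookup (mpoly_const c * p) m = c * Poly_Mapping.lookup p m"
  unfolding mpoly_const_def mult_map_scale_conv_mult[symmetric]
  by (simp add: Poly_Mapping.map.rep_eq when_def)

lemma single_power: "Poly_Mapping.single m (1::'a::comm_semiring_1) ^ c =
    Poly_Mapping.single (\<Sum>_<c. m :: 'b::comm_monoid_add) 1"
  using prod_single_one[where A = "{..<c}" and f = "\<lambda>_. m" and 'a = 'a] by simp

context pfaffian_setting
begin

context
  fixes q :: "nat \<Rightarrow> int \<Rightarrow> int"
  assumes q: "good_family q"
begin

definition lead_poly :: "nat \<times> nat \<Rightarrow> 'k::field mpoly" where
  "lead_poly v = (if v \<in> covers q then Poly_Mapping.single (lead_monomial q v) 1 else 0)"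

lemma monomial_subst_lead_poly:
  "monomial_subst lead_poly m = (if Poly_Mapping.keys m \<subseteq> covers q
     then Poly_Mapping.single (lead_image q m) 1 else (0::'k::field mpoly))"
proof (cases "Poly_Mapping.keys m \<subseteq> covers q")
  case True
  then have "monomial_subst lead_poly m = (\<Prod>v\<in>Poly_Mapping.keys m.
      Poly_Mapping.single (\<Sum>_<Poly_Mapping.lookup m v. lead_monomial q v) (1::'k))"
    unfolding monomial_subst_def by (intro prod.cong) (auto simp: lead_poly_def single_power)
  then show ?thesis using True by (simp add: prod_single_one lead_image_def[OF q])
next
  case False
  then obtain v where v: "v \<in> Poly_Mapping.keys m" "v \<notin> covers q" by blast
  then have "lead_poly v ^ Poly_Mapping.lookup m v = (0::'k mpoly)"
    by (auto simp: lead_poly_def in_keys_iff power_0_left)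
  then have "monomial_subst lead_poly m = (0::'k mpoly)" unfolding monomial_subst_def
    using v by (intro prod_zero) auto
  then show ?thesis using False by simp
qed

text \<open>At most one path passes through \<open>(i, j)\<close>, so the lowest part of an entry is
  a single monomial, or zero off the paths. The mirrored products of an entry never reach degree
  \<open>i * j\<close>: their equality case would put a path on the wrong side of the diagonal.
  Lowest parts then multiply.\<close>

lemma initial_forms:
  obtains d where "\<And>a b. d (a + b) = d a + d b" "d 0 = 0"
    "\<And>m. Poly_Mapping.keys m \<subseteq> skew_vars n \<Longrightarrow>
       initial_form d (monomial_subst (\<lambda>v. low_rank_entry r (fst v) (snd v)) m) (int (weight m))
         (monomial_subst lead_poly m :: 'k::field mpoly)"
proof -
  have "\<forall>k. \<exists>F G :: int \<Rightarrow> int. k < r \<longrightarrow>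
      (\<forall>u y. u * y \<le> F u + G y \<and> (u * y = F u + G y \<longleftrightarrow> q k (u + y) = u))"
    using good_potentials[OF q] by metis
  then obtain F G :: "nat \<Rightarrow> int \<Rightarrow> int" where FG: "\<And>k u y. k < r \<Longrightarrow> u * y \<le> F k u + G k y"
    "\<And>k u y. k < r \<Longrightarrow> (u * y = F k u + G k y \<longleftrightarrow> q k (u + y) = u)"
    by metis
  define w where "w x = (if even (fst x) then F (fst x div 2) (int (snd x)) else G (fst x div 2) (int (snd x)))"
    for x :: "nat \<times> nat"
  define d where "d \<mu> = (\<Sum>x\<in>Poly_Mapping.keys \<mu>. int (Poly_Mapping.lookup \<mu> x) * w x)" for \<mu> :: monomial
  have d_superset: "d \<mu> = (\<Sum>x\<in>A. int (Poly_Mapping.lookup \<mu> x) * w x)"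
    if "Poly_Mapping.keys \<mu> \<subseteq> A" "finite A" for \<mu> A
    unfolding d_def using that by (intro sum.mono_neutral_left) (auto simp: in_keys_iff)
  have d_add: "d (a + b) = d a + d b" for a b
    using d_superset[of a "Poly_Mapping.keys (a + b)"] d_superset[of b "Poly_Mapping.keys (a + b)"]
      d_superset[of "a + b" "Poly_Mapping.keys (a + b)"]
    by (simp add: keys_add_nat lookup_add sum.distrib distrib_right)
  have d_zero: "d 0 = 0" by (simp add: d_def)
  have d_var: "d (form_var k False j) = F k (int j)" "d (form_var k True i) = G k (int i)" for k i j
    by (auto simp: d_def form_var_def w_def)
  have entry: "initial_form d (low_rank_entry r i j) (int i * int j) (lead_poly (i, j) :: 'k mpoly)"
    if v: "(i, j) \<in> skew_vars n" for i j
    unfolding initial_form_def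
  proof (intro conjI ballI)
    let ?t = "\<lambda>k. form_var k True i + form_var k False j"
    let ?s = "\<lambda>k. form_var k False i + form_var k True j"
    have ij: "i < j" using v by (simp add: skew_vars_def)
    have dt: "int i * int j \<le> d (?t k)" if "k < r" for k
      using FG(1)[OF that, of "int j" "int i"] by (simp add: d_add d_var mult.commute)
    have dt_eq: "q k (vsum (i, j)) = int j" if "k < r" "d (?t k) \<le> int i * int j" for k
      using FG(2)[OF that(1), of "int j" "int i"] FG(1)[OF that(1), of "int j" "int i"] that(2)
      by (simp add: d_add d_var mult.commute vsum_def add.commute)
    have ds: "int i * int j < d (?s k)" if "k < r" for k
    proof -
      have "q k (int i + int j) \<noteq> int i"
        using good_diag'[OF q that, of "int i + int j"] ij by auto
      then show ?thesis using FG[OF that, of "int i" "int j"] by (simp add: d_add d_var)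
    qed
    show "d \<mu> = int i * int j" if \<mu>: "\<mu> \<in> Poly_Mapping.keys (lead_poly (i, j) :: 'k mpoly)" for \<mu>
    proof -
      have c: "(i, j) \<in> covers q" "\<mu> = ?t (path_index q (i, j))"
        using \<mu> by (auto simp: lead_poly_def lead_monomial_def[OF q] split: if_splits)
      then show ?thesis
        using path_index[OF q c(1)] FG(2)[of "path_index q (i, j)" "int j" "int i"]
        by (simp add: d_add d_var vsum_def add.commute mult.commute)
    qed
    show "int i * int j < d \<mu>"
      if \<mu>: "\<mu> \<in> Poly_Mapping.keys (low_rank_entry r i j - lead_poly (i, j) :: 'k mpoly)" for \<mu>
    proof (rule ccontr)
      assume small: "\<not> int i * int j < d \<mu>"
      have s0: "?s k \<noteq> \<mu>" if "k < r" for k using ds[OF that] small by auto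
      have "Poly_Mapping.lookup (low_rank_entry r i j :: 'k mpoly) \<mu> = (\<Sum>k<r. if ?t k = \<mu> then 1 else 0)"
        unfolding low_rank_entry_eq lookup_sum
        by (intro sum.cong) (auto simp: lookup_minus lookup_single when_def s0)
      also have "\<dots> = Poly_Mapping.lookup (lead_poly (i, j)) \<mu>"
      proof (cases "\<exists>k<r. ?t k = \<mu>")
        case True
        then obtain k where k: "k < r" "?t k = \<mu>" by blast
        have qk: "q l (vsum (i, j)) = int j" if "l < r" "?t l = \<mu>" for l
          using dt_eq[OF that(1)] small that by auto
        have c: "(i, j) \<in> covers q" using qk[OF k] k v by (auto simp: covers_def)
        have l: "l = k" if "l < r" "?t l = \<mu>" for l
          by (rule good_inj[OF q that(1) k(1), of "vsum (i, j)"]) (simp add: qk[OF that] qk[OF k])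
        have "path_index q (i, j) = k"
          by (rule good_inj[OF q path_index(1)[OF q c] k(1), of "vsum (i, j)"])
            (use path_index(2)[OF q c] qk[OF k] in simp)
        then have "lead_monomial q (i, j) = \<mu>" using k by (simp add: lead_monomial_def[OF q])
        moreover have "(\<Sum>l<r. if ?t l = \<mu> then 1 else 0 :: 'k) = (\<Sum>l<r. if l = k then 1 else 0)"
        proof (rule sum.cong)
          fix x assume "x \<in> {..<r}"
          then show "(if ?t x = \<mu> then 1 else 0 :: 'k) = (if x = k then 1 else 0)"
            using l[of x] k(2) by (cases "x = k") auto
        qed simp
        ultimately show ?thesis using c k by (simp add: lead_poly_def)
      next
        case False
        have "Poly_Mapping.lookup (lead_poly (i, j) :: 'k mpoly) \<mu> = 0"
          using False path_index[OF q, of "(i, j)"]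
          by (auto simp: lead_poly_def lead_monomial_def[OF q] lookup_single when_def)
        moreover have "(\<Sum>k<r. if ?t k = \<mu> then 1 else 0 :: 'k) = 0" using False by (intro sum.neutral) auto
        ultimately show ?thesis by simp
      qed
      finally show False using \<mu> by (simp add: in_keys_iff lookup_minus)
    qed
  qed
  have "initial_form d (monomial_subst (\<lambda>v. low_rank_entry r (fst v) (snd v)) m) (int (weight m))
      (monomial_subst lead_poly m :: 'k mpoly)" if m: "Poly_Mapping.keys m \<subseteq> skew_vars n" for m
  proof -
    have "initial_form d (\<Prod>v\<in>Poly_Mapping.keys m. (low_rank_entry r (fst v) (snd v) :: 'k mpoly) ^ Poly_Mapping.lookup m v)
      (\<Sum>v\<in>Poly_Mapping.keys m. int (Poly_Mapping.lookup m v) * (int (fst v) * int (snd v)))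
      (\<Prod>v\<in>Poly_Mapping.keys m. lead_poly v ^ Poly_Mapping.lookup m v)"
    proof (rule initial_form_prod[OF d_add d_zero])
      fix v assume "v \<in> Poly_Mapping.keys m"
      then have "(fst v, snd v) \<in> skew_vars n" using m by auto
      from initial_form_power[OF d_add d_zero entry[OF this]]
      show "initial_form d (low_rank_entry r (fst v) (snd v) ^ Poly_Mapping.lookup m v)
        (int (Poly_Mapping.lookup m v) * (int (fst v) * int (snd v))) (lead_poly v ^ Poly_Mapping.lookup m v :: 'k mpoly)"
        by simp
    qed simp
    then show ?thesis by (simp add: monomial_subst_def weight_def)
  qed
  then show ?thesis using that d_add d_zero by blast
qed

end

text \<open>The coefficient of \<open>p\<close> at a nest-free monomial of smallest weight survives as the
  coefficient of the image of that monomial under the substitution attached to a covering family.\<close>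

lemma nest_free_independent:
  fixes p :: "'k::field mpoly"
  assumes zero: "rank_subst r p = 0"
    and p: "\<And>m. m \<in> Poly_Mapping.keys p \<Longrightarrow>
      Poly_Mapping.keys m \<subseteq> skew_vars n \<and> nest_level (Poly_Mapping.keys m) r = {}"
  shows "p = 0"
proof (rule ccontr)
  assume "p \<noteq> 0"
  then have "Poly_Mapping.keys p \<noteq> {}" by (metis ex_in_conv in_keys_iff lookup_zero poly_mapping_eqI)
  then obtain m0 where m0: "m0 \<in> Poly_Mapping.keys p"
    "\<And>m. m \<in> Poly_Mapping.keys p \<Longrightarrow> weight m0 \<le> weight m"
    using ex_is_arg_min_if_finite[of "Poly_Mapping.keys p" weight] by (auto simp: is_arg_min_linorder)
  obtain q where q: "good_family q" "Poly_Mapping.keys m0 \<subseteq> covers q"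
    using covering_family p[OF m0(1)] by blast
  let ?f = "\<lambda>v. low_rank_entry r (fst v) (snd v) :: 'k mpoly"
  obtain d where d: "\<And>m. Poly_Mapping.keys m \<subseteq> skew_vars n \<Longrightarrow>
       initial_form d (monomial_subst ?f m) (int (weight m)) (monomial_subst (lead_poly q) m)"
    using initial_forms[OF q(1)] by metis
  let ?\<mu> = "lead_image q m0"
  have d0: "d ?\<mu> = int (weight m0)"
    using d[of m0] p[OF m0(1)] q(2) by (simp add: initial_form_def monomial_subst_lead_poly[OF q(1)])
  \<comment> \<open>The lowest form controls only degrees up to \<open>weight m\<close>, which is
    where the minimality of \<open>weight m0\<close> enters. A monomial with a variable off the
    paths contributes zero, and one on the paths has a different leading monomial.\<close>
  have coeff: "Poly_Mapping.lookup (monomial_subst ?f m) ?\<mu> = (if m = m0 then 1 else 0)"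
    if m: "m \<in> Poly_Mapping.keys p" for m
  proof -
    have "Poly_Mapping.lookup (monomial_subst ?f m) ?\<mu> = Poly_Mapping.lookup (monomial_subst (lead_poly q) m) ?\<mu>"
      using d[of m] p[OF m] d0 m0(2)[OF m] by (intro initial_form_lookup[of d _ "int (weight m)"]) auto
    also have "\<dots> = (if m = m0 then 1 else 0)"
      using lead_image_inj[OF q(1), of m m0] q(2)
      by (auto simp: monomial_subst_lead_poly[OF q(1)] lookup_single when_def)
    finally show ?thesis .
  qed
  have "0 = Poly_Mapping.lookup (rank_subst r p) ?\<mu>" using zero by simp
  also have "\<dots> = (\<Sum>m\<in>Poly_Mapping.keys p. Poly_Mapping.lookup p m * Poly_Mapping.lookup (monomial_subst ?f m) ?\<mu>)"
    by (simp add: rank_subst_def poly_subst_def lookup_sum lookup_mpoly_const_mult)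
  also have "\<dots> = (\<Sum>m\<in>Poly_Mapping.keys p. if m = m0 then Poly_Mapping.lookup p m0 else 0)"
    using coeff by (intro sum.cong) auto
  also have "\<dots> = Poly_Mapping.lookup p m0" using m0(1) by simp
  finally show False using m0(1) by (simp add: in_keys_iff)
qed

end

section \<open>The polynomial ring and its Pfaffian ideal\<close>

lemma skew_ring_simps [simp]:
  "\<one>\<^bsub>skew_poly_ring n\<^esub> = 1" "\<zero>\<^bsub>skew_poly_ring n\<^esub> = 0"
  "x \<oplus>\<^bsub>skew_poly_ring n\<^esub> y = x + y" "x \<otimes>\<^bsub>skew_poly_ring n\<^esub> y = x * y"
  by (simp_all add: skew_poly_ring_def)

lemma skew_carrier_iff: "p \<in> carrier (skew_poly_ring n) \<longleftrightarrow>
  (\<forall>m\<in>Poly_Mapping.keys p. Poly_Mapping.keys m \<subseteq> skew_vars n)"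
  by (simp add: skew_poly_ring_def)

lemma skew_carrier_closed:
  assumes "p \<in> carrier (skew_poly_ring n)" "q \<in> carrier (skew_poly_ring n)"
  shows "p + q \<in> carrier (skew_poly_ring n)" "p * q \<in> carrier (skew_poly_ring n)"
proof -
  show "p + q \<in> carrier (skew_poly_ring n)"
    using assms keys_add[of p q] unfolding skew_carrier_iff by blast
  show "p * q \<in> carrier (skew_poly_ring n)"
    unfolding skew_carrier_iff
  proof
    fix m assume "m \<in> Poly_Mapping.keys (p * q)"
    then obtain a b where "m = a + b" "a \<in> Poly_Mapping.keys p" "b \<in> Poly_Mapping.keys q"
      using keys_mult[of p q] by blast
    then show "Poly_Mapping.keys m \<subseteq> skew_vars n"
      using assms by (auto simp: keys_add_nat skew_carrier_iff)
  qed
qed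

lemma mpoly_const_carrier: "mpoly_const c \<in> carrier (skew_poly_ring n)"
  by (simp add: skew_carrier_iff mpoly_const_def)

lemma uminus_mpoly: "- p = mpoly_const (- 1) * (p :: 'k::field mpoly)"
  by (rule poly_mapping_eqI) (simp add: lookup_mpoly_const_mult)

lemma mpoly_const_uminus: "mpoly_const (- c :: 'k::field) = - mpoly_const c"
  by (simp add: mpoly_const_def single_uminus)

lemma skew_carrier_uminus: "p \<in> carrier (skew_poly_ring n) \<Longrightarrow> - p \<in> carrier (skew_poly_ring n)"
  unfolding uminus_mpoly by (intro skew_carrier_closed mpoly_const_carrier)

lemma skew_zero_one_carrier: "0 \<in> carrier (skew_poly_ring n)" "1 \<in> carrier (skew_poly_ring n)"
  by (auto simp: skew_carrier_iff)

lemma skew_poly_cring: "cring (skew_poly_ring n :: 'k::field mpoly ring)"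
proof (rule cringI)
  show "abelian_group (skew_poly_ring n :: 'k mpoly ring)"
  proof (rule abelian_groupI)
    fix x :: "'k mpoly" assume "x \<in> carrier (skew_poly_ring n)"
    then show "\<exists>y\<in>carrier (skew_poly_ring n). y \<oplus>\<^bsub>skew_poly_ring n\<^esub> x = \<zero>\<^bsub>skew_poly_ring n\<^esub>"
      by (intro bexI[of _ "- x"] skew_carrier_uminus) auto
  qed (auto simp: skew_carrier_closed skew_zero_one_carrier algebra_simps)
  show "Group.comm_monoid (skew_poly_ring n :: 'k mpoly ring)"
    by (rule comm_monoidI) (auto simp: skew_carrier_closed skew_zero_one_carrier algebra_simps)
qed (auto simp: algebra_simps)

lemma skew_minus:
  assumes "p \<in> carrier (skew_poly_ring n)" "q \<in> carrier (skew_poly_ring n)"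
  shows "p \<ominus>\<^bsub>skew_poly_ring n\<^esub> q = p - (q :: 'k::field mpoly)"
proof -
  interpret cring "skew_poly_ring n :: 'k mpoly ring" by (rule skew_poly_cring)
  have "\<ominus>\<^bsub>skew_poly_ring n\<^esub> q = - q"
    using minus_equality[of "- q" q] skew_carrier_uminus[OF assms(2)] assms(2) by simp
  then show ?thesis by (simp add: a_minus_def)
qed

lemma matching_edge_var:
  assumes s: "strict_mono_on {1..2 * m} s" "s ` {1..2 * m} \<subseteq> {1..n}"
    and M: "M \<in> perfect_matchings m" "e \<in> M"
  shows "(s (fst e), s (snd e)) \<in> skew_vars n"
proof -
  have e: "fst e \<in> {1..2 * m}" "snd e \<in> {1..2 * m}" "fst e < snd e"
    using perfect_matching_edge[OF M] by auto
  have "s (fst e) \<in> {1..n}" "s (snd e) \<in> {1..n}" using e s(2) by blast+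
  moreover have "s (fst e) < s (snd e)" using strict_mono_onD[OF s(1)] e by blast
  ultimately show ?thesis by (auto simp: skew_vars_def)
qed

lemma finite_monomials_of_degree:
  assumes "finite V"
  shows "finite {m :: monomial. Poly_Mapping.keys m \<subseteq> V \<and> total_degree m = l}"
proof (rule finite_subset)
  show "{m :: monomial. Poly_Mapping.keys m \<subseteq> V \<and> total_degree m = l} \<subseteq>
    (\<lambda>f. \<Sum>v\<in>V. Poly_Mapping.single v (f v)) ` (V \<rightarrow>\<^sub>E {..l})"
  proof
    fix m :: monomial assume "m \<in> {m. Poly_Mapping.keys m \<subseteq> V \<and> total_degree m = l}"
    then have m: "Poly_Mapping.keys m \<subseteq> V" "total_degree m = l" by auto
    have le: "Poly_Mapping.lookup m v \<le> l" for v
    proof (cases "v \<in> Poly_Mapping.keys m")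
      case True
      then show ?thesis using m(2) member_le_sum[of v "Poly_Mapping.keys m" "Poly_Mapping.lookup m"]
        by (simp add: total_degree_def)
    qed (simp add: in_keys_iff)
    have "m = (\<Sum>v\<in>V. Poly_Mapping.single v (Poly_Mapping.lookup m v))"
    proof (rule poly_mapping_eqI)
      fix k
      have "Poly_Mapping.lookup (\<Sum>v\<in>V. Poly_Mapping.single v (Poly_Mapping.lookup m v)) k =
        (\<Sum>v\<in>V. if v = k then Poly_Mapping.lookup m v else 0)"
        by (simp add: lookup_sum lookup_single when_def)
      then show "Poly_Mapping.lookup m k =
        Poly_Mapping.lookup (\<Sum>v\<in>V. Poly_Mapping.single v (Poly_Mapping.lookup m v)) k"
        using m assms by (auto simp: in_keys_iff)
    qed
    also have "\<dots> = (\<Sum>v\<in>V. Poly_Mapping.single v (restrict (Poly_Mapping.lookup m) V v))" by simp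
    finally show "m \<in> (\<lambda>f. \<Sum>v\<in>V. Poly_Mapping.single v (f v)) ` (V \<rightarrow>\<^sub>E {..l})"
      using le by (intro image_eqI[of _ _ "restrict (Poly_Mapping.lookup m) V"]) auto
  qed
qed (use assms in \<open>simp add: finite_PiE\<close>)

context pfaffian_setting
begin

definition nest_free_monomials :: "nat \<Rightarrow> monomial set" where
  "nest_free_monomials l = {m. Poly_Mapping.keys m \<subseteq> skew_vars n \<and> total_degree m = l \<and>
     nest_level (Poly_Mapping.keys m) r = {}}"

lemma finite_nest_free_monomials: "finite (nest_free_monomials l)"
  by (rule finite_subset[OF _ finite_monomials_of_degree[OF finite_skew_vars, of l]])
    (auto simp: nest_free_monomials_def)

abbreviation I :: "'k::field mpoly set" where "I \<equiv> pfaffian_ideal (r + 1) n"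

lemma minors_carrier: "(pfaffian_minors (r + 1) n :: 'k::field mpoly set) \<subseteq> carrier (skew_poly_ring n)"
proof
  fix p :: "'k mpoly" assume "p \<in> pfaffian_minors (r + 1) n"
  then obtain s where s: "strict_mono_on {1..2 * (r + 1)} s" "s ` {1..2 * (r + 1)} \<subseteq> {1..n}"
    and p: "p = Pf (r + 1) (\<lambda>a b. generic_skew (s a) (s b))" by (auto simp: pfaffian_minors_def)
  have sum: "(\<Sum>x\<in>A. f x) \<in> carrier (skew_poly_ring n)" if "\<And>x. x \<in> A \<Longrightarrow> f x \<in> carrier (skew_poly_ring n)"
    for A and f :: "(nat \<times> nat) set \<Rightarrow> 'k mpoly"
    using that by (induction A rule: infinite_finite_induct)
      (auto simp: skew_carrier_closed skew_zero_one_carrier)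
  have sign: "(- 1) ^ c * x \<in> carrier (skew_poly_ring n)" if "x \<in> carrier (skew_poly_ring n)"
    for c and x :: "'k mpoly"
    using that by (cases "even c") (auto simp: skew_carrier_uminus)
  show "p \<in> carrier (skew_poly_ring n)" unfolding p Pf_generic_skew[OF s(1)]
  proof (intro sum sign)
    fix M assume M: "M \<in> perfect_matchings (r + 1)"
    have "(s (fst e), s (snd e)) \<in> skew_vars n" if "e \<in> M" for e
      using matching_edge_var[OF s M that] .
    then show "Poly_Mapping.single (matching_monomial s M) (1::'k) \<in> carrier (skew_poly_ring n)"
      using finite_perfect_matching[OF M] by (auto simp: skew_carrier_iff matching_monomial_def keys_sum_nat)
  qed
qed

lemma I_ideal: "ideal (I :: 'k::field mpoly set) (skew_poly_ring n)"
proof -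
  interpret cring "skew_poly_ring n :: 'k mpoly ring" by (rule skew_poly_cring)
  show ?thesis unfolding pfaffian_ideal_def by (rule genideal_ideal[OF minors_carrier])
qed

lemma I_add: "p \<in> I \<Longrightarrow> q \<in> I \<Longrightarrow> p + q \<in> (I :: 'k::field mpoly set)"
  using additive_subgroup.a_closed[OF ideal.axioms(1)[OF I_ideal], of p q] by simp

lemma I_zero: "0 \<in> (I :: 'k::field mpoly set)"
  using additive_subgroup.zero_closed[OF ideal.axioms(1)[OF I_ideal]] by simp

lemma I_mult: "p \<in> I \<Longrightarrow> x \<in> carrier (skew_poly_ring n) \<Longrightarrow> x * p \<in> (I :: 'k::field mpoly set)"
  using ideal.I_l_closed[OF I_ideal, of p x] by simp

lemma I_minor: "p \<in> pfaffian_minors (r + 1) n \<Longrightarrow> p \<in> (I :: 'k::field mpoly set)"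
proof -
  interpret cring "skew_poly_ring n :: 'k mpoly ring" by (rule skew_poly_cring)
  show "p \<in> pfaffian_minors (r + 1) n \<Longrightarrow> p \<in> (I :: 'k mpoly set)"
    unfolding pfaffian_ideal_def using genideal_self[OF minors_carrier] by blast
qed

text \<open>The polynomials in the carrier killed by the substitution form an ideal that contains
  the minors.\<close>

lemma I_rank_subst: "p \<in> I \<Longrightarrow> rank_subst r p = (0 :: 'k::field mpoly)"
proof -
  interpret cring "skew_poly_ring n :: 'k mpoly ring" by (rule skew_poly_cring)
  let ?J = "{p \<in> carrier (skew_poly_ring n). rank_subst r p = (0 :: 'k mpoly)}"
  have inv: "\<ominus>\<^bsub>skew_poly_ring n\<^esub> x = - x" if "x \<in> carrier (skew_poly_ring n)" for x :: "'k mpoly"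
    using minus_equality[of "- x" x] skew_carrier_uminus[OF that] that by simp
  have "ideal ?J (skew_poly_ring n)"
  proof (rule idealI[OF local.ring_axioms])
    show "subgroup ?J (add_monoid (skew_poly_ring n))"
      by (rule add.subgroupI)
        (auto simp: inv rank_subst_def poly_subst_add poly_subst_uminus skew_carrier_closed
          skew_carrier_uminus skew_zero_one_carrier intro!: exI[of _ 0])
  qed (auto simp: rank_subst_def poly_subst_mult skew_carrier_closed)
  moreover have "pfaffian_minors (r + 1) n \<subseteq> ?J" using minors_carrier rank_subst_minor by blast
  ultimately have "I \<subseteq> ?J" unfolding pfaffian_ideal_def by (rule genideal_minimal)
  then show "p \<in> I \<Longrightarrow> rank_subst r p = 0" by blast
qed

text \<open>The degree \<open>l\<close> is part of the normal form because the span is later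
  compared with one homogeneous component.\<close>

definition reducible :: "nat \<Rightarrow> 'k::field mpoly \<Rightarrow> bool" where
  "reducible l p \<longleftrightarrow> (\<exists>g. Poly_Mapping.keys g \<subseteq> nest_free_monomials l \<and> p - g \<in> I)"

lemma reducible_add:
  assumes "reducible l p" "reducible l p'" shows "reducible l (p + p')"
proof -
  obtain g g' where "Poly_Mapping.keys g \<subseteq> nest_free_monomials l" "p - g \<in> I"
    "Poly_Mapping.keys g' \<subseteq> nest_free_monomials l" "p' - g' \<in> I"
    using assms by (auto simp: reducible_def)
  moreover from this have "p + p' - (g + g') \<in> I" using I_add[of "p - g" "p' - g'"] by (simp add: algebra_simps)
  ultimately show ?thesis using keys_add[of g g'] unfolding reducible_def by blast
qed

lemma reducible_const:
  assumes "reducible l p" shows "reducible l (mpoly_const c * p)"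
proof -
  obtain g where g: "Poly_Mapping.keys g \<subseteq> nest_free_monomials l" "p - g \<in> I"
    using assms by (auto simp: reducible_def)
  have "mpoly_const c * p - mpoly_const c * g \<in> I"
    using I_mult[OF g(2) mpoly_const_carrier[of c]] by (simp add: algebra_simps)
  moreover have "Poly_Mapping.keys (mpoly_const c * g) \<subseteq> nest_free_monomials l"
    using g(1) by (auto simp: in_keys_iff lookup_mpoly_const_mult)
  ultimately show ?thesis unfolding reducible_def by blast
qed

lemma reducible_ideal: "p \<in> I \<Longrightarrow> reducible l p"
  unfolding reducible_def by (intro exI[of _ 0]) simp

lemma reducible_sum: "(\<And>x. x \<in> A \<Longrightarrow> reducible l (f x)) \<Longrightarrow> reducible l (\<Sum>x\<in>A. f x)"
  by (induction A rule: infinite_finite_induct) (auto simp: reducible_add reducible_ideal[OF I_zero])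

lemma mpoly_sign: "(- 1 :: 'k::field mpoly) ^ c = mpoly_const ((- 1) ^ c)"
  by (induction c) (auto simp: mpoly_const_simps mpoly_const_uminus)

text \<open>A nested chain in the support makes \<open>m\<close> a multiple of the nesting term of a
  minor. Modulo that minor, \<open>m\<close> becomes a combination of monomials of the same degree
  and larger weight, so the distance to the weight bound decreases.\<close>

lemma reducible_monomial:
  assumes "Poly_Mapping.keys m \<subseteq> skew_vars n" "total_degree m = l"
  shows "reducible l (Poly_Mapping.single m (1::'k::field))"
  using assms
proof (induction "l * (n * n) - weight m" arbitrary: m rule: less_induct)
  case less
  show ?case
  proof (cases "m \<in> nest_free_monomials l")
    case True
    then show ?thesis unfolding reducible_def
      using I_zero[where 'k = 'k] by (intro exI[of _ "Poly_Mapping.single m 1"]) simp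
  next
    case False
    then obtain c where c: "\<forall>a\<le>r. c a \<in> Poly_Mapping.keys m" "\<forall>a<r. inside (c a) (c (Suc a))"
      using less.prems by (auto simp: nest_free_monomials_def nest_level_iff_chain)
    obtain s where s: "strict_mono_on {1..2 * (r + 1)} s" "s ` {1..2 * (r + 1)} \<subseteq> {1..n}"
      and nest: "matching_monomial s (nesting (r + 1)) = (\<Sum>a\<le>r. Poly_Mapping.single (c a) 1)"
      using nested_chain_minor[OF c less.prems(1)] by blast
    let ?N = "nesting (r + 1)" and ?PM = "perfect_matchings (r + 1)"
    let ?x = "\<lambda>M. Poly_Mapping.single (matching_monomial s M) (1::'k)"
    have inc: "snd (c a) < snd (c b)" if "a < b" "b \<le> r" for a b using that
    proof (induction b)
      case (Suc b)
      then have "inside (c b) (c (Suc b))" using c by simp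
      then show ?case using Suc by (cases "a = b") (auto simp: inside_def)
    qed simp
    have inj: "inj_on c {..r}"
    proof (rule inj_onI)
      fix a b assume "a \<in> {..r}" "b \<in> {..r}" "c a = c b"
      then show "a = b" using inc[of a b] inc[of b a] by (cases a b rule: linorder_cases) auto
    qed
    \<comment> \<open>The members of the chain are distinct, so their product is squarefree and
      divides \<open>m\<close>; the truncated difference \<open>m'\<close> is then a true
      quotient.\<close>
    have le: "Poly_Mapping.lookup (\<Sum>a\<le>r. Poly_Mapping.single (c a) (1::nat)) v \<le> Poly_Mapping.lookup m v" for v
    proof -
      have "Poly_Mapping.lookup (\<Sum>a\<le>r. Poly_Mapping.single (c a) (1::nat)) v = (\<Sum>u\<in>c ` {..r}. if u = v then 1 else 0)"
        by (subst sum.reindex[OF inj]) (simp add: lookup_sum lookup_single when_def del: One_nat_def)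
      also have "\<dots> \<le> Poly_Mapping.lookup m v"
        using c(1) by (auto simp: in_keys_iff Suc_le_eq)
      finally show ?thesis .
    qed
    define m' where "m' = m - matching_monomial s ?N"
    have "Poly_Mapping.lookup m' v = Poly_Mapping.lookup m v - Poly_Mapping.lookup (matching_monomial s ?N) v" for v
      unfolding m'_def minus_poly_mapping.rep_eq ..
    then have m': "m = m' + matching_monomial s ?N"
      using le by (intro poly_mapping_eqI) (simp only: lookup_add nest le_add_diff_inverse2)
    have N: "?N \<in> ?PM" by (rule nesting_perfect)
    define P where "P = Pf (r + 1) (\<lambda>a b. generic_skew (s a) (s b) :: 'k mpoly)"
    define \<sigma> where "\<sigma> M = (- 1 :: 'k) ^ crossing_number M" for M
    have P: "P = mpoly_const (\<sigma> ?N) * ?x ?N + (\<Sum>M\<in>?PM - {?N}. mpoly_const (\<sigma> M) * ?x M)"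
      unfolding P_def Pf_generic_skew[OF s(1)] \<sigma>_def
      using sum.remove[OF finite_perfect_matchings N] by (simp add: mpoly_sign)
    have "P \<in> I" using s by (intro I_minor) (auto simp: pfaffian_minors_def P_def)
    moreover have m'_carrier: "Poly_Mapping.single m' (1::'k) \<in> carrier (skew_poly_ring n)"
      using less.prems(1) unfolding m' by (auto simp: skew_carrier_iff keys_add_nat)
    ultimately have "reducible l (Poly_Mapping.single m' 1 * P)" by (intro reducible_ideal I_mult)
    moreover have "reducible l (Poly_Mapping.single (m' + matching_monomial s M) (1::'k))"
      if M: "M \<in> ?PM - {?N}" for M
    proof (rule less.hyps)
      let ?m = "m' + matching_monomial s M"
      have vars: "(s (fst e), s (snd e)) \<in> skew_vars n" if "e \<in> M" for e
        using matching_edge_var[OF s _ that] M by blast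
      have fin: "finite M" using M finite_perfect_matching by blast
      show k: "Poly_Mapping.keys ?m \<subseteq> skew_vars n"
        using less.prems(1) vars fin unfolding m'
        by (auto simp: keys_add_nat matching_monomial_def keys_sum_nat)
      show deg: "total_degree ?m = l"
        using less.prems(2) M total_degree_matching_monomial[of M "r + 1" s]
          total_degree_matching_monomial[OF N, of s] unfolding m' total_degree_add by auto
      have "weight m < weight ?m"
        using nesting_strict_minimal[OF s(1), of M] M unfolding m' by (simp add: weight_add weight_matching_monomial)
      moreover have "weight ?m \<le> l * (n * n)" using weight_le[OF k] deg by simp
      ultimately show "l * (n * n) - weight ?m < l * (n * n) - weight m" by simp
    qed
    \<comment> \<open>Multiplying by the sign of the nesting term, whose square is 1, isolates
      \<open>m\<close> without evaluating that sign.\<close>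
    ultimately have red: "reducible l (mpoly_const (\<sigma> ?N) * (Poly_Mapping.single m' 1 * P +
      (\<Sum>M\<in>?PM - {?N}. mpoly_const (- \<sigma> M) * Poly_Mapping.single (m' + matching_monomial s M) 1)))"
      by (intro reducible_const reducible_add reducible_sum)
    have sp: "Poly_Mapping.single (m' + matching_monomial s M) (1::'k) = Poly_Mapping.single m' 1 * ?x M" for M
      by (simp add: mult_single)
    have "Poly_Mapping.single m' 1 * P +
      (\<Sum>M\<in>?PM - {?N}. mpoly_const (- \<sigma> M) * Poly_Mapping.single (m' + matching_monomial s M) 1) =
      mpoly_const (\<sigma> ?N) * (Poly_Mapping.single m' 1 * ?x ?N)"
      unfolding P sp by (simp add: distrib_left sum_distrib_left mpoly_const_uminus sum_negf mult.left_commute)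
    moreover have "\<sigma> ?N * \<sigma> ?N = 1" by (simp add: \<sigma>_def flip: power_add)
    then have "mpoly_const (\<sigma> ?N) * (mpoly_const (\<sigma> ?N) * x) = x" for x
      by (simp add: mpoly_const_simps flip: mult.assoc) (simp add: mpoly_const_simps flip: mpoly_const_simps(4))
    ultimately show ?thesis using red by (simp add: mult_single m')
  qed
qed

lemma homogeneous_reducible:
  assumes "p \<in> homogeneous_part n l" shows "reducible l (p :: 'k::field mpoly)"
proof -
  have "reducible l (\<Sum>m\<in>Poly_Mapping.keys p. mpoly_const (Poly_Mapping.lookup p m) * Poly_Mapping.single m 1)"
    using assms by (intro reducible_sum reducible_const reducible_monomial)
      (auto simp: homogeneous_part_def skew_carrier_iff)
  also have "(\<Sum>m\<in>Poly_Mapping.keys p. mpoly_const (Poly_Mapping.lookup p m) * Poly_Mapping.single m 1) = p"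
    by (subst (3) poly_mapping_sum_single) (simp add: mpoly_const_def mult_single)
  finally show ?thesis .
qed

end

section \<open>Dimension of the homogeneous components\<close>


text \<open>Dimension in the quotient is taken over the image of this subfield.\<close>

lemma range_mpoly_const_subfield:
  "subfield (range mpoly_const) (skew_poly_ring n :: 'k::field mpoly ring)"
proof -
  let ?R = "skew_poly_ring n :: 'k mpoly ring"
  interpret cring ?R by (rule skew_poly_cring)
  have "subring (range mpoly_const) ?R"
  proof (rule subringI)
    show "range mpoly_const \<subseteq> carrier ?R" using mpoly_const_carrier by blast
    show "\<one>\<^bsub>?R\<^esub> \<in> range mpoly_const" using mpoly_const_simps(2)[where 'k = 'k] by (metis rangeI skew_ring_simps(1))
    fix x y :: "'k mpoly" assume xy: "x \<in> range mpoly_const" "y \<in> range mpoly_const"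
    then obtain a b where ab: "x = mpoly_const a" "y = mpoly_const b" by auto
    show "x \<oplus>\<^bsub>?R\<^esub> y \<in> range mpoly_const" "x \<otimes>\<^bsub>?R\<^esub> y \<in> range mpoly_const"
      by (simp_all add: ab flip: mpoly_const_simps)
    have "\<ominus>\<^bsub>?R\<^esub> x = mpoly_const (- a)"
      using minus_equality[of "mpoly_const (- a)" x] ab mpoly_const_carrier[of a n]
        mpoly_const_carrier[of "- a" n] by (simp add: mpoly_const_uminus)
    then show "\<ominus>\<^bsub>?R\<^esub> x \<in> range mpoly_const" by simp
  qed
  then have sub: "subcring (range mpoly_const) ?R"
    by (intro subcringI) (auto simp: mult.commute)
  have cr: "cring (?R\<lparr>carrier := range mpoly_const\<rparr>)"
    using subcring_iff[of "range mpoly_const"] sub mpoly_const_carrier by blast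
  have "field (?R\<lparr>carrier := range mpoly_const\<rparr>)"
  proof (rule cring.cring_fieldI2[OF cr])
    fix a assume a: "a \<in> carrier (?R\<lparr>carrier := range mpoly_const\<rparr>)" "a \<noteq> \<zero>\<^bsub>?R\<lparr>carrier := range mpoly_const\<rparr>\<^esub>"
    then obtain c where c: "a = mpoly_const c" by auto
    then have "c \<noteq> 0" using a(2) by (auto simp: mpoly_const_simps)
    then have "a * mpoly_const (inverse c) = 1" using c by (simp add: mpoly_const_simps flip: mpoly_const_simps(4))
    then show "\<exists>b\<in>carrier (?R\<lparr>carrier := range mpoly_const\<rparr>).
        a \<otimes>\<^bsub>?R\<lparr>carrier := range mpoly_const\<rparr>\<^esub> b = \<one>\<^bsub>?R\<lparr>carrier := range mpoly_const\<rparr>\<^esub>"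
      by (intro bexI[of _ "mpoly_const (inverse c)"]) auto
  qed simp
  then show ?thesis using mpoly_const_carrier by (intro subfield_iff(1)) auto
qed

context pfaffian_setting
begin

lemma residue_hom:
  "ring_hom_ring (skew_poly_ring n) (pfaffian_ring (r + 1) n) (residue_class (r + 1) n :: 'k::field mpoly \<Rightarrow> _)"
proof -
  have "(residue_class (r + 1) n :: 'k mpoly \<Rightarrow> _) = a_r_coset (skew_poly_ring n) I"
    by (simp add: residue_class_def fun_eq_iff)
  then show ?thesis using ideal.rcos_ring_hom_ring[OF I_ideal] by (simp add: pfaffian_ring_def)
qed

lemma residue_eq_iff:
  assumes "p \<in> carrier (skew_poly_ring n)" "q \<in> carrier (skew_poly_ring n)"
  shows "residue_class (r + 1) n p = residue_class (r + 1) n q \<longleftrightarrow> p - q \<in> (I :: 'k::field mpoly set)"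
proof -
  interpret cring "skew_poly_ring n :: 'k mpoly ring" by (rule skew_poly_cring)
  show ?thesis
    using quotient_eq_iff_same_a_r_cos[OF I_ideal assms] skew_minus[OF assms]
    by (simp add: residue_class_def)
qed

text \<open>Independence of a list means that each entry lies outside the span of the entries after
  it, so both claims go through one induction. An entry inside that span would yield a nonzero
  element of the ideal supported on nest-free monomials.\<close>

lemma nest_free_span:
  fixes ms :: "monomial list"
  defines "K \<equiv> pfaffian_ring_scalars (r + 1) n :: 'k::field mpoly set set"
    and "u \<equiv> \<lambda>m. residue_class (r + 1) n (Poly_Mapping.single m (1::'k))"
  assumes "distinct ms" "set ms \<subseteq> nest_free_monomials l"
  shows "ring.Span (pfaffian_ring (r + 1) n) K (map u ms) =
      residue_class (r + 1) n ` {g. Poly_Mapping.keys g \<subseteq> set ms} \<and>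
    ring.independent (pfaffian_ring (r + 1) n) K (map u ms)"
  using assms(3,4)
proof (induction ms)
  case Nil
  interpret h: ring_hom_ring "skew_poly_ring n" "pfaffian_ring (r + 1) n"
    "residue_class (r + 1) n :: 'k mpoly \<Rightarrow> _" by (rule residue_hom)
  have "{g. Poly_Mapping.keys g \<subseteq> {}} = {0 :: 'k mpoly}"
    by (auto intro!: poly_mapping_eqI simp: in_keys_iff)
  then show ?case using h.hom_zero h.S.Span.simps[of K "[]"] h.S.independent.intros(1)[of K] by simp
next
  case (Cons m ms)
  let ?Q = "pfaffian_ring (r + 1) n :: 'k mpoly set ring" and ?rc = "residue_class (r + 1) n :: 'k mpoly \<Rightarrow> _"
  interpret h: ring_hom_ring "skew_poly_ring n" ?Q ?rc by (rule residue_hom)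
  let ?N = "\<lambda>ms. {g :: 'k mpoly. Poly_Mapping.keys g \<subseteq> set ms}"
  have car: "g \<in> carrier (skew_poly_ring n)" if "Poly_Mapping.keys g \<subseteq> nest_free_monomials l" for g :: "'k mpoly"
    using that by (auto simp: skew_carrier_iff nest_free_monomials_def)
  have mono: "Poly_Mapping.single m (1::'k) \<in> carrier (skew_poly_ring n)"
    using Cons.prems by (intro car) auto
  have IH: "h.S.Span K (map u ms) = ?rc ` ?N ms" "h.S.independent K (map u ms)"
    using Cons by auto
  have lin: "?rc (mpoly_const c) \<otimes>\<^bsub>?Q\<^esub> u m \<oplus>\<^bsub>?Q\<^esub> ?rc g = ?rc (mpoly_const c * Poly_Mapping.single m 1 + g)"
    if "g \<in> ?N ms" for c g
  proof -
    have "g \<in> carrier (skew_poly_ring n)" using that Cons.prems by (intro car) auto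
    then show ?thesis using mono mpoly_const_carrier[of c n] h.hom_mult h.hom_add
      skew_carrier_closed(2)[OF mpoly_const_carrier mono, of c] unfolding u_def
      by (metis skew_ring_simps(3,4))
  qed
  have "h.S.Span K (map u (m # ms)) = h.S.line_extension K (u m) (?rc ` ?N ms)"
    using IH(1) h.S.Span.simps[of K "map u ms"] h.S.Span.simps[of K "map u (m # ms)"] by simp
  also have "\<dots> = ?rc ` ?N (m # ms)"
  proof (intro equalityI subsetI)
    fix x assume "x \<in> h.S.line_extension K (u m) (?rc ` ?N ms)"
    then obtain c g where cg: "g \<in> ?N ms" "x = ?rc (mpoly_const c) \<otimes>\<^bsub>?Q\<^esub> u m \<oplus>\<^bsub>?Q\<^esub> ?rc g"
      unfolding h.S.line_extension_mem_iff K_def pfaffian_ring_scalars_def by blast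
    moreover have "Poly_Mapping.keys (mpoly_const c * Poly_Mapping.single m 1 + g) \<subseteq> set (m # ms)"
      using cg(1) keys_add[of "mpoly_const c * Poly_Mapping.single m 1" g]
      by (auto simp: mpoly_const_def mult_single split: if_splits)
    ultimately show "x \<in> ?rc ` ?N (m # ms)" using lin by auto
  next
    fix x assume "x \<in> ?rc ` ?N (m # ms)"
    then obtain g where g: "Poly_Mapping.keys g \<subseteq> set (m # ms)" "x = ?rc g" by auto
    let ?c = "Poly_Mapping.lookup g m"
    define g' where "g' = g - mpoly_const ?c * Poly_Mapping.single m 1"
    have "Poly_Mapping.lookup g' v = (if v = m then 0 else Poly_Mapping.lookup g v)" for v
      by (auto simp: g'_def mpoly_const_def mult_single lookup_minus lookup_single when_def)
    then have "g' \<in> ?N ms" using g(1) by (auto simp: in_keys_iff split: if_splits)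
    moreover have "g = mpoly_const ?c * Poly_Mapping.single m 1 + g'" by (simp add: g'_def)
    ultimately have "x = ?rc (mpoly_const ?c) \<otimes>\<^bsub>?Q\<^esub> u m \<oplus>\<^bsub>?Q\<^esub> ?rc g'" using lin g(2) by simp
    then show "x \<in> h.S.line_extension K (u m) (?rc ` ?N ms)"
      using \<open>g' \<in> ?N ms\<close> unfolding h.S.line_extension_mem_iff K_def pfaffian_ring_scalars_def by blast
  qed
  finally have span: "h.S.Span K (map u (m # ms)) = ?rc ` ?N (m # ms)" .
  have "u m \<notin> h.S.Span K (map u ms)"
  proof
    assume "u m \<in> h.S.Span K (map u ms)"
    then obtain g where g: "Poly_Mapping.keys g \<subseteq> set ms" "?rc (Poly_Mapping.single m 1) = ?rc g"
      using IH(1) by (auto simp: u_def)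
    let ?p = "Poly_Mapping.single m 1 - g"
    have "g \<in> carrier (skew_poly_ring n)" using g Cons.prems by (intro car) auto
    then have "?p \<in> I" using residue_eq_iff[OF mono] g(2) by blast
    moreover have "Poly_Mapping.keys ?p \<subseteq> nest_free_monomials l"
      using keys_minus_subset[of "Poly_Mapping.single m 1" g] g Cons.prems by auto
    then have "Poly_Mapping.keys v \<subseteq> skew_vars n \<and> nest_level (Poly_Mapping.keys v) r = {}"
      if "v \<in> Poly_Mapping.keys ?p" for v
      using that unfolding nest_free_monomials_def by blast
    ultimately have "?p = 0" using nest_free_independent[OF I_rank_subst] by blast
    then have "Poly_Mapping.lookup ?p m = 0" by simp
    moreover have "Poly_Mapping.lookup g m = 0" using g(1) Cons.prems(1) by (auto simp: in_keys_iff)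
    ultimately show False by (simp add: lookup_minus)
  qed
  moreover have "u m \<in> carrier ?Q" using h.hom_closed[OF mono] by (simp add: u_def)
  ultimately have "h.S.independent K (map u (m # ms))"
    using IH(2) h.S.independent.intros(2)[of "u m" K "map u ms"] by simp
  then show ?case using span by simp
qed

lemma pfaffian_ring_dim_eq:
  "pfaffian_ring_dim TYPE('k::field) (r + 1) n l = card (nest_free_monomials l)"
proof -
  let ?Q = "pfaffian_ring (r + 1) n :: 'k mpoly set ring" and ?rc = "residue_class (r + 1) n :: 'k mpoly \<Rightarrow> _"
  let ?K = "pfaffian_ring_scalars (r + 1) n :: 'k mpoly set set"
  interpret h: ring_hom_ring "skew_poly_ring n" ?Q ?rc by (rule residue_hom)
  \<comment> \<open>The image of the scalars is a field only in a nonzero quotient;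
    \<open>rank_subst r\<close> fixes 1 and thereby keeps it out of the ideal.\<close>
  have "\<one>\<^bsub>?Q\<^esub> \<noteq> \<zero>\<^bsub>?Q\<^esub>"
  proof
    assume "\<one>\<^bsub>?Q\<^esub> = \<zero>\<^bsub>?Q\<^esub>"
    then have "?rc 1 = ?rc 0" using h.hom_one h.hom_zero by simp
    then have "1 - 0 \<in> (I :: 'k mpoly set)"
      using residue_eq_iff[OF skew_zero_one_carrier(2,1), where 'k = 'k] by blast
    then have "rank_subst r (1 - 0 :: 'k mpoly) = 0" by (rule I_rank_subst)
    then show False by (simp add: rank_subst_def poly_subst_one)
  qed
  then have K: "subfield ?K ?Q"
    using h.img_is_subfield(2)[OF range_mpoly_const_subfield] by (simp add: pfaffian_ring_scalars_def)
  obtain ms where ms: "set ms = nest_free_monomials l" "distinct ms"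
    using finite_distinct_list[OF finite_nest_free_monomials] by blast
  let ?us = "map (\<lambda>m. ?rc (Poly_Mapping.single m 1)) ms"
  have span: "h.S.Span ?K ?us = ?rc ` {g. Poly_Mapping.keys g \<subseteq> nest_free_monomials l}"
    and ind: "h.S.independent ?K ?us"
    using nest_free_span[OF ms(2) equalityD1[OF ms(1)], where 'k = 'k] ms(1) by simp_all
  have "?rc ` {g. Poly_Mapping.keys g \<subseteq> nest_free_monomials l} = pfaffian_ring_part (r + 1) n l"
    unfolding pfaffian_ring_part_def
  proof (intro equalityI subsetI)
    fix x assume "x \<in> ?rc ` {g. Poly_Mapping.keys g \<subseteq> nest_free_monomials l}"
    then obtain g where "Poly_Mapping.keys g \<subseteq> nest_free_monomials l" "x = ?rc g" by blast
    then show "x \<in> ?rc ` homogeneous_part n l"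
      by (intro image_eqI[of _ _ g]) (auto simp: homogeneous_part_def skew_carrier_iff nest_free_monomials_def)
  next
    fix x assume "x \<in> ?rc ` homogeneous_part n l"
    then obtain p where p: "p \<in> homogeneous_part n l" "x = ?rc p" by blast
    then obtain g where g: "Poly_Mapping.keys g \<subseteq> nest_free_monomials l" "p - g \<in> I"
      using homogeneous_reducible[OF p(1)] by (auto simp: reducible_def)
    have "p \<in> carrier (skew_poly_ring n)" "g \<in> carrier (skew_poly_ring n)"
      using p g by (auto simp: homogeneous_part_def skew_carrier_iff nest_free_monomials_def)
    then have "x = ?rc g" using residue_eq_iff g(2) p(2) by blast
    then show "x \<in> ?rc ` {g. Poly_Mapping.keys g \<subseteq> nest_free_monomials l}" using g(1) by blast
  qed
  then have "h.S.dimension (length ?us) ?K (pfaffian_ring_part (r + 1) n l)"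
    using h.S.dimension_independent[OF ind] span by simp
  then have "h.S.dim ?K (pfaffian_ring_part (r + 1) n l) = length ?us"
    using h.S.dimI[OF K] by (simp add: over_def)
  then show ?thesis unfolding pfaffian_ring_dim_def
    using ms distinct_card[OF ms(2)] by simp
qed

end

section \<open>Summing over families of lattice paths\<close>


definition monomials_between :: "(nat \<times> nat) set \<Rightarrow> (nat \<times> nat) set \<Rightarrow> nat \<Rightarrow> monomial set" where
  "monomials_between S W l =
     {m. S \<subseteq> Poly_Mapping.keys m \<and> Poly_Mapping.keys m \<subseteq> W \<and> total_degree m = l}"

definition between_series :: "(nat \<times> nat) set \<Rightarrow> (nat \<times> nat) set \<Rightarrow> rat fps" where
  "between_series S W = Abs_fps (\<lambda>l. of_nat (card (monomials_between S W l)))"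

lemma total_degree_eq_0_iff: "total_degree m = 0 \<longleftrightarrow> m = 0"
proof
  assume "total_degree m = 0"
  then have "Poly_Mapping.lookup m v = 0" for v
    by (cases v) (auto simp: total_degree_def in_keys_iff)
  then show "m = 0" by (intro poly_mapping_eqI) simp
qed simp

lemma finite_monomials_between: "finite W \<Longrightarrow> finite (monomials_between S W l)"
  by (rule finite_subset[OF _ finite_monomials_of_degree[of W l]]) (auto simp: monomials_between_def)

text \<open>Division by \<open>v\<close> is the bijection. The quotient may have lost
  \<open>v\<close> from its support, hence the lower bound \<open>S - {v}\<close>.\<close>

lemma card_monomials_containing:
  assumes "v \<in> W"
  shows "card {m \<in> monomials_between S W (Suc l). v \<in> Poly_Mapping.keys m} =
    card (monomials_between (S - {v}) W l)"
proof -
  let ?f = "\<lambda>m :: monomial. m + Poly_Mapping.single v 1"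
  have "bij_betw ?f (monomials_between (S - {v}) W l) {m \<in> monomials_between S W (Suc l). v \<in> Poly_Mapping.keys m}"
    unfolding bij_betw_def
  proof (intro conjI equalityI subsetI)
    show "inj_on ?f (monomials_between (S - {v}) W l)" by (intro inj_onI) simp
  next
    fix m assume "m \<in> ?f ` monomials_between (S - {v}) W l"
    then show "m \<in> {m \<in> monomials_between S W (Suc l). v \<in> Poly_Mapping.keys m}"
      using assms by (auto simp: monomials_between_def keys_add_nat total_degree_add)
  next
    fix m assume m: "m \<in> {m \<in> monomials_between S W (Suc l). v \<in> Poly_Mapping.keys m}"
    define m' where "m' = m - Poly_Mapping.single v 1"
    have l: "Poly_Mapping.lookup m' u = Poly_Mapping.lookup m u - Poly_Mapping.lookup (Poly_Mapping.single v 1) u" for u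
      unfolding m'_def minus_poly_mapping.rep_eq ..
    have eq: "m = ?f m'"
      using m by (intro poly_mapping_eqI) (auto simp: l lookup_add lookup_single when_def in_keys_iff)
    have "total_degree m = Suc l" using m by (simp add: monomials_between_def)
    then have "total_degree m' = l" using eq by (simp add: total_degree_add)
    moreover have "u \<in> Poly_Mapping.keys m' \<longleftrightarrow> u \<in> Poly_Mapping.keys m" if "u \<noteq> v" for u
      using that by (simp add: in_keys_iff l lookup_single when_def)
    then have "Poly_Mapping.keys m' \<subseteq> insert v (Poly_Mapping.keys m)"
      "Poly_Mapping.keys m \<subseteq> insert v (Poly_Mapping.keys m')"
      by (metis insert_iff subsetI)+
    moreover have "S \<subseteq> Poly_Mapping.keys m" "Poly_Mapping.keys m \<subseteq> W" using m by (auto simp: monomials_between_def)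
    ultimately have "m' \<in> monomials_between (S - {v}) W l"
      using assms \<open>Poly_Mapping.keys m' \<subseteq> insert v (Poly_Mapping.keys m)\<close> unfolding monomials_between_def
      by blast
    then show "m \<in> ?f ` monomials_between (S - {v}) W l" using eq by blast
  qed
  then show ?thesis by (simp add: bij_betw_same_card)
qed

lemma between_series_remove_lower:
  assumes "v \<in> S" "v \<in> W"
  shows "between_series S W = fps_X * between_series (S - {v}) W"
proof (rule fps_ext)
  fix l
  show "fps_nth (between_series S W) l = fps_nth (fps_X * between_series (S - {v}) W) l"
  proof (cases l)
    case 0
    have "m \<notin> monomials_between S W 0" for m
      using assms by (auto simp: monomials_between_def total_degree_eq_0_iff)
    then have "monomials_between S W 0 = {}" by blast
    then show ?thesis using 0 by (simp add: between_series_def)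
  next
    case (Suc k)
    have "{m \<in> monomials_between S W (Suc k). v \<in> Poly_Mapping.keys m} = monomials_between S W (Suc k)"
      using assms by (auto simp: monomials_between_def)
    then show ?thesis using card_monomials_containing[OF assms(2), of S k] Suc
      by (simp add: between_series_def)
  qed
qed

lemma between_series_remove_upper:
  assumes "v \<notin> S" "v \<in> W" "finite W"
  shows "(1 - fps_X) * between_series S W = between_series S (W - {v})"
proof (rule fps_ext)
  fix l
  show "fps_nth ((1 - fps_X) * between_series S W) l = fps_nth (between_series S (W - {v})) l"
  proof (cases l)
    case 0
    have "monomials_between S W 0 = monomials_between S (W - {v}) 0"
      by (auto simp: monomials_between_def total_degree_def in_keys_iff)
    then show ?thesis using 0 by (simp add: between_series_def left_diff_distrib)
  next
    case (Suc k)
    let ?A = "{m \<in> monomials_between S W (Suc k). v \<in> Poly_Mapping.keys m}"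
    have split: "monomials_between S W (Suc k) = ?A \<union> monomials_between S (W - {v}) (Suc k)"
      by (auto simp: monomials_between_def)
    have "card (?A \<union> monomials_between S (W - {v}) (Suc k)) = card ?A + card (monomials_between S (W - {v}) (Suc k))"
    proof (rule card_Un_disjoint)
      show "finite ?A" using finite_monomials_between[OF assms(3), of S "Suc k"] by simp
      show "finite (monomials_between S (W - {v}) (Suc k))" using assms(3) by (simp add: finite_monomials_between)
    qed (auto simp: monomials_between_def)
    then have "card (monomials_between S W (Suc k)) = card ?A + card (monomials_between S (W - {v}) (Suc k))"
      using split by argo
    then show ?thesis using card_monomials_containing[OF assms(2), of S k] assms(1) Suc
      by (simp add: between_series_def left_diff_distrib)
  qed
qed

text \<open>Each variable of \<open>S\<close> contributes \<open>z / (1 - z)\<close> and each other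
  variable of \<open>W\<close> contributes \<open>1 / (1 - z)\<close>, so the denominator depends on
  \<open>card W\<close> alone.\<close>

lemma between_series_eq:
  assumes "finite W" "S \<subseteq> W"
  shows "between_series S W * (1 - fps_X) ^ card W = fps_X ^ card S"
proof -
  have base: "between_series {} W * (1 - fps_X) ^ card W = 1"
    using assms(1)
  proof (induction W rule: finite_induct)
    case empty
    have "card (monomials_between {} {} l) = (if l = 0 then 1 else 0)" for l
    proof -
      have "monomials_between {} {} l = (if l = 0 then {0} else {})"
        by (auto simp: monomials_between_def)
      then show ?thesis by simp
    qed
    then show ?case by (intro fps_ext) (simp add: between_series_def)
  next
    case (insert v W)
    have "(1 - fps_X) * between_series {} (insert v W) = between_series {} W"
      using between_series_remove_upper[of v "{}" "insert v W"] insert by simp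
    moreover have "between_series {} (insert v W) * ((1 - fps_X) * (1 - fps_X) ^ card W) =
        ((1 - fps_X) * between_series {} (insert v W)) * (1 - fps_X) ^ card W" by (simp only: mult_ac)
    ultimately show ?case using insert by simp
  qed
  have "finite S" using assms finite_subset by blast
  then show ?thesis using assms(2)
  proof (induction S rule: finite_induct)
    case empty
    then show ?case using base by simp
  next
    case (insert v S)
    then have "between_series (insert v S) W = fps_X * between_series S W"
      using between_series_remove_lower[of v "insert v S" W] by simp
    then show ?case using insert by (simp add: mult.assoc)
  qed
qed

text \<open>Each step raises the coordinate sum by one. The position in the list therefore
  determines the antidiagonal, and the end points determine the length.\<close>

lemma path_nth:
  assumes "path_from_to A E L"
  shows "Suc t < length L \<Longrightarrow> horizontal_step (L ! t) (L ! Suc t) \<or> vertical_step (L ! t) (L ! Suc t)"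
    and "t < length L \<Longrightarrow> fst (L ! t) + snd (L ! t) = fst A + snd A + int t"
    and "L \<noteq> []" "L ! 0 = A" "L ! (length L - 1) = E"
    and "int (length L) = fst E + snd E - fst A - snd A + 1"
proof -
  show step: "horizontal_step (L ! t) (L ! Suc t) \<or> vertical_step (L ! t) (L ! Suc t)" if "Suc t < length L" for t
    using assms that by (auto simp: path_from_to_def lattice_path_def successively_conv_nth)
  show ne: "L \<noteq> []" using assms by (auto simp: path_from_to_def lattice_path_def)
  show L0: "L ! 0 = A" using assms ne by (auto simp: path_from_to_def hd_conv_nth)
  show L1: "L ! (length L - 1) = E" using assms ne by (auto simp: path_from_to_def last_conv_nth)
  show sum: "fst (L ! t) + snd (L ! t) = fst A + snd A + int t" if "t < length L" for t
    using that
  proof (induction t)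
    case 0
    then show ?case using L0 by simp
  next
    case (Suc t)
    then show ?case using step[of t] by (auto simp: horizontal_step_def vertical_step_def)
  qed
  have "length L - 1 < length L" using ne by simp
  then have "fst E + snd E = fst A + snd A + int (length L - 1)" using sum L1 by metis
  moreover have "int (length L) = int (length L - 1) + 1" using ne by (cases L) auto
  ultimately show "int (length L) = fst E + snd E - fst A - snd A + 1" by linarith
qed

section \<open>Families of lattice paths as column functions\<close>

context pfaffian_setting
begin

definition path_length :: nat where "path_length = Suc (2 * (n - 2 * r))"

lemma path_length_eq: "int path_length = hi - lo + 1"
  using n_ge by (simp add: path_length_def hi_def lo_def of_nat_diff)

abbreviation families where "families \<equiv> path_families r (start_point r) (end_point n r)"

text \<open>The lattice point \<open>(x, y)\<close> stands for the variable \<open>(i, j) = (y, x + 1)\<close>.\<close>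

definition crossing_columns :: "(nat \<Rightarrow> point list) \<Rightarrow> nat \<Rightarrow> int \<Rightarrow> int" where
  "crossing_columns P k s =
     (if lo \<le> s \<and> s \<le> hi then fst (P (Suc k) ! nat (s - lo)) + 1 else zigzag k s)"

definition family_of :: "(nat \<Rightarrow> int \<Rightarrow> int) \<Rightarrow> nat \<Rightarrow> point list" where
  "family_of q = (\<lambda>i\<in>{1..r}. map (\<lambda>t. (q (i - 1) (lo + int t) - 1, int t + 2 * int r + 1 - q (i - 1) (lo + int t)))
     [0..<path_length])"

context
  fixes P assumes P: "P \<in> families"
begin

lemma family_path:
  assumes "k < r"
  shows "path_from_to (start_point r (Suc k)) (end_point n r (Suc k)) (P (Suc k))"
    "below_diagonal (P (Suc k))"
  using P assms by (auto simp: path_families_def PiE_def Pi_def)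

lemma family_length:
  assumes "k < r" shows "length (P (Suc k)) = path_length"
proof -
  have "int (length (P (Suc k))) = hi - lo + 1"
    using path_nth(6)[OF family_path(1)[OF assms]] by (simp add: start_point_def end_point_def hi_def lo_def)
  then show ?thesis using path_length_eq by simp
qed

lemma family_nth:
  assumes "k < r" "t < path_length"
  shows "P (Suc k) ! t = (crossing_columns P k (lo + int t) - 1,
    int t + 2 * int r + 1 - crossing_columns P k (lo + int t))"
proof -
  have "lo + int t \<le> hi" using assms(2) path_length_eq by linarith
  then have c: "crossing_columns P k (lo + int t) = fst (P (Suc k) ! t) + 1" by (simp add: crossing_columns_def)
  have "fst (P (Suc k) ! t) + snd (P (Suc k) ! t) = 2 * int r + int t"
    using path_nth(2)[OF family_path(1)[OF assms(1)], of t] assms family_length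
    by (simp add: start_point_def)
  then show ?thesis using c by (intro prod_eqI) auto
qed

lemma crossing_columns_ends:
  assumes "k < r"
  shows "crossing_columns P k lo = zigzag k lo" "crossing_columns P k hi = zigzag k hi"
proof -
  note p = family_path(1)[OF assms]
  show "crossing_columns P k lo = zigzag k lo"
    using path_nth(4)[OF p] lo_le_hi by (simp add: crossing_columns_def start_point_def zigzag_def lo_def)
  have "nat (hi - lo) = length (P (Suc k)) - 1"
    using path_length_eq family_length[OF assms] by linarith
  then show "crossing_columns P k hi = zigzag k hi"
    using path_nth(5)[OF p] lo_le_hi by (simp add: crossing_columns_def end_point_def zigzag_def hi_def)
qed

lemma crossing_columns_step:
  assumes k: "k < r" and t: "Suc t < path_length"
  shows "horizontal_step (P (Suc k) ! t) (P (Suc k) ! Suc t) \<longleftrightarrow>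
      crossing_columns P k (lo + int t + 1) = crossing_columns P k (lo + int t) + 1"
    "vertical_step (P (Suc k) ! t) (P (Suc k) ! Suc t) \<longleftrightarrow>
      crossing_columns P k (lo + int t + 1) = crossing_columns P k (lo + int t)"
  using family_nth[OF k, of t] family_nth[OF k, of "Suc t"] t
  by (auto simp: horizontal_step_def vertical_step_def algebra_simps)

lemma crossing_columns_good: "good_family (crossing_columns P)"
  unfolding good_family_def
proof (intro conjI allI impI)
  fix k s assume k: "k < r"
  have z: "zigzag k (s + 1) = zigzag k s \<or> zigzag k (s + 1) = zigzag k s + 1"
    unfolding zigzag_def by linarith
  consider "lo \<le> s" "s + 1 \<le> hi" | "s + 1 = lo" | "s = hi" | "s + 1 < lo \<or> hi < s" by linarith
  then show "crossing_columns P k (s + 1) = crossing_columns P k s \<or>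
      crossing_columns P k (s + 1) = crossing_columns P k s + 1"
  proof cases
    case 1
    define t where "t = nat (s - lo)"
    have t: "s = lo + int t" "Suc t < path_length" using 1 path_length_eq by (auto simp: t_def)
    then show ?thesis
      using path_nth(1)[OF family_path(1)[OF k], of t] family_length[OF k] crossing_columns_step[OF k t(2)]
      by auto
  qed (use z crossing_columns_ends[OF k] lo_le_hi in \<open>auto simp: crossing_columns_def\<close>)
next
  fix k s assume "k < r" "s \<le> lo \<or> hi \<le> s"
  then show "crossing_columns P k s = zigzag k s"
    using crossing_columns_ends[of k] by (auto simp: crossing_columns_def)
next
  fix k s assume k: "Suc k < r"
  \<comment> \<open>After \<open>t\<close> steps both paths are on the same antidiagonal, and each
    step moves a column by 0 or 1. The order could be lost only in a common lattice point.\<close>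
  have "crossing_columns P k (lo + int t) < crossing_columns P (Suc k) (lo + int t)" if "t < path_length" for t
    using that
  proof (induction t)
    case 0
    then show ?case using crossing_columns_ends(1)[of k] crossing_columns_ends(1)[of "Suc k"] k
      by (simp add: zigzag_def)
  next
    case (Suc t)
    have mono: "crossing_columns P l (lo + int (Suc t)) = crossing_columns P l (lo + int t) \<or>
      crossing_columns P l (lo + int (Suc t)) = crossing_columns P l (lo + int t) + 1" if l: "l < r" for l
      using path_nth(1)[OF family_path(1)[OF l], of t] family_length[OF l] crossing_columns_step[OF l Suc.prems]
        Suc.prems by (auto simp: algebra_simps)
    have "P (Suc k) ! Suc t \<noteq> P (Suc (Suc k)) ! Suc t"
    proof
      assume "P (Suc k) ! Suc t = P (Suc (Suc k)) ! Suc t"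
      moreover have "P (Suc k) ! Suc t \<in> set (P (Suc k))" "P (Suc (Suc k)) ! Suc t \<in> set (P (Suc (Suc k)))"
        using Suc.prems family_length k by auto
      moreover have "set (P (Suc k)) \<inter> set (P (Suc (Suc k))) = {}"
        using P k unfolding path_families_def by auto
      ultimately show False by auto
    qed
    then have "crossing_columns P k (lo + int (Suc t)) \<noteq> crossing_columns P (Suc k) (lo + int (Suc t))"
      using family_nth[OF _ Suc.prems, of k] family_nth[OF _ Suc.prems, of "Suc k"] k by auto
    then show ?case using mono[of k] mono[of "Suc k"] Suc k by linarith
  qed
  from this[of "nat (s - lo)"] show "crossing_columns P k s < crossing_columns P (Suc k) s"
    using path_length_eq by (cases "lo \<le> s \<and> s \<le> hi") (auto simp: crossing_columns_def zigzag_def)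
next
  fix s
  show "s < 2 * crossing_columns P 0 s"
  proof (cases "lo \<le> s \<and> s \<le> hi")
    case True
    define t where "t = nat (s - lo)"
    have t: "s = lo + int t" "t < path_length" using True path_length_eq by (auto simp: t_def)
    have r0: "0 < r" using r_pos by simp
    have "P (Suc 0) ! t \<in> set (P (Suc 0))" using t family_length[OF r0] by simp
    then have "snd (P (Suc 0) ! t) \<le> fst (P (Suc 0) ! t)"
      using family_path(2)[OF r0] by (auto simp: below_diagonal_def)
    then show ?thesis using family_nth[OF r0 t(2)] t(1) by (simp add: lo_def)
  next
    case False
    then show ?thesis by (auto simp: crossing_columns_def zigzag_def)
  qed
qed

text \<open>The bounds in \<open>turn_at\<close> select the points that have both a preceding and a
  following step in the list. Turns on different paths are different variables, so the numbers add
  up.\<close>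

lemma NE_family_eq: "NE_family r P = card (turns (crossing_columns P))"
proof -
  let ?q = "crossing_columns P"
  note q = crossing_columns_good
  define T where "T k = {v \<in> skew_vars n. ?q k (vsum v) = int (snd v) \<and> turn_at (?q k) (vsum v)}" for k
  let ?f = "\<lambda>v :: nat \<times> nat. (int (snd v) - 1, int (fst v))"
  have fin: "finite (T k)" for k using finite_skew_vars by (simp add: T_def)
  have NE: "NE (P (Suc k)) = card (T k)" if k: "k < r" for k
  proof -
    have img: "?f ` T k = NE_turns (P (Suc k))"
    proof (intro equalityI subsetI)
      fix p assume "p \<in> ?f ` T k"
      then obtain v where v: "v \<in> T k" "p = ?f v" by auto
      define t where "t = nat (vsum v - lo - 1)"
      have s: "lo < vsum v" "vsum v < hi" using v by (auto simp: T_def turn_at_def)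
      then have t: "vsum v = lo + int t + 1" "Suc (Suc t) < path_length"
        using path_length_eq by (auto simp: t_def)
      have "P (Suc k) ! Suc t = p"
        using family_nth[OF k, of "Suc t"] t v by (auto simp: T_def lo_def vsum_def algebra_simps)
      moreover have "vertical_step (P (Suc k) ! t) (P (Suc k) ! Suc t)"
        "horizontal_step (P (Suc k) ! Suc t) (P (Suc k) ! Suc (Suc t))"
        using crossing_columns_step[OF k, of t] crossing_columns_step[OF k, of "Suc t"] t v
        by (auto simp: T_def turn_at_def algebra_simps)
      ultimately show "p \<in> NE_turns (P (Suc k))"
        using t(2) family_length[OF k] unfolding NE_turns_def by (intro CollectI exI[of _ t]) simp
    next
      fix p assume "p \<in> NE_turns (P (Suc k))"
      then obtain t where t: "p = P (Suc k) ! Suc t" "Suc (Suc t) < path_length"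
        "vertical_step (P (Suc k) ! t) (P (Suc k) ! Suc t)"
        "horizontal_step (P (Suc k) ! Suc t) (P (Suc k) ! Suc (Suc t))"
        using family_length[OF k] by (auto simp: NE_turns_def)
      have s: "lo < lo + int t + 1" "lo + int t + 1 < hi" using t(2) path_length_eq by auto
      obtain v where v: "v \<in> skew_vars n" "vsum v = lo + int t + 1" "int (snd v) = ?q k (lo + int t + 1)"
        using path_point_var[OF q k, of "lo + int t + 1"] s by auto
      have "v \<in> T k"
        using v s crossing_columns_step[OF k, of t] crossing_columns_step[OF k, of "Suc t"] t
        by (auto simp: T_def turn_at_def algebra_simps)
      moreover have "?f v = p"
        using family_nth[OF k, of "Suc t"] t v by (auto simp: lo_def vsum_def algebra_simps)
      ultimately show "p \<in> ?f ` T k" by blast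
    qed
    have "inj_on ?f (T k)" by (auto simp: inj_on_def)
    then show ?thesis unfolding NE_def img[symmetric] by (rule card_image)
  qed
  have "NE_family r P = (\<Sum>k<r. NE (P (Suc k)))"
    unfolding NE_family_def by (rule sum.reindex_bij_witness[of _ Suc "\<lambda>i. i - 1"]) auto
  also have "\<dots> = (\<Sum>k<r. card (T k))" using NE by simp
  also have "\<dots> = card (\<Union>k<r. T k)"
  proof (rule card_UN_disjoint[symmetric])
    show "\<forall>i\<in>{..<r}. \<forall>j\<in>{..<r}. i \<noteq> j \<longrightarrow> T i \<inter> T j = {}"
    proof (intro ballI impI)
      fix i j assume ij: "i \<in> {..<r}" "j \<in> {..<r}" "i \<noteq> j"
      show "T i \<inter> T j = {}"
      proof (rule ccontr)
        assume "T i \<inter> T j \<noteq> {}"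
        then obtain v where "v \<in> T i" "v \<in> T j" by blast
        then have eq: "?q i (vsum v) = ?q j (vsum v)" by (simp add: T_def)
        show False using good_inj[OF q _ _ eq] ij by simp
      qed
    qed
  qed (use fin in auto)
  also have "(\<Union>k<r. T k) = turns ?q" by (auto simp: T_def turns_def)
  finally show ?thesis .
qed

end

text \<open>The diagonal condition on columns becomes that on points. Two paths can share a point
  only at equal positions, since the coordinate sum fixes the position, and there the columns
  differ.\<close>

lemma family_of_mem:
  assumes q: "good_family q"
  shows "family_of q \<in> families"
    and "k < r \<Longrightarrow> crossing_columns (family_of q) k s = q k s"
proof -
  have nth: "family_of q (Suc k) ! t = (q k (lo + int t) - 1, int t + 2 * int r + 1 - q k (lo + int t))"
    if "k < r" "t < path_length" for k t
    using that by (simp add: family_of_def)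
  have len: "length (family_of q (Suc k)) = path_length" if "k < r" for k
    using that by (simp add: family_of_def)
  show "crossing_columns (family_of q) k s = q k s" if k: "k < r" for k s
  proof (cases "lo \<le> s \<and> s \<le> hi")
    case True
    then have "nat (s - lo) < path_length" using path_length_eq by linarith
    then show ?thesis using True nth[OF k, of "nat (s - lo)"] by (simp add: crossing_columns_def)
  next
    case False
    then show ?thesis using good_zigzag[OF q k, of s] by (auto simp: crossing_columns_def)
  qed
  have path: "path_from_to (start_point r (Suc k)) (end_point n r (Suc k)) (family_of q (Suc k)) \<and>
    below_diagonal (family_of q (Suc k))" if k: "k < r" for k
  proof
    let ?L = "family_of q (Suc k)"
    have ne: "?L \<noteq> []" using len[OF k] by (auto simp: path_length_def)
    have "horizontal_step (?L ! t) (?L ! Suc t) \<or> vertical_step (?L ! t) (?L ! Suc t)" if "Suc t < length ?L" for t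
      using good_step[OF q k, of "lo + int t"] that nth[OF k, of t] nth[OF k, of "Suc t"] len[OF k]
      by (auto simp: horizontal_step_def vertical_step_def algebra_simps)
    then have "lattice_path ?L" using ne by (auto simp: lattice_path_def successively_conv_nth)
    moreover have "hd ?L = start_point r (Suc k)"
      using ne nth[OF k, of 0] good_zigzag[OF q k, of lo]
      by (simp add: hd_conv_nth path_length_def start_point_def zigzag_def lo_def)
    moreover have "last ?L = end_point n r (Suc k)"
    proof -
      have t: "path_length - 1 < path_length" by (simp add: path_length_def)
      have hi: "lo + int (path_length - 1) = hi" using path_length_eq t by linarith
      have "int (path_length - 1) = 2 * int n - 4 * int r" using hi by (simp add: hi_def lo_def)
      moreover have "q k hi = int n - int r + int k + 1"
        using good_zigzag[OF q k, of hi] by (simp add: zigzag_def hi_def)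
      ultimately have "?L ! (path_length - 1) = end_point n r (Suc k)"
        using nth[OF k t] unfolding hi by (simp add: end_point_def)
      then show ?thesis using ne len[OF k] by (simp add: last_conv_nth)
    qed
    ultimately show "path_from_to (start_point r (Suc k)) (end_point n r (Suc k)) ?L"
      by (simp add: path_from_to_def)
    show "below_diagonal ?L"
      unfolding below_diagonal_def
    proof
      fix p assume "p \<in> set ?L"
      then obtain t where t: "t < path_length" "p = ?L ! t" using len[OF k] by (auto simp: in_set_conv_nth)
      then show "case p of (x, y) \<Rightarrow> y \<le> x"
        using nth[OF k t(1)] good_diag'[OF q k, of "lo + int t"] by (simp add: lo_def)
    qed
  qed
  have disjoint: "set (family_of q (Suc k)) \<inter> set (family_of q (Suc l)) = {}" if kl: "k < r" "l < r" "k \<noteq> l" for k l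
  proof (rule ccontr)
    assume "set (family_of q (Suc k)) \<inter> set (family_of q (Suc l)) \<noteq> {}"
    then obtain p where "p \<in> set (family_of q (Suc k))" "p \<in> set (family_of q (Suc l))" by blast
    then obtain t u where "t < path_length" "u < path_length"
      "family_of q (Suc k) ! t = family_of q (Suc l) ! u"
      using len[OF kl(1)] len[OF kl(2)] by (auto simp: in_set_conv_nth)
    then have "t = u \<and> q k (lo + int t) = q l (lo + int u)" using nth[OF kl(1)] nth[OF kl(2)] by auto
    then show False using good_inj[OF q, of k l] kl by blast
  qed
  show "family_of q \<in> families"
    unfolding path_families_def
  proof (intro CollectI conjI ballI impI PiE_I)
    fix i assume "i \<in> {1..r}"
    then have "i = Suc (i - 1)" "i - 1 < r" by auto
    then show "path_from_to (start_point r i) (end_point n r i) (family_of q i)" "below_diagonal (family_of q i)"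
      using path[of "i - 1"] by metis+
  next
    fix i assume "i \<notin> {1..r}"
    then show "family_of q i = undefined" by (auto simp: family_of_def)
  next
    fix i j assume "i \<in> {1..r}" "j \<in> {1..r}" "i \<noteq> j"
    then have "i = Suc (i - 1)" "i - 1 < r" "j = Suc (j - 1)" "j - 1 < r" "i - 1 \<noteq> j - 1" by auto
    then show "set (family_of q i) \<inter> set (family_of q j) = {}" using disjoint by metis
  qed
qed

lemma family_determined:
  assumes P: "P \<in> families" and P': "P' \<in> families"
    and eq: "\<And>k s. k < r \<Longrightarrow> crossing_columns P k s = crossing_columns P' k s"
  shows "P = P'"
proof (rule PiE_ext)
  show "P \<in> (\<Pi>\<^sub>E i \<in> {1..r}. UNIV)" "P' \<in> (\<Pi>\<^sub>E i \<in> {1..r}. UNIV)"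
    using P P' by (auto simp: path_families_def PiE_def)
  fix i assume "i \<in> {1..r}"
  then have i: "i = Suc (i - 1)" "i - 1 < r" by auto
  have "P (Suc (i - 1)) = P' (Suc (i - 1))"
    using family_length[OF P i(2)] family_length[OF P' i(2)] family_nth[OF P i(2)] family_nth[OF P' i(2)] eq[OF i(2)]
    by (intro nth_equalityI) auto
  then show "P i = P' i" using i(1) by metis
qed

text \<open>Both column functions agree with the light family of \<open>F\<close>.\<close>

lemma family_unique:
  assumes "P \<in> families" "turns (crossing_columns P) \<subseteq> F" "F \<subseteq> covers (crossing_columns P)"
    and "P' \<in> families" "turns (crossing_columns P') \<subseteq> F" "F \<subseteq> covers (crossing_columns P')"
  shows "P = P'"
  using good_eq_light_family[OF crossing_columns_good] assms by (intro family_determined) auto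

lemma turns_subset_covers: "turns q \<subseteq> covers q"
  by (auto simp: turns_def covers_def)

lemma covers_subset: "covers q \<subseteq> skew_vars n"
  by (auto simp: covers_def)

text \<open>A family is recovered from the set it covers, by uniqueness applied to that set itself,
  and there are finitely many sets of variables.\<close>

lemma finite_families: "finite families"
proof (rule inj_on_finite)
  show "inj_on (\<lambda>P. covers (crossing_columns P)) families"
  proof (rule inj_onI)
    fix P P' assume PP: "P \<in> families" "P' \<in> families"
      "covers (crossing_columns P) = covers (crossing_columns P')"
    then show "P = P'"
      using turns_subset_covers[of "crossing_columns P"] turns_subset_covers[of "crossing_columns P'"]
      by (intro family_unique[of P "covers (crossing_columns P)" P']) simp_all
  qed
  show "(\<lambda>P. covers (crossing_columns P)) ` families \<subseteq> Pow (skew_vars n)"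
    using covers_subset by auto
qed (simp add: finite_skew_vars)

text \<open>The light family of the support provides a family for every nest-free monomial;
  conversely any set covered by \<open>r\<close> such paths is nest-free.\<close>

lemma nest_free_monomials_partition:
  "nest_free_monomials l =
    (\<Union>P\<in>families. monomials_between (turns (crossing_columns P)) (covers (crossing_columns P)) l)"
proof (intro equalityI subsetI)
  fix m assume m: "m \<in> nest_free_monomials l"
  let ?F = "Poly_Mapping.keys m"
  have F: "?F \<subseteq> skew_vars n" "nest_level ?F r = {}" using m by (auto simp: nest_free_monomials_def)
  let ?q = "light_family ?F"
  let ?c = "crossing_columns (family_of ?q)"
  note fam = family_of_mem[OF light_family_good[OF F(1)]]
  have "turns ?c = turns ?q" "covers ?c = covers ?q"
    using fam(2) by (auto simp: turns_def covers_def turn_at_def)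
  then have "m \<in> monomials_between (turns ?c) (covers ?c) l"
    using turns_light_family[OF F(1)] covers_light_family[OF F] m
    by (simp add: monomials_between_def nest_free_monomials_def)
  then show "m \<in> (\<Union>P\<in>families. monomials_between (turns (crossing_columns P)) (covers (crossing_columns P)) l)"
    using fam(1) by blast
next
  fix m assume "m \<in> (\<Union>P\<in>families. monomials_between (turns (crossing_columns P)) (covers (crossing_columns P)) l)"
  then obtain P where P: "P \<in> families" "Poly_Mapping.keys m \<subseteq> covers (crossing_columns P)" "total_degree m = l"
    by (auto simp: monomials_between_def)
  then show "m \<in> nest_free_monomials l"
    using nest_level_mono[OF P(2), of r] nest_free_covers[OF crossing_columns_good[OF P(1)]]
      covers_subset[of "crossing_columns P"] by (auto simp: nest_free_monomials_def)
qed

lemma card_nest_free_monomials: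
  "card (nest_free_monomials l) =
    (\<Sum>P\<in>families. card (monomials_between (turns (crossing_columns P)) (covers (crossing_columns P)) l))"
  unfolding nest_free_monomials_partition
proof (rule card_UN_disjoint[OF finite_families])
  show "\<forall>P\<in>families. finite (monomials_between (turns (crossing_columns P)) (covers (crossing_columns P)) l)"
    using finite_monomials_between finite_subset[OF covers_subset finite_skew_vars] by blast
  show "\<forall>P\<in>families. \<forall>P'\<in>families. P \<noteq> P' \<longrightarrow>
    monomials_between (turns (crossing_columns P)) (covers (crossing_columns P)) l \<inter>
    monomials_between (turns (crossing_columns P')) (covers (crossing_columns P')) l = {}"
    using family_unique unfolding monomials_between_def by blast
qed

text \<open>Every family covers the same number of variables, so all contributions have a common
  denominator and only the numerators \<open>fps_X ^ NE_family r P\<close> add up.\<close>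

lemma hilbert_series:
  "(Abs_fps (\<lambda>l. of_nat (card (nest_free_monomials l))) :: rat fps) =
    (\<Sum>P\<in>families. fps_X ^ NE_family r P) / (1 - fps_X) ^ (r * (2 * n - 2 * r - 1))"
proof -
  let ?d = "r * (2 * n - 2 * r - 1)"
  let ?G = "\<lambda>P. between_series (turns (crossing_columns P)) (covers (crossing_columns P))"
  have series: "(Abs_fps (\<lambda>l. of_nat (card (nest_free_monomials l))) :: rat fps) = (\<Sum>P\<in>families. ?G P)"
    by (rule fps_ext) (simp add: card_nest_free_monomials fps_sum_nth between_series_def)
  have nz: "(1 - fps_X :: rat fps) ^ ?d \<noteq> 0" by simp
  have "(\<Sum>P\<in>families. ?G P) * (1 - fps_X) ^ ?d = (\<Sum>P\<in>families. fps_X ^ NE_family r P)"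
    unfolding sum_distrib_right
  proof (rule sum.cong)
    fix P assume P: "P \<in> families"
    show "?G P * (1 - fps_X) ^ ?d = fps_X ^ NE_family r P"
      using between_series_eq[OF finite_subset[OF covers_subset finite_skew_vars] turns_subset_covers,
          of "crossing_columns P"] card_covers[OF crossing_columns_good[OF P]] NE_family_eq[OF P] by simp
  qed simp
  from this[symmetric] show ?thesis
    unfolding series by (simp only: nonzero_mult_div_cancel_right[OF nz])
qed

end

theorem proposition1:
  fixes n r :: nat
  assumes "r \<ge> 1" and "n \<ge> 2 * r"
  shows "(Abs_fps (\<lambda>l. of_nat (pfaffian_ring_dim TYPE('k::field) (r + 1) n l)) :: rat fps) =
    (\<Sum>P \<in> path_families r (start_point r) (end_point n r). fps_X ^ NE_family r P) /
    (1 - fps_X) ^ (r * (2 * n - 2 * r - 1))"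
proof -
  interpret pfaffian_setting n r by unfold_locales (use assms in auto)
  show ?thesis unfolding pfaffian_ring_dim_eq by (rule hilbert_series)
qed

end
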